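(* Let $\lambda=\sum_{i=1}^r m_i\omega_i\in P^+$. Then the set $\{b\,w_\lambda : b\in\mathcal B^r(\lambda)\}$ is a basis of the Weyl module $W(\lambda)$ (and distinct elements of $\mathcal B^r(\lambda)$ give distinct basis vectors).
   Context: Let $r\ge1$, $\mathfrak g=\mathfrak{sl}_{r+1}(\mathbb C)$, $\mathfrak h$ the diagonal trace-zero matrices, $\omega_i$ the fundamental weights, $P^+=\sum_i\mathbb N\omega_i$. With matrix units $E_{a,b}$, for $1\le i\le j\le r$ put $x^+_{i,j}=E_{i,j+1}$, $x^-_{i,j}=E_{j+1,i}$, $\mathfrak n^\pm=\bigoplus\mathbb Cx^\pm_{i,j}$. $\mathfrak a[t]=\mathfrak a\otimes\mathbb C[t]$ with the pointwise bracket, $\mathfrak a\equiv\mathfrak a\otimes1$, $\mathfrak at[t]=\mathfrak a\otimes t\mathbb C[t]$. The Weyl module $W(\lambda)$, $\lambda=\sum m_i\omega_i$, is the $\mathfrak g[t]$-module generated by $w_\lambda$ with defining relations $\mathfrak n^+[t]w_\lambda=0$, $\mathfrak ht[t]w_\lambda=0$, $hw_\lambda=\lambda(h)w_\lambda$ ($h\in\mathfrak h$), $(x^-_{i,i}\otimes1)^{m_i+1}w_\lambda=0$ ($1\le i\le r$). Let $\mathbf F$ be the set of pairs $(\ell,\mathbf s)$ with $\ell\in\mathbb N$ and $\mathbf s=(\mathbf s(1)\le\dots\le\mathbf s(\ell))\in\mathbb N^\ell$ (for $\ell=0$, $\mathbf s=\emptyset$). For $m\in\mathbb Z$, $\mathbf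 F(m)=\emptyset$ if $m<0$, and for $m\ge0$, $\mathbf F(m)$ consists of $(0,\emptyset)$ together with the pairs $(\ell,\mathbf s)\in\mathbf F$ with $\ell>0$ and $\mathbf s(\ell)\le m-\ell$. For $(\ell,\mathbf s)\in\mathbf F$ put $\mathbf x^-_{i,j}(\ell,\mathbf s)=\prod_{p=1}^{\ell}(x^-_{i,j}\otimes t^{\mathbf s(p)})\in U(\mathfrak n^-[t])$ (equal to $1$ if $\ell=0$). $\mathcal B^r(\lambda)\subset U(\mathfrak n^-[t])$ is the set of all products $$\mathbf x^-_{1,1}(\ell_{1,1},\mathbf s_{1,1})\,\mathbf x^-_{1,2}(\ell_{1,2},\mathbf s_{1,2})\,\mathbf x^-_{2,2}(\ell_{2,2},\mathbf s_{2,2})\,\mathbf x^-_{1,3}(\ell_{1,3},\mathbf s_{1,3})\cdots\mathbf x^-_{r,r}(\ell_{r,r},\mathbf s_{r,r})$$ (factors ordered by increasing $j$, and for fixed $j$ by increasing $i$) such that $(\ell_{i,j},\mathbf s_{i,j})\in\mathbf F(m_{i,j})$ for all $1\le i\le j\le r$, where $m_{i,j}=m_i+\sum_{s=j+1}^{r}(\ell_{i+1,s}-\ell_{i,s})$. *)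

theory Defs
  imports Complex_Main "HOL-Library.Function_Algebras"
begin

text \<open>Elements of sl_{r+1}[t] = sl_{r+1} (x) C[t] are encoded as functions
  X :: nat => nat => nat => complex, where X k a b is the coefficient of E_{a,b} (x) t^k.\<close>

type_synonym cur = "nat \<Rightarrow> nat \<Rightarrow> nat \<Rightarrow> complex"

definition gt :: "nat \<Rightarrow> cur set" where
  "gt r = {X. (\<exists>N. \<forall>k\<ge>N. \<forall>a b. X k a b = 0)
             \<and> (\<forall>k a b. X k a b \<noteq> 0 \<longrightarrow> a \<in> {1..r+1} \<and> b \<in> {1..r+1})
             \<and> (\<forall>k. (\<Sum>a\<in>{1..r+1}. X k a a) = 0)}"

definition br :: "nat \<Rightarrow> cur \<Rightarrow> cur \<Rightarrow> cur" where
  "br r X Y = (\<lambda>k a b. \<Sum>i\<in>{0..k}. \<Sum>c\<in>{1..r+1}.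
       X i a c * Y (k - i) c b - Y i a c * X (k - i) c b)"

definition nplus_t :: "nat \<Rightarrow> cur set" where
  "nplus_t r = {X \<in> gt r. \<forall>k a b. X k a b \<noteq> 0 \<longrightarrow> a < b}"

definition h_t_pos :: "nat \<Rightarrow> cur set" where
  "h_t_pos r = {X \<in> gt r. (\<forall>k a b. X k a b \<noteq> 0 \<longrightarrow> a = b) \<and> (\<forall>a b. X 0 a b = 0)}"

definition h0 :: "nat \<Rightarrow> cur set" where
  "h0 r = {X \<in> gt r. \<forall>k a b. X k a b \<noteq> 0 \<longrightarrow> a = b \<and> k = 0}"

text \<open>lambda(h) for lambda = sum m_i omega_i, omega_i(diag(d)) = d_1 + ... + d_i\<close>
definition lam :: "nat \<Rightarrow> (nat \<Rightarrow> nat) \<Rightarrow> cur \<Rightarrow> complex" where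
  "lam r m H = (\<Sum>i\<in>{1..r}. of_nat (m i) * (\<Sum>j\<in>{1..i}. H 0 j j))"

definition xminus :: "nat \<Rightarrow> nat \<Rightarrow> nat \<Rightarrow> cur" where
  "xminus i j k = (\<lambda>k' a b. if k' = k \<and> a = j + 1 \<and> b = i then 1 else 0)"

text \<open>Free associative algebra on the set gt r: finitely supported functions on words;
  the product is concatenation-convolution.\<close>
type_synonym tens = "cur list \<Rightarrow> complex"

definition tmono :: "cur list \<Rightarrow> tens" where
  "tmono w = (\<lambda>u. if u = w then 1 else 0)"

definition tmul :: "tens \<Rightarrow> tens \<Rightarrow> tens" where
  "tmul F G = (\<lambda>w. \<Sum>i\<in>{0..length w}. F (take i w) * G (drop i w))"

definition smul :: "complex \<Rightarrow> tens \<Rightarrow> tens" where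
  "smul c F = (\<lambda>w. c * F w)"

definition weyl_rel :: "nat \<Rightarrow> (nat \<Rightarrow> nat) \<Rightarrow> tens set" where
  "weyl_rel r m =
     {tmono [x] | x. x \<in> nplus_t r}
   \<union> {tmono [h] | h. h \<in> h_t_pos r}
   \<union> {tmono [h] - smul (lam r m h) (tmono []) | h. h \<in> h0 r}
   \<union> {tmono (replicate (m i + 1) (xminus i i 0)) | i. i \<in> {1..r}}"

text \<open>K = (two-sided ideal of T(g[t]) defining U(g[t]) from the free algebra on the set g[t])
  + (left ideal generated by the Weyl relators).  W(lambda) = T / K, with w_lambda the class of 1.\<close>
inductive_set Kw :: "nat \<Rightarrow> (nat \<Rightarrow> nat) \<Rightarrow> tens set" for r m where
  zero: "(\<lambda>_. 0) \<in> Kw r m"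
| add: "F \<in> Kw r m \<Longrightarrow> G \<in> Kw r m \<Longrightarrow> F + G \<in> Kw r m"
| smult: "F \<in> Kw r m \<Longrightarrow> smul c F \<in> Kw r m"
| lin_add: "x \<in> gt r \<Longrightarrow> y \<in> gt r \<Longrightarrow> u \<in> lists (gt r) \<Longrightarrow> v \<in> lists (gt r) \<Longrightarrow>
     tmul (tmul (tmono u) (tmono [x + y] - tmono [x] - tmono [y])) (tmono v) \<in> Kw r m"
| lin_smult: "x \<in> gt r \<Longrightarrow> u \<in> lists (gt r) \<Longrightarrow> v \<in> lists (gt r) \<Longrightarrow>
     tmul (tmul (tmono u) (tmono [(\<lambda>k a b. c * x k a b)] - smul c (tmono [x]))) (tmono v) \<in> Kw r m"
| lie: "x \<in> gt r \<Longrightarrow> y \<in> gt r \<Longrightarrow> u \<in> lists (gt r) \<Longrightarrow> v \<in> lists (gt r) \<Longrightarrow>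
     tmul (tmul (tmono u) (tmono [x, y] - tmono [y, x] - tmono [br r x y])) (tmono v) \<in> Kw r m"
| weyl: "R \<in> weyl_rel r m \<Longrightarrow> u \<in> lists (gt r) \<Longrightarrow> tmul (tmono u) R \<in> Kw r m"

text \<open>Membership of (l, s) (with l = length s) in F(m).\<close>
definition inF :: "int \<Rightarrow> nat list \<Rightarrow> bool" where
  "inF mm s \<longleftrightarrow> sorted s \<and> 0 \<le> mm \<and> (s = [] \<or> int (last s) \<le> mm - int (length s))"

definition mij :: "nat \<Rightarrow> (nat \<Rightarrow> nat) \<Rightarrow> (nat \<Rightarrow> nat \<Rightarrow> nat list) \<Rightarrow> nat \<Rightarrow> nat \<Rightarrow> int" where
  "mij r m S i j = int (m i) + (\<Sum>s\<in>{j+1..r}. int (length (S (i+1) s)) - int (length (S i s)))"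

definition bword :: "nat \<Rightarrow> (nat \<Rightarrow> nat \<Rightarrow> nat list) \<Rightarrow> cur list" where
  "bword r S = concat (map (\<lambda>j. concat (map (\<lambda>i. map (xminus i j) (S i j)) [1..<j+1])) [1..<r+1])"

definition Bset :: "nat \<Rightarrow> (nat \<Rightarrow> nat) \<Rightarrow> cur list set" where
  "Bset r m = {bword r S | S. \<forall>i j. 1 \<le> i \<and> i \<le> j \<and> j \<le> r \<longrightarrow> inF (mij r m S i j) (S i j)}"

end

theory Submission
  imports Defs "HOL-Library.Multiset" "HOL-Library.Nat_Bijection"
begin

text \<open>Both halves are inductions on the rank in which the letters \<open>E\<^bsub>r+1,i\<^esub> \<otimes> t\<^sup>k\<close> are split off.
  These commute, so the products of them are monomials \<open>Y t\<close>; their height is the sum of the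
  indices \<open>i\<close>.

  Spanning: applied to a highest weight vector, and modulo monomials of greater height, the
  \<open>\<ell>\<^sub>i\<close> letters with index \<open>i\<close> inherit Garland's relations for the simple root vector of index \<open>i\<close>,
  that is, the complete symmetric polynomials \<open>h\<^sub>p\<close> with \<open>p + \<ell>\<^sub>i > m\<^sub>i\<close> act by zero.  This leaves the
  monomials with all exponents at most \<open>m\<^sub>i - \<ell>\<^sub>i\<close>.  Modulo greater height, and then greater degree,
  such a monomial sends the highest weight vector to a Weyl vector of weights \<open>m\<^sub>i + \<ell>\<^sub>i\<^sub>+\<^sub>1 - \<ell>\<^sub>i\<close> for
  rank \<open>r - 1\<close>, to which the induction hypothesis applies.

  Independence: let the current \<open>x \<otimes> t\<^sup>k\<close> act on the exterior algebra of \<open>N = \<Sum> m\<^sub>i\<close> copies of the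
  vector representation by \<open>p\<^sup>k x\<close> on copy \<open>p\<close>, starting from the product of the highest weight vectors of
  exterior powers, \<open>m\<^sub>i\<close> of them being \<open>i\<close>-th powers.  This vector satisfies the Weyl relations only
  up to terms of lower degree, but by spanning those are combinations of basis words of lower degree,
  so it suffices that the basis words are independent here.  Looking at the copies that have been moved to
  the vector \<open>r + 1\<close>, and taking the total type of those copies equal to the smallest height that occurs,
  one finds a sum of monomials in the points \<open>p\<close> over all matchings of letters with copies; the bound on
  the exponents makes these sums independent functions of the points.\<close>

section \<open>Complete symmetric sums\<close>

text \<open>The sl2-triple of the root of \<open>E (Suc r) i\<close> bounds exponents only in terms
  of m_i + ... + m_r. The bound by m_i alone has to come from the simple root: commuting E_{i+1,i}
  with an auxiliary factor E_{r+1,i+1} produces E_{r+1,i}, and every such exchange changes the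
  height by exactly one, which is why height is the filtration to use. The box of exponents is the
  one known from Grassmannians: symmetric polynomials in l variables modulo the h_p with p > m - l
  have dimension binomial(m, l), and the straightening into the box follows Pascal's recursion.
  Splitting off letters produces vectors that are Weyl vectors only modulo a submodule, so the
  spanning statement carries an arbitrary stable subspace \<open>L\<close> through the induction.
  The space used for independence is a degeneration in the manner of a fusion product: exterior
  powers placed at distinct points. There h t^k with k > 0 multiplies the generator by a power sum
  of the points instead of killing it, and only the associated graded module of the degree
  filtration is a quotient of the Weyl module.\<close>

primrec hsum :: "nat list \<Rightarrow> (nat list \<Rightarrow> 'v::comm_monoid_add) \<Rightarrow> nat \<Rightarrow> 'v" where
  "hsum [] F p = (if p = 0 then F [] else 0)"
| "hsum (x # s) F p = (\<Sum>k\<le>p. hsum s (\<lambda>l. F ((x + k) # l)) (p - k))"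

lemma hsum_cong:
  "(\<And>l. length l = length s \<Longrightarrow> sum_list l = sum_list s + p \<Longrightarrow> F l = G l) \<Longrightarrow> hsum s F p = hsum s G p"
proof (induction s arbitrary: F G p)
  case (Cons x s)
  have "hsum s (\<lambda>l. F ((x + k) # l)) (p - k) = hsum s (\<lambda>l. G ((x + k) # l)) (p - k)" if "k \<le> p" for k
    by (rule Cons.IH, rule Cons.prems) (use that in auto)
  then show ?case by simp
qed simp

lemma hsum_add: "hsum s (\<lambda>l. F l + G l) p = hsum s F p + hsum s G p"
  by (induction s arbitrary: F G p) (simp_all add: sum.distrib)

lemma hsum_zero [simp]: "hsum s (\<lambda>l. 0) p = 0"
  by (induction s arbitrary: p) simp_all

lemma hsum_sum: "hsum s (\<lambda>l. \<Sum>i\<in>I. F i l) p = (\<Sum>i\<in>I. hsum s (F i) p)"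
  by (induction I rule: infinite_finite_induct) (simp_all add: hsum_add)

lemma hsum_0 [simp]: "hsum s F 0 = F s"
  by (induction s arbitrary: F) simp_all

lemma hsum_hom:
  fixes T :: "'v::comm_monoid_add \<Rightarrow> 'w::comm_monoid_add"
  assumes "T 0 = 0" "\<And>x y. T (x + y) = T x + T y"
  shows "hsum s (\<lambda>l. T (F l)) p = T (hsum s F p)"
proof -
  have T: "T (sum f A) = (\<Sum>x\<in>A. T (f x))" for f :: "nat \<Rightarrow> 'v" and A
    by (induction A rule: infinite_finite_induct) (simp_all add: assms)
  show ?thesis
    by (induction s arbitrary: F p) (simp_all add: assms T)
qed

lemma hsum_closed:
  fixes L :: "'v::comm_monoid_add set"
  assumes "0 \<in> L" "\<And>x y. x \<in> L \<Longrightarrow> y \<in> L \<Longrightarrow> x + y \<in> L"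
  shows "(\<And>l. length l = length s \<Longrightarrow> sum_list l = sum_list s + p \<Longrightarrow> F l \<in> L) \<Longrightarrow> hsum s F p \<in> L"
proof (induction s arbitrary: F p)
  case (Cons x s)
  have **: "sum f A \<in> L" if "\<And>x. x \<in> A \<Longrightarrow> f x \<in> L" for f :: "nat \<Rightarrow> 'v" and A
    using that by (induction A rule: infinite_finite_induct) (simp_all add: assms)
  have *: "hsum s (\<lambda>l. F ((x + k) # l)) (p - k) \<in> L" if "k \<le> p" for k
    by (rule Cons.IH, rule Cons.prems) (use that in auto)
  show ?case unfolding hsum.simps by (rule **) (simp add: *)
qed (auto simp: assms)

lemma sum_triangle_swap:
  fixes g :: "nat \<Rightarrow> nat \<Rightarrow> 'v::comm_monoid_add"
  shows "(\<Sum>k\<le>p. \<Sum>l\<le>p - k. g k l) = (\<Sum>l\<le>p. \<Sum>k\<le>p - l. g k l)"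
  unfolding sum.Sigma [OF finite_atMost ballI, OF finite_atMost]
  by (rule sum.reindex_bij_witness [where i = "\<lambda>(a, b). (b, a)" and j = "\<lambda>(a, b). (b, a)"]) auto

lemma hsum_swap:
  assumes "\<And>a b l. F (a # b # l) = F (b # a # l)"
  shows "hsum (x # y # s) F p = hsum (y # x # s) F p"
proof -
  have "hsum (x # y # s) F p = (\<Sum>k\<le>p. \<Sum>l\<le>p - k. hsum s (\<lambda>u. F ((x + k) # (y + l) # u)) (p - k - l))"
    by simp
  also have "\<dots> = (\<Sum>l\<le>p. \<Sum>k\<le>p - l. hsum s (\<lambda>u. F ((x + k) # (y + l) # u)) (p - k - l))"
    by (rule sum_triangle_swap)
  also have "\<dots> = hsum (y # x # s) F p"
  proof -
    have "hsum s (\<lambda>u. F ((x + k) # (y + l) # u)) (p - k - l) = hsum s (\<lambda>u. F ((y + l) # (x + k) # u)) (p - l - k)" for k l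
      by (subst assms) (simp add: add.commute)
    then show ?thesis by simp
  qed
  finally show ?thesis .
qed

definition symm :: "(nat list \<Rightarrow> 'v) \<Rightarrow> bool" where
  "symm F \<longleftrightarrow> (\<forall>l l'. mset l = mset l' \<longrightarrow> F l = F l')"

lemma symmD: "symm F \<Longrightarrow> mset l = mset l' \<Longrightarrow> F l = F l'"
  unfolding symm_def by blast

lemma symmI: "(\<And>l l'. mset l = mset l' \<Longrightarrow> F l = F l') \<Longrightarrow> symm F"
  unfolding symm_def by blast

lemma symm_Cons: "symm F \<Longrightarrow> symm (\<lambda>l. F (x # l))"
  by (rule symmI, erule symmD) simp

lemma hsum_move: "symm F \<Longrightarrow> hsum (s1 @ x # s2) F p = hsum (x # s1 @ s2) F p"
proof (induction s1 arbitrary: F p)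
  case (Cons y s1)
  have "hsum ((y # s1) @ x # s2) F p = hsum (y # x # s1 @ s2) F p"
    using Cons.IH [OF symm_Cons [OF Cons.prems]] by simp
  also have "\<dots> = hsum (x # y # s1 @ s2) F p"
    by (rule hsum_swap, rule symmD [OF Cons.prems]) simp
  finally show ?case by simp
qed simp

lemma hsum_perm: "symm F \<Longrightarrow> mset s = mset s' \<Longrightarrow> hsum s F p = hsum s' F p"
proof (induction s arbitrary: s' F p)
  case (Cons x s)
  have "x \<in># mset s'"
    unfolding Cons.prems(2) [symmetric] by simp
  then have "x \<in> set s'" by simp
  then obtain s1 s2 where s': "s' = s1 @ x # s2"
    by (meson split_list)
  with Cons.prems have *: "mset s = mset (s1 @ s2)" by simp
  have "hsum s' F p = hsum (x # s1 @ s2) F p"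
    unfolding s' by (rule hsum_move [OF Cons.prems(1)])
  also have "\<dots> = hsum (x # s) F p"
    using Cons.IH [OF symm_Cons [OF Cons.prems(1)] *] by simp
  finally show ?case by simp
qed simp

text \<open>Multiplying by a power of the \<open>j\<close>-th variable commutes with multiplying by
  h_p.\<close>

lemma hsum_shift:
  "j < length s \<Longrightarrow> hsum (s[j := s ! j + k]) F p = hsum s (\<lambda>l. F (l[j := l ! j + k])) p"
proof (induction s arbitrary: j F p)
  case (Cons x s)
  then show ?case
    by (cases j) (simp_all add: add.commute add.left_commute)
qed simp

lemma hsum_map_Suc: "hsum (map Suc s) F p = hsum s (\<lambda>l. F (map Suc l)) p"
  by (induction s arbitrary: F p) simp_all

text \<open>The recursion h_{p+1}(z_1,...,z_l) = h_{p+1}(z_2,...,z_l) + z_1 h_p(z_1,...,z_l): either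
  the first exponent stays, or one unit of it is split off.\<close>

lemma hsum_Cons_Suc:
  fixes F :: "nat list \<Rightarrow> 'v::ab_group_add"
  shows "hsum (x # s) F (Suc p) = hsum s (\<lambda>l. F (x # l)) (Suc p) + hsum (Suc x # s) F p"
proof -
  have "hsum (x # s) F (Suc p) = hsum s (\<lambda>l. F (x # l)) (Suc p)
      + (\<Sum>k\<le>p. hsum s (\<lambda>l. F ((x + Suc k) # l)) (p - k))"
    by (simp only: hsum.simps sum.atMost_Suc_shift) simp
  then show ?thesis by simp
qed

locale vector_space_char_0 = vector_space scale
  for scale :: "'a::field_char_0 \<Rightarrow> 'v::ab_group_add \<Rightarrow> 'v" (infixr \<open>*s\<close> 75)
begin

lemma hsum_scale: "hsum s (\<lambda>l. c *s F l) p = c *s hsum s F p"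
  by (rule hsum_hom) (simp_all add: scale_right_distrib)

lemma hsum_in_subspace:
  "subspace L \<Longrightarrow> (\<And>l. length l = length s \<Longrightarrow> sum_list l = sum_list s + p \<Longrightarrow> F l \<in> L) \<Longrightarrow> hsum s F p \<in> L"
  by (rule hsum_closed) (simp_all add: subspace_0 subspace_add)

text \<open>Both sides sum over the compositions together with a chosen zero entry of the shifted list.\<close>
lemma hsum_count_zero:
  "symm F \<Longrightarrow> hsum s (\<lambda>l. of_nat (count_list l 0) *s F l) p
     = of_nat (count_list s 0) *s hsum (remove1 0 s) (\<lambda>l. F (0 # l)) p"
proof (induction s arbitrary: F p)
  case (Cons x s)
  let ?c = "of_nat (count_list s 0)"
  have "hsum (x # s) (\<lambda>l. of_nat (count_list l 0) *s F l) p
      = (\<Sum>k\<le>p. hsum s (\<lambda>l. (if x + k = 0 then F ((x + k) # l) else 0)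
           + of_nat (count_list l 0) *s F ((x + k) # l)) (p - k))"
    by (auto simp: scale_left_distrib intro!: sum.cong hsum_cong)
  also have "\<dots> = (\<Sum>k\<le>p. hsum s (\<lambda>l. if x + k = 0 then F ((x + k) # l) else 0) (p - k))
      + (\<Sum>k\<le>p. hsum s (\<lambda>l. of_nat (count_list l 0) *s F ((x + k) # l)) (p - k))"
    by (simp only: hsum_add sum.distrib)
  also have "(\<Sum>k\<le>p. hsum s (\<lambda>l. if x + k = 0 then F ((x + k) # l) else 0) (p - k))
      = (if x = 0 then hsum s (\<lambda>l. F (0 # l)) p else 0)"
    by (simp add: sum.atMost_shift)
  also have "(\<Sum>k\<le>p. hsum s (\<lambda>l. of_nat (count_list l 0) *s F ((x + k) # l)) (p - k))
      = (\<Sum>k\<le>p. ?c *s hsum (remove1 0 s) (\<lambda>l. F (0 # (x + k) # l)) (p - k))"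
  proof (rule sum.cong [OF refl])
    fix k
    have "hsum (remove1 0 s) (\<lambda>l. F ((x + k) # 0 # l)) (p - k) = hsum (remove1 0 s) (\<lambda>l. F (0 # (x + k) # l)) (p - k)"
      by (rule hsum_cong, rule symmD [OF Cons.prems]) simp
    then show "hsum s (\<lambda>l. of_nat (count_list l 0) *s F ((x + k) # l)) (p - k)
        = ?c *s hsum (remove1 0 s) (\<lambda>l. F (0 # (x + k) # l)) (p - k)"
      using Cons.IH [OF symm_Cons [OF Cons.prems], of "x + k" "p - k"] by simp
  qed
  also have "\<dots> = ?c *s hsum (x # remove1 0 s) (\<lambda>l. F (0 # l)) p"
    by (simp add: scale_sum_right)
  finally have *: "hsum (x # s) (\<lambda>l. of_nat (count_list l 0) *s F l) p
      = (if x = 0 then hsum s (\<lambda>l. F (0 # l)) p else 0) + ?c *s hsum (x # remove1 0 s) (\<lambda>l. F (0 # l)) p" .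
  show ?case
  proof (cases "x = 0")
    case True
    have "?c *s hsum (0 # remove1 0 s) (\<lambda>l. F (0 # l)) p = ?c *s hsum s (\<lambda>l. F (0 # l)) p"
    proof (cases "0 \<in> set s")
      case True
      then have "hsum (0 # remove1 0 s) (\<lambda>l. F (0 # l)) p = hsum s (\<lambda>l. F (0 # l)) p"
        by (intro hsum_perm symm_Cons Cons.prems) simp
      then show ?thesis by simp
    qed (simp add: count_list_0_iff)
    then show ?thesis
      unfolding * using True by (simp add: scale_left_distrib)
  next
    case False
    then show ?thesis unfolding * by simp
  qed
qed simp

text \<open>With \<^term>\<open>F\<close> symmetric and multilinear, the lists stand for monomials in \<^term>\<open>l\<close> variables
  and \<^term>\<open>hsum\<close> is multiplication by a complete symmetric polynomial \<open>h\<^sub>p\<close>.  If the \<open>h\<^sub>p\<close> in all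
  variables act by zero for \<open>p > m - l\<close>, then so do the \<open>h\<^sub>p\<close> in the first \<open>j\<close> variables for
  \<open>p > m - j\<close>.\<close>
lemma hsum_fewer_variables:
  assumes L: "subspace L" and F: "symm F"
    and rel: "\<And>s p. length s = l \<Longrightarrow> p + l > m \<Longrightarrow> hsum s F p \<in> L"
  shows "length s + length t = l \<Longrightarrow> p + length s > m \<Longrightarrow> hsum s (\<lambda>u. F (t @ u)) p \<in> L"
proof (induction "length t" arbitrary: s t p)
  case 0
  then show ?case using rel by simp
next
  case (Suc n)
  then obtain x t' where t: "t = t' @ [x]" and n: "length t' = n"
    by (metis length_Suc_conv_rev)
  have *: "hsum (y # s) (\<lambda>u. F (t' @ u)) q \<in> L" if "q + Suc (length s) > m" for y q
    using Suc.hyps(1) [of t' "y # s" q] Suc.prems that t n by simp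
  have eq: "(\<lambda>u. F (t @ u)) = (\<lambda>u. F (t' @ x # u))"
    by (simp add: t)
  show ?case
  proof (cases p)
    case 0
    have "hsum (x # s) (\<lambda>u. F (t' @ u)) 0 = hsum s (\<lambda>u. F (t @ u)) 0"
      by (simp add: eq)
    then show ?thesis using * [of 0 x] Suc.prems 0 by simp
  next
    case (Suc q)
    have "hsum s (\<lambda>u. F (t @ u)) p
        = hsum (x # s) (\<lambda>u. F (t' @ u)) (Suc q) - hsum (Suc x # s) (\<lambda>u. F (t' @ u)) q"
      unfolding Suc eq hsum_Cons_Suc by simp
    also have "\<dots> \<in> L"
      using Suc.prems Suc by (intro subspace_diff [OF L] *) simp_all
    finally show ?thesis .
  qed
qed

text \<open>The product of the elementary polynomial \<open>e\<^sub>j\<close> and \<open>h\<^sub>p\<close>, \<open>p = m - j\<close>, in \<open>j\<close> variables also acts by zero.\<close>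
lemma hsum_elementary:
  assumes L: "subspace L" and F: "symm F" and "m > 0"
    and rel: "\<And>s p. length s = l \<Longrightarrow> p + l > m \<Longrightarrow> hsum s F p \<in> L"
  shows "length s + length t = l \<Longrightarrow> p + length s = m \<Longrightarrow> hsum (map Suc s) (\<lambda>u. F (t @ u)) p \<in> L"
proof (induction s arbitrary: t p)
  case Nil
  then show ?case using \<open>m > 0\<close> subspace_0 [OF L] by simp
next
  case (Cons x s)
  have "hsum (Suc x # map Suc s) (\<lambda>u. F (t @ u)) p
      = hsum (x # map Suc s) (\<lambda>u. F (t @ u)) (Suc p) - hsum (map Suc s) (\<lambda>u. F ((t @ [x]) @ u)) (Suc p)"
    unfolding hsum_Cons_Suc by simp
  also have "\<dots> \<in> L"
  proof (rule subspace_diff [OF L])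
    show "hsum (x # map Suc s) (\<lambda>u. F (t @ u)) (Suc p) \<in> L"
      by (rule hsum_fewer_variables [OF L F rel]) (use Cons.prems in auto)
    show "hsum (map Suc s) (\<lambda>u. F ((t @ [x]) @ u)) (Suc p) \<in> L"
      by (rule Cons.IH) (use Cons.prems in auto)
  qed
  finally show ?case by simp
qed

text \<open>Pascal's recursion for binomial(m, l): lists without an entry 0 reduce to (m - 1, l) by
  subtracting 1 from every entry, lists with an entry 0 reduce to (m - 1, l - 1) by dropping one
  such entry. The second reduction is modulo the lists of the first kind, and it divides by the
  number of zeros.\<close>

lemma box_spanning:
  assumes "subspace L" "symm F" "\<And>s p. length s = l \<Longrightarrow> p + l > m \<Longrightarrow> hsum s F p \<in> L" "length M = l"
  shows "F M \<in> span ({F M' |M'. length M' = l \<and> (\<forall>x\<in>set M'. x + l \<le> m)} \<union> L)"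
  using assms
proof (induction m arbitrary: l F L M)
  case 0
  show ?case
  proof (cases "l = 0")
    case True
    then show ?thesis using 0 by (auto intro!: span_base)
  next
    case False
    have "hsum M F 0 = F M"
      by (rule hsum_0)
    then show ?thesis using 0(3) [where s = M and p = 0] 0(4) False by (auto intro!: span_base)
  qed
next
  case (Suc m)
  note L = \<open>subspace L\<close> and F = \<open>symm F\<close>
  show ?case
  proof (cases "l = 0")
    case True
    then show ?thesis using Suc.prems by (auto intro!: span_base)
  next
    case False
    then obtain l' where l': "l = Suc l'" by (cases l) auto
    define B where "B = {F M' |M'. length M' = l \<and> (\<forall>x\<in>set M'. x + l \<le> Suc m)} \<union> L"
    have B: "L \<subseteq> span B"
      by (auto simp: B_def intro: span_base)
    have pos: "F N \<in> span B" if N: "length N = l" "0 \<notin> set N" for N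
    proof -
      let ?F = "\<lambda>u. F (map Suc u)"
      obtain N' where N': "N = map Suc N'"
        using N(2) by (metis ex_map_conv not0_implies_Suc)
      have "?F N' \<in> span ({?F M' |M'. length M' = l \<and> (\<forall>x\<in>set M'. x + l \<le> m)} \<union> L)"
      proof (rule Suc.IH [OF L])
        show "symm ?F" by (rule symmI, rule symmD [OF F]) simp
        \<comment> \<open>For p + l = Suc m the given relations just fail to apply to the shifted
          list; this is the product e_l h_p.\<close>
        show "hsum s ?F p \<in> L" if s: "length s = l" and p: "p + l > m" for s p
        proof (cases "p + l = Suc m")
          case True
          then show ?thesis
            using hsum_elementary [where L = L and F = F and m = "Suc m" and l = l and s = s and t = "[]" and p = p]
              L F Suc.prems(3) s by (simp add: hsum_map_Suc)
        next
          case False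
          then show ?thesis
            using Suc.prems(3) [where s = "map Suc s" and p = p] s p by (simp add: hsum_map_Suc)
        qed
        show "length N' = l" using N(1) N' by simp
      qed
      moreover have "{?F M' |M'. length M' = l \<and> (\<forall>x\<in>set M'. x + l \<le> m)} \<union> L \<subseteq> B"
        unfolding B_def by (force intro: exI [of _ "map Suc _"])
      ultimately show ?thesis unfolding N' using span_mono by blast
    qed
    have zero: "F (0 # N) \<in> span B" if N: "length N = l'" for N
    proof -
      \<comment> \<open>\<open>hsum\<close> over \<open>0 # s\<close> with a distinguished zero
        meets a list once for every zero that can play this part. Dividing by the number of zeros of
        \<open>0 # u\<close> therefore gives a function of the shorter list that inherits the
        relations in l' variables.\<close>
      let ?c = "\<lambda>u. of_nat (Suc (count_list u 0)) :: 'a"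
      let ?F = "\<lambda>u. inverse (?c u) *s F (0 # u)"
      have F'N: "?F N \<in> span ({?F M' |M'. length M' = l' \<and> (\<forall>x\<in>set M'. x + l' \<le> m)} \<union> span B)"
      proof (rule Suc.IH)
        show "symm ?F"
          unfolding symm_def
        proof (intro allI impI)
          fix u u' :: "nat list" assume u: "mset u = mset u'"
          then have "F (0 # u) = F (0 # u')"
            by (intro symmD [OF F]) simp
          moreover have "count_list u 0 = count_list u' 0"
            using u by (metis count_mset)
          ultimately show "?F u = ?F u'" by simp
        qed
        show "hsum s ?F p \<in> span B" if s: "length s = l'" and p: "p + l' > m" for s p
        proof -
          \<comment> \<open>Since the inverse of 0 is 0, \<open>?G\<close> vanishes on lists without
            an entry 0. On these the difference from \<open>F\<close> is \<open>- F u\<close>, which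
            is in the span by the case already treated.\<close>
          let ?G = "\<lambda>u. inverse (of_nat (count_list u 0)) *s F u"
          have G: "symm ?G"
            unfolding symm_def
          proof (intro allI impI)
            fix u u' :: "nat list" assume u: "mset u = mset u'"
            then have "F u = F u'"
              by (intro symmD [OF F]) simp
            moreover have "count_list u 0 = count_list u' 0"
              using u by (metis count_mset)
            ultimately show "?G u = ?G u'" by simp
          qed
          have "?c s *s hsum s ?F p = hsum (0 # s) (\<lambda>u. of_nat (count_list u 0) *s ?G u) p"
            using hsum_count_zero [OF G, of "0 # s" p] by simp
          also have "\<dots> = hsum (0 # s) (\<lambda>u. F u + (of_nat (count_list u 0) *s ?G u - F u)) p"
            by simp
          also have "\<dots> = hsum (0 # s) F p + hsum (0 # s) (\<lambda>u. of_nat (count_list u 0) *s ?G u - F u) p"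
            by (rule hsum_add)
          also have "\<dots> \<in> span B"
          proof (rule span_add)
            show "hsum (0 # s) F p \<in> span B"
              using Suc.prems(3) [where s = "0 # s" and p = p] s p l' B by auto
            show "hsum (0 # s) (\<lambda>u. of_nat (count_list u 0) *s ?G u - F u) p \<in> span B"
            proof (rule hsum_in_subspace)
              fix u :: "nat list" assume u: "length u = length (0 # s)"
              show "of_nat (count_list u 0) *s ?G u - F u \<in> span B"
              proof (cases "0 \<in> set u")
                case True
                then have "count_list u 0 \<noteq> 0" by (simp add: count_list_0_iff)
                then show ?thesis by (simp add: span_zero)
              next
                case False
                then show ?thesis using pos [of u] u s l' by (simp add: count_list_0_iff span_neg)
              qed
            qed simp
          qed
          finally have "inverse (?c s) *s ?c s *s hsum s ?F p \<in> span B"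
            by (rule span_scale)
          then show ?thesis by (simp del: of_nat_Suc)
        qed
      qed (use N in simp_all)
      have *: "?F M' \<in> span B" if "length M' = l'" "\<forall>x\<in>set M'. x + l' \<le> m" for M'
      proof -
        have "l' \<le> m"
          using that by (cases M') auto
        then have "F (0 # M') \<in> B"
          unfolding B_def using that l' by (intro UnI1 CollectI exI [of _ "0 # M'"]) auto
        then show ?thesis by (intro span_scale span_base)
      qed
      then have "{?F M' |M'. length M' = l' \<and> (\<forall>x\<in>set M'. x + l' \<le> m)} \<union> span B \<subseteq> span B"
        by blast
      then have "?F N \<in> span B"
        using span_minimal [OF _ subspace_span] F'N by blast
      then have "?c N *s ?F N \<in> span B" by (rule span_scale)
      then show ?thesis by (simp del: of_nat_Suc)
    qed
    show ?thesis
    proof (cases "0 \<in> set M")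
      case True
      then have "F M = F (0 # remove1 0 M)"
        by (intro symmD [OF F]) simp
      then show ?thesis
        using zero [of "remove1 0 M"] True Suc.prems(4) l' by (simp add: length_remove1 B_def)
    next
      case False
      then show ?thesis using pos [of M] Suc.prems(4) by (simp add: B_def)
    qed
  qed
qed

end

section \<open>Lowering operators\<close>

context vector_space_char_0
begin

lemma scale_2: "2 *s v = v + v"
  using scale_left_distrib [of 1 1 v] by simp

abbreviation endo :: "('v \<Rightarrow> 'v) \<Rightarrow> bool" where
  "endo f \<equiv> module_hom scale scale f"

lemma endoI:
  "(\<And>x y. f (x + y) = f x + f y) \<Longrightarrow> (\<And>c x. f (c *s x) = c *s f x) \<Longrightarrow> endo f"
  by unfold_locales (simp_all add: module_hom_axioms_def)

lemma endo_add: "endo f \<Longrightarrow> f (x + y) = f x + f y"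
  and endo_scale: "endo f \<Longrightarrow> f (c *s x) = c *s f x"
  and endo_0: "endo f \<Longrightarrow> f 0 = 0"
  and endo_neg: "endo f \<Longrightarrow> f (- x) = - f x"
  and endo_diff: "endo f \<Longrightarrow> f (x - y) = f x - f y"
  and endo_sum: "endo f \<Longrightarrow> f (sum g A) = (\<Sum>a\<in>A. f (g a))"
  by (simp_all add: module_hom.add module_hom.scale module_hom.zero module_hom.neg module_hom.diff module_hom.sum)

lemma endo_hsum: "endo f \<Longrightarrow> hsum s (\<lambda>l. f (F l)) p = f (hsum s F p)"
  by (rule hsum_hom) (simp_all add: endo_add endo_0)

lemma endo_foldr: "(\<And>a. a \<in> set l \<Longrightarrow> endo (f a)) \<Longrightarrow> endo (foldr f l)"
proof (induction l)
  case Nil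
  then show ?case by (auto intro: endoI)
next
  case (Cons a l)
  then have "endo (f a)" "endo (foldr f l)" by auto
  then show ?case by (auto intro!: endoI simp: endo_add endo_scale)
qed

lemma endo_funpow: "endo f \<Longrightarrow> endo (f ^^ n)"
  by (induction n) (auto intro!: endoI simp: endo_add endo_scale)

lemma endo_span:
  "endo f \<Longrightarrow> (\<And>x. x \<in> S \<Longrightarrow> f x \<in> L) \<Longrightarrow> subspace L \<Longrightarrow> v \<in> span S \<Longrightarrow> f v \<in> L"
  by (rule span_induct [of v S "\<lambda>v. f v \<in> L"])
     (auto simp: endo_add endo_scale endo_0 subspace_def)

end

lemma foldr_perm:
  assumes "\<And>a b v. a \<in> set l \<Longrightarrow> b \<in> set l \<Longrightarrow> x a (x b v) = x b (x a v)" and "mset l = mset l'"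
  shows "foldr x l w = foldr x l' w"
  using assms
proof (induction l arbitrary: l')
  case (Cons a l)
  have "a \<in># mset l'"
    unfolding Cons.prems(2) [symmetric] by simp
  then have "a \<in> set l'" by simp
  then obtain l1 l2 where l': "l' = l1 @ a # l2"
    by (meson split_list)
  have "set l1 \<subseteq> set (a # l)"
    using mset_eq_setD [OF Cons.prems(2)] l' by auto
  then have "foldr x (l1 @ a # l2) w = x a (foldr x (l1 @ l2) w)"
    using Cons.prems(1) by (induction l1) simp_all
  moreover have "foldr x l w = foldr x (l1 @ l2) w"
    by (rule Cons.IH) (use Cons.prems l' in simp_all)
  ultimately show ?case by (simp add: l')
qed simp

text \<open>\<open>x k\<close>, \<open>h k\<close> and \<open>e\<close> stand for f t^k, h t^k and e
  t in sl2[t]. The single raising current e t suffices: it trades a factor f for one more power of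
  t.\<close>

locale sl2_lowering = vector_space_char_0 scale
  for scale :: "'a::field_char_0 \<Rightarrow> 'v::ab_group_add \<Rightarrow> 'v" (infixr \<open>*s\<close> 75) +
  fixes x h :: "nat \<Rightarrow> 'v \<Rightarrow> 'v" and e :: "'v \<Rightarrow> 'v" and w :: 'v and m :: nat
  assumes endo: "endo (x k)" "endo (h k)" "endo e"
    and x_x: "x a (x b v) = x b (x a v)"
    and h_x: "0 < k \<Longrightarrow> h k (x a v) = x a (h k v) - 2 *s x (a + k) v"
    and e_x: "e (x a v) = x a (e v) + h (Suc a) v"
    and e_w: "e w = 0"
    and h_w: "0 < k \<Longrightarrow> h k w = 0"
    and x_w: "m < n \<Longrightarrow> (x 0 ^^ n) w = 0"
begin

text \<open>The coefficient of z^p in X(z)^n w, where X(z) is the generating series of the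
  \<open>x k\<close>.\<close>

definition A :: "nat \<Rightarrow> nat \<Rightarrow> 'v" where
  "A n p = hsum (replicate n 0) (\<lambda>l. foldr x l w) p"

lemma A_0: "A 0 p = (if p = 0 then w else 0)"
  by (simp add: A_def)

lemma A_Suc: "A (Suc n) p = (\<Sum>k\<le>p. x k (A n (p - k)))"
  by (simp add: A_def endo_hsum [OF endo(1)])

lemma A_p0: "A n 0 = (x 0 ^^ n) w"
  by (induction n) (simp_all add: A_0 A_Suc)

text \<open>The coefficients of the identity z (X^(n+1))' = (n + 1) z X' X^n.\<close>

lemma A_weighted:
  "of_nat (Suc n) *s (\<Sum>c\<le>q. of_nat c *s x c (A n (q - c))) = of_nat q *s A (Suc n) q"
proof (induction n arbitrary: q)
  case 0
  have "(\<Sum>c\<le>q. f c *s x c (A 0 (q - c))) = f q *s x q w" for f :: "nat \<Rightarrow> 'a"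
    by (subst sum.remove [of _ q]) (auto simp: A_0 endo_0 [OF endo(1)] intro!: sum.neutral)
  from this [of of_nat] this [of "\<lambda>_. 1"] show ?case by (simp add: A_Suc)
next
  case (Suc n)
  let ?B = "\<lambda>n q. \<Sum>c\<le>q. of_nat c *s x c (A n (q - c))"
  have "of_nat q *s A (Suc (Suc n)) q = (\<Sum>c\<le>q. of_nat q *s x c (A (Suc n) (q - c)))"
    by (simp add: A_Suc [of "Suc n"] scale_sum_right)
  also have "\<dots> = (\<Sum>c\<le>q. of_nat c *s x c (A (Suc n) (q - c)) + x c (of_nat (q - c) *s A (Suc n) (q - c)))"
    by (rule sum.cong) (auto simp: endo_scale [OF endo(1)] scale_left_distrib [symmetric] of_nat_add [symmetric] simp del: of_nat_add)
  also have "\<dots> = ?B (Suc n) q + (\<Sum>c\<le>q. x c (of_nat (Suc n) *s ?B n (q - c)))"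
    by (simp only: sum.distrib Suc.IH)
  also have "(\<Sum>c\<le>q. x c (of_nat (Suc n) *s ?B n (q - c)))
      = of_nat (Suc n) *s (\<Sum>c\<le>q. \<Sum>d\<le>q - c. of_nat d *s x c (x d (A n (q - c - d))))"
    by (simp only: endo_scale [OF endo(1)] endo_sum [OF endo(1)] scale_sum_right)
  also have "(\<Sum>c\<le>q. \<Sum>d\<le>q - c. of_nat d *s x c (x d (A n (q - c - d))))
      = (\<Sum>d\<le>q. \<Sum>c\<le>q - d. of_nat d *s x c (x d (A n (q - c - d))))"
    by (rule sum_triangle_swap)
  also have "\<dots> = ?B (Suc n) q"
    by (intro sum.cong refl)
      (simp add: A_Suc endo_sum [OF endo(1)] scale_sum_right x_x [of _ "_ :: nat"] add.commute)
  finally show ?case by (simp add: scale_left_distrib scale_2)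
qed

lemma h_A_0: "0 < k \<Longrightarrow> h k (A 0 p) = 0"
  by (simp add: A_0 h_w endo_0 [OF endo(2)])

lemma h_A_Suc:
  assumes k: "0 < k"
  shows "h k (A (Suc n) p) = - (2 * of_nat (Suc n)) *s (\<Sum>j\<le>p. x (j + k) (A n (p - j)))"
proof (induction n arbitrary: p)
  case 0
  show ?case
    by (simp add: A_Suc endo_sum [OF endo(2)] h_x k h_A_0 endo_0 [OF endo(1)] scale_sum_right sum_negf [symmetric])
next
  case (Suc n)
  have "h k (A (Suc (Suc n)) p)
      = (\<Sum>j\<le>p. x j (h k (A (Suc n) (p - j)))) - 2 *s (\<Sum>j\<le>p. x (j + k) (A (Suc n) (p - j)))"
    by (simp only: A_Suc [of "Suc n"] endo_sum [OF endo(2)] h_x k sum_subtractf scale_sum_right)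
  also have "(\<Sum>j\<le>p. x j (h k (A (Suc n) (p - j))))
      = - (2 * of_nat (Suc n)) *s (\<Sum>j\<le>p. \<Sum>i\<le>p - j. x j (x (i + k) (A n (p - j - i))))"
    by (simp only: Suc.IH endo_scale [OF endo(1)] endo_sum [OF endo(1)] scale_sum_right)
  also have "(\<Sum>j\<le>p. \<Sum>i\<le>p - j. x j (x (i + k) (A n (p - j - i))))
      = (\<Sum>i\<le>p. \<Sum>j\<le>p - i. x j (x (i + k) (A n (p - j - i))))"
    by (rule sum_triangle_swap)
  also have "\<dots> = (\<Sum>i\<le>p. x (i + k) (A (Suc n) (p - i)))"
    by (simp add: A_Suc endo_sum [OF endo(1)] x_x [of _ "_ + k"] add.commute)
  finally show ?case
    by (simp only: scale_left_diff_distrib [symmetric]) (simp add: algebra_simps)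
qed

text \<open>Passing e t through the factors leaves currents h t^(k+1), and moving these on to
  \<open>w\<close> produces the weighted sums evaluated by \<open>A_weighted\<close>. As the scalar
  is not 0, vanishing of \<open>A (Suc n) p\<close> forces vanishing of
  \<open>A n (Suc p)\<close>.\<close>

lemma e_A: "e (A (Suc n) p) = - (of_nat (Suc n) * of_nat (Suc p)) *s A n (Suc p)"
proof (induction n arbitrary: p)
  case 0
  have "x j (A 0 (p - j)) = (if j = p then x p w else 0)" if "j \<le> p" for j
    using that by (auto simp: A_0 endo_0 [OF endo(1)])
  then have "A (Suc 0) p = x p w"
    by (simp add: A_Suc)
  then show ?case by (simp add: e_x e_w h_w endo_0 [OF endo(1)] A_0)
next
  case (Suc n)
  let ?B = "\<Sum>c\<le>Suc p. of_nat c *s x c (A n (Suc p - c))"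
  have "e (A (Suc (Suc n)) p) = (\<Sum>k\<le>p. x k (e (A (Suc n) (p - k)))) + (\<Sum>k\<le>p. h (Suc k) (A (Suc n) (p - k)))"
    by (simp only: A_Suc [of "Suc n"] endo_sum [OF endo(3)] e_x sum.distrib)
  also have "(\<Sum>k\<le>p. x k (e (A (Suc n) (p - k))))
      = - of_nat (Suc n) *s (\<Sum>k\<le>p. of_nat (Suc p - k) *s x k (A n (Suc p - k)))"
    by (simp add: Suc.IH endo_scale [OF endo(1)] endo_neg [OF endo(1)] scale_sum_right Suc_diff_le del: of_nat_Suc)
  also have "(\<Sum>k\<le>p. of_nat (Suc p - k) *s x k (A n (Suc p - k)))
      = (\<Sum>k\<le>Suc p. of_nat (Suc p) *s x k (A n (Suc p - k)) - of_nat k *s x k (A n (Suc p - k)))"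
    by (auto simp: scale_left_diff_distrib [symmetric] of_nat_diff simp del: of_nat_Suc intro!: sum.cong)
  also have "\<dots> = of_nat (Suc p) *s A (Suc n) (Suc p) - ?B"
    by (simp only: sum_subtractf A_Suc scale_sum_right)
  also have "(\<Sum>k\<le>p. h (Suc k) (A (Suc n) (p - k))) = - (2 * of_nat (Suc n)) *s ?B"
  proof -
    have "(\<Sum>k\<le>p. \<Sum>j\<le>p - k. x (j + Suc k) (A n (p - k - j)))
        = (\<Sum>(k, j)\<in>Sigma {..p} (\<lambda>k. {..p - k}). x (j + Suc k) (A n (p - k - j)))"
      by (rule sum.Sigma) auto
    also have "\<dots> = (\<Sum>(c, k)\<in>Sigma {..Suc p} (\<lambda>c. {..<c}). x c (A n (Suc p - c)))"
      by (rule sum.reindex_bij_witness [where i = "\<lambda>(c, k). (k, c - Suc k)" and j = "\<lambda>(k, j). (j + Suc k, k)"])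
        (auto simp: algebra_simps)
    also have "\<dots> = (\<Sum>c\<le>Suc p. \<Sum>k<c. x c (A n (Suc p - c)))"
      by (rule sum.Sigma [symmetric]) auto
    also have "\<dots> = ?B"
      by (simp add: sum_constant_scale)
    finally have "?B = (\<Sum>k\<le>p. \<Sum>j\<le>p - k. x (j + Suc k) (A n (p - k - j)))" ..
    then show ?thesis
      by (simp only: h_A_Suc zero_less_Suc scale_sum_right)
  qed
  also have "- of_nat (Suc n) *s (of_nat (Suc p) *s A (Suc n) (Suc p) - ?B) + - (2 * of_nat (Suc n)) *s ?B
      = - (of_nat (Suc n) * of_nat (Suc p)) *s A (Suc n) (Suc p) - of_nat (Suc n) *s ?B"
  proof -
    have "- a *s (b *s v - y) + - (2 * a) *s y = - (a * b) *s v - a *s y" for a b v y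
      by (simp add: scale_right_diff_distrib scale_2 flip: scale_scale)
    then show ?thesis .
  qed
  also have "\<dots> = - (of_nat (Suc n) * of_nat (Suc p)) *s A (Suc n) (Suc p) - of_nat (Suc p) *s A (Suc n) (Suc p)"
    by (simp only: A_weighted)
  also have "\<dots> = - (of_nat (Suc (Suc n)) * of_nat (Suc p)) *s A (Suc n) (Suc p)"
    by (simp only: scale_left_diff_distrib [symmetric]) (simp add: algebra_simps)
  finally show ?case .
qed

lemma A_eq_0: "m < p + n \<Longrightarrow> A n p = 0"
proof (induction p arbitrary: n)
  case 0
  then show ?case by (simp add: A_p0 x_w)
next
  case (Suc p)
  then have "e (A (Suc n) p) = 0"
    by (simp add: endo_0 [OF endo(3)])
  then have "(of_nat (Suc n) * of_nat (Suc p) :: 'a) = 0 \<or> A n (Suc p) = 0"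
    by (simp add: e_A del: of_nat_Suc)
  then show ?case by (metis mult_eq_0_iff of_nat_neq_0)
qed

lemma symm_x: "symm (\<lambda>l. foldr x l w)"
  by (rule symmI, rule foldr_perm) (rule x_x)

lemma h_foldr:
  assumes k: "0 < k"
  shows "h k (foldr x l w) = - 2 *s (\<Sum>i<length l. foldr x (l[i := l ! i + k]) w)"
proof (induction l)
  case Nil
  then show ?case using k by (simp add: h_w)
next
  case (Cons a l)
  then show ?case
    by (simp add: h_x k endo_scale [OF endo(1)] endo_neg [OF endo(1)] endo_sum [OF endo(1)] sum.lessThan_Suc_shift scale_right_distrib del: sum.lessThan_Suc)
qed

text \<open>On products of lowering currents applied to \<open>w\<close>, \<open>h k\<close> acts as
  - 2 times the k-th power sum. Applied to a relation with one more exponent 0 it introduces the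
  exponent k, so the relations for all exponents follow from those for exponents 0 by induction on
  the number of prescribed exponents.\<close>

theorem lowering_relation:
  assumes "m < p + length s"
  shows "hsum s (\<lambda>l. foldr x l w) p = 0"
proof -
  let ?R = "\<lambda>s. hsum s (\<lambda>l. foldr x l w) p"
  have "?R (t @ replicate c 0) = 0" if "m < p + (length t + c)" for t c
    using that
  proof (induction "length t" arbitrary: t c)
    case 0
    then show ?case using A_eq_0 [of p c] by (simp add: A_def)
  next
    case (Suc n)
    then obtain k t' where t: "t = k # t'" and n: "length t' = n"
      by (metis length_Suc_conv)
    let ?s = "t' @ replicate (Suc c) 0"
    have R: "?R ?s = 0"
      by (rule Suc.hyps(1)) (use Suc.prems t n in auto)
    show ?case
    proof (cases "k = 0")
      case True
      have "?R (t @ replicate c 0) = ?R ?s"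
        by (rule hsum_perm [OF symm_x]) (simp add: t True)
      then show ?thesis using R by simp
    next
      case False
      have "0 = h k (?R ?s)"
        unfolding R by (simp add: endo_0 [OF endo(2)])
      also have "\<dots> = hsum ?s (\<lambda>l. h k (foldr x l w)) p"
        by (rule endo_hsum [OF endo(2), symmetric])
      also have "\<dots> = hsum ?s (\<lambda>l. - 2 *s (\<Sum>i<length ?s. foldr x (l[i := l ! i + k]) w)) p"
        by (rule hsum_cong) (use False in \<open>simp add: h_foldr\<close>)
      also have "\<dots> = - 2 *s (\<Sum>i<length ?s. hsum ?s (\<lambda>l. foldr x (l[i := l ! i + k]) w) p)"
        by (simp only: hsum_scale hsum_sum)
      also have "\<dots> = - 2 *s (\<Sum>i<n + Suc c. ?R (?s[i := ?s ! i + k]))"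
        using n by (simp add: hsum_shift)
      \<comment> \<open>Raising one of the first n exponents does not increase the number of
        prescribed ones, so these terms vanish by induction. Raising any of the \<open>Suc c\<close>
        zeros gives the wanted relation up to order.\<close>
      also have "(\<Sum>i<n + Suc c. ?R (?s[i := ?s ! i + k]))
          = (\<Sum>i<n. ?R (?s[i := ?s ! i + k])) + (\<Sum>i=n..<n + Suc c. ?R (?s[i := ?s ! i + k]))"
        by (subst sum.atLeastLessThan_concat [of 0 n, symmetric, simplified atLeast0LessThan]) auto
      also have "(\<Sum>i<n. ?R (?s[i := ?s ! i + k])) = 0"
      proof (rule sum.neutral, rule ballI)
        fix i assume "i \<in> {..<n}"
        then have i: "i < length t'" using n by simp
        then have "?s[i := ?s ! i + k] = t'[i := t' ! i + k] @ replicate (Suc c) 0"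
          by (simp add: list_update_append nth_append)
        moreover have "?R (t'[i := t' ! i + k] @ replicate (Suc c) 0) = 0"
          by (rule Suc.hyps(1)) (use Suc.prems t n in auto)
        ultimately show "?R (?s[i := ?s ! i + k]) = 0" by simp
      qed
      also have "(\<Sum>i=n..<n + Suc c. ?R (?s[i := ?s ! i + k])) = (\<Sum>i=n..<n + Suc c. ?R (t @ replicate c 0))"
      proof (rule sum.cong [OF refl])
        fix i assume i: "i \<in> {n..<n + Suc c}"
        have "i < length ?s" "?s ! i = 0"
          using i n by (auto simp: nth_append simp del: replicate_Suc)
        then have "mset (?s[i := ?s ! i + k]) = mset (t @ replicate c 0)"
          by (simp only: mset_update) (simp add: t)
        then show "?R (?s[i := ?s ! i + k]) = ?R (t @ replicate c 0)"
          by (rule hsum_perm [OF symm_x])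
      qed
      also have "\<dots> = of_nat (Suc c) *s ?R (t @ replicate c 0)"
        by (simp only: sum_constant_scale card_atLeastLessThan) simp
      finally show ?thesis by (simp del: of_nat_Suc)
    qed
  qed
  from this [of s 0] assms show ?thesis by simp
qed

end

section \<open>Adjoining one rank\<close>

definition act :: "(nat \<Rightarrow> nat \<Rightarrow> nat \<Rightarrow> 'v \<Rightarrow> 'v) \<Rightarrow> (nat \<times> nat \<times> nat) list \<Rightarrow> 'v \<Rightarrow> 'v" where
  "act E = foldr (\<lambda>(a, b, k). E a b k)"

lemma act_Nil [simp]: "act E [] v = v"
  and act_Cons [simp]: "act E ((a, b, k) # u) v = E a b k (act E u v)"
  and act_append [simp]: "act E (u @ u') v = act E u (act E u' v)"
  by (simp_all add: act_def)

definition letters :: "nat \<Rightarrow> (nat \<times> nat \<times> nat) set" where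
  "letters n = {1..n} \<times> {1..n} \<times> UNIV"

context vector_space_char_0
begin

definition stable :: "nat \<Rightarrow> (nat \<Rightarrow> nat \<Rightarrow> nat \<Rightarrow> 'v \<Rightarrow> 'v) \<Rightarrow> 'v set \<Rightarrow> bool" where
  "stable n E L \<longleftrightarrow> (\<forall>a\<in>{1..n}. \<forall>b\<in>{1..n}. \<forall>k. \<forall>v\<in>L. E a b k v \<in> L)"

lemma stable_act: "stable n E L \<Longrightarrow> set u \<subseteq> letters n \<Longrightarrow> v \<in> L \<Longrightarrow> act E u v \<in> L"
  by (induction u) (auto simp: stable_def letters_def)

text \<open>The highest weight conditions for gl_n[t] modulo \<open>L\<close>. Only the differences
  of the weights \<mu> are prescribed, since the eigenvalues themselves change when letters are
  split off.\<close>

definition weyl_vector :: "nat \<Rightarrow> (nat \<Rightarrow> nat) \<Rightarrow> (nat \<Rightarrow> nat \<Rightarrow> nat \<Rightarrow> 'v \<Rightarrow> 'v) \<Rightarrow> 'v set \<Rightarrow> 'v \<Rightarrow> bool" where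
  "weyl_vector n m E L w \<longleftrightarrow>
     (\<forall>a b k. 1 \<le> a \<and> a < b \<and> b \<le> n \<longrightarrow> E a b k w \<in> L) \<and>
     (\<forall>a k. 1 \<le> a \<and> a \<le> n \<and> 0 < k \<longrightarrow> E a a k w \<in> L) \<and>
     (\<exists>\<mu>. (\<forall>a. 1 \<le> a \<and> a \<le> n \<longrightarrow> E a a 0 w - \<mu> a *s w \<in> L) \<and>
          (\<forall>i. 1 \<le> i \<and> i < n \<longrightarrow> \<mu> i - \<mu> (Suc i) = of_nat (m i))) \<and>
     (\<forall>i. 1 \<le> i \<and> i < n \<longrightarrow> (E (Suc i) i 0 ^^ Suc (m i)) w \<in> L)"

text \<open>The argument is the usual one for a nilpotent lowering operator: \<open>e f\<^sup>k\<^sup>+\<^sup>1 v = (k + 1) (M - k) f\<^sup>k v\<close>.\<close>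
lemma lowering_power_in:
  assumes L: "subspace L" and endo: "endo e" "endo f" "endo h"
    and st: "\<And>v. v \<in> L \<Longrightarrow> e v \<in> L" "\<And>v. v \<in> L \<Longrightarrow> f v \<in> L" "\<And>v. v \<in> L \<Longrightarrow> h v \<in> L"
    and ef: "\<And>v. e (f v) = f (e v) + h v" and hf: "\<And>v. h (f v) = f (h v) - 2 *s f v"
    and v: "e v \<in> L" "h v - of_nat M *s v \<in> L" "(f ^^ N) v \<in> L"
  shows "(f ^^ Suc M) v \<in> L"
proof -
  have hk: "h ((f ^^ k) v) - (of_nat M - 2 * of_nat k) *s (f ^^ k) v \<in> L" for k
  proof (induction k)
    case 0
    then show ?case using v by simp
  next
    case (Suc k)
    have "h ((f ^^ Suc k) v) - (of_nat M - 2 * of_nat (Suc k)) *s (f ^^ Suc k) v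
        = f (h ((f ^^ k) v) - (of_nat M - 2 * of_nat k) *s (f ^^ k) v)"
      by (simp add: hf endo_diff [OF endo(2)] endo_add [OF endo(2)] endo_scale [OF endo(2)] algebra_simps scale_2)
    then show ?case using st(2) [OF Suc.IH] by simp
  qed
  have ek: "e ((f ^^ Suc k) v) - (of_nat (Suc k) * (of_nat M - of_nat k)) *s (f ^^ k) v \<in> L" for k
  proof (induction k)
    case 0
    have "e (f v) - of_nat M *s v = f (e v) + (h v - of_nat M *s v)"
      by (simp add: ef)
    also have "\<dots> \<in> L"
      by (rule subspace_add [OF L st(2) [OF v(1)] v(2)])
    finally show ?case by simp
  next
    case (Suc k)
    have "e ((f ^^ Suc (Suc k)) v) - (of_nat (Suc (Suc k)) * (of_nat M - of_nat (Suc k))) *s (f ^^ Suc k) v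
        = f (e ((f ^^ Suc k) v) - (of_nat (Suc k) * (of_nat M - of_nat k)) *s (f ^^ k) v)
          + (h ((f ^^ Suc k) v) - (of_nat M - 2 * of_nat (Suc k)) *s (f ^^ Suc k) v)"
    proof -
      have *: "(of_nat (Suc k) * (of_nat M - of_nat k)) + (of_nat M - 2 * of_nat (Suc k))
          = (of_nat (Suc (Suc k)) * (of_nat M - of_nat (Suc k)) :: 'a)"
        by (simp add: algebra_simps)
      show ?thesis
        unfolding * [symmetric] by (simp add: ef endo_diff [OF endo(2)] endo_scale [OF endo(2)] scale_left_distrib)
    qed
    then show ?case using st(2) [OF Suc.IH] hk [of "Suc k"] subspace_add [OF L] by simp
  qed
  have down: "(f ^^ k) v \<in> L" if "(f ^^ Suc k) v \<in> L" "M < k" for k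
  proof -
    let ?c = "of_nat (Suc k) * (of_nat M - of_nat k) :: 'a"
    have "?c *s (f ^^ k) v \<in> L"
      using subspace_diff [OF L st(1) [OF that(1)] ek [of k]] by simp
    then have "inverse ?c *s ?c *s (f ^^ k) v \<in> L"
      by (rule subspace_scale [OF L])
    moreover have "inverse ?c * ?c = 1"
      by (rule left_inverse) (use that(2) in \<open>simp del: of_nat_Suc\<close>)
    ultimately show ?thesis by (simp only: scale_scale scale_one)
  qed
  have up: "(f ^^ (N + k)) v \<in> L" for k
    using v st(2) by (induction k) simp_all
  have "(f ^^ (Suc M + k)) v \<in> L \<Longrightarrow> (f ^^ Suc M) v \<in> L" for k
  proof (induction k)
    case (Suc k)
    then show ?case using down [of "Suc M + k"] by simp
  qed simp
  then show ?thesis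
    using up [of "Suc M"] by (metis add.commute)
qed

end

text \<open>The algebra is gl_n[t] and not sl_n[t]: all matrix units then share one commutator
  formula, and the upper left corner of smaller size acts by the same operators.\<close>

locale current_module = vector_space_char_0 scale
  for scale :: "'a::field_char_0 \<Rightarrow> 'v::ab_group_add \<Rightarrow> 'v" (infixr \<open>*s\<close> 75) +
  fixes n :: nat and E :: "nat \<Rightarrow> nat \<Rightarrow> nat \<Rightarrow> 'v \<Rightarrow> 'v"
  assumes endo_E: "a \<in> {1..n} \<Longrightarrow> b \<in> {1..n} \<Longrightarrow> module_hom scale scale (E a b k)"
    and comm_E: "a \<in> {1..n} \<Longrightarrow> b \<in> {1..n} \<Longrightarrow> c \<in> {1..n} \<Longrightarrow> d \<in> {1..n} \<Longrightarrow>
      E a b k (E c d l v) = E c d l (E a b k v)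
        + (if b = c then E a d (k + l) v else 0) - (if d = a then E c b (k + l) v else 0)"
begin

lemma current_submodule:
  assumes n': "n' \<le> n"
  shows "current_module scale n' E"
proof (rule current_module.intro [OF vector_space_char_0_axioms], rule current_module_axioms.intro)
  show "endo (E a b k)" if "a \<in> {1..n'}" "b \<in> {1..n'}" for a b k
    by (rule endo_E) (use that n' in auto)
  show "E a b k (E c d l v) = E c d l (E a b k v)
        + (if b = c then E a d (k + l) v else 0) - (if d = a then E c b (k + l) v else 0)"
    if "a \<in> {1..n'}" "b \<in> {1..n'}" "c \<in> {1..n'}" "d \<in> {1..n'}" for a b c d k l v
    by (rule comm_E) (use that n' in auto)
qed

lemma endo_act:
  assumes "set u \<subseteq> letters n"
  shows "endo (act E u)"
  unfolding act_def
proof (rule endo_foldr)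
  fix x assume "x \<in> set u"
  then have "x \<in> letters n" using assms by blast
  then show "endo (case x of (a, b, k) \<Rightarrow> E a b k)"
    by (cases x) (simp add: letters_def endo_E)
qed

end

locale weyl_step = current_module scale "Suc r" E
  for scale :: "'a::field_char_0 \<Rightarrow> 'v::ab_group_add \<Rightarrow> 'v" (infixr \<open>*s\<close> 75) and r E +
  fixes m :: "nat \<Rightarrow> nat" and w :: 'v
  assumes weyl: "weyl_vector (Suc r) m E {0} w"
begin

lemma E_upper: "1 \<le> a \<Longrightarrow> a < b \<Longrightarrow> b \<le> Suc r \<Longrightarrow> E a b k w = 0"
  and E_diag: "1 \<le> a \<Longrightarrow> a \<le> Suc r \<Longrightarrow> 0 < k \<Longrightarrow> E a a k w = 0"
  and E_power: "1 \<le> i \<Longrightarrow> i \<le> r \<Longrightarrow> (E (Suc i) i 0 ^^ Suc (m i)) w = 0"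
  using weyl by (auto simp: weyl_vector_def less_Suc_eq_le)

lemma ex_weight: "\<exists>\<mu>. (\<forall>a. 1 \<le> a \<and> a \<le> Suc r \<longrightarrow> E a a 0 w = \<mu> a *s w) \<and>
          (\<forall>i. 1 \<le> i \<and> i \<le> r \<longrightarrow> \<mu> i - \<mu> (Suc i) = of_nat (m i))"
  using weyl by (simp add: weyl_vector_def less_Suc_eq_le)

definition Y :: "(nat \<times> nat) list \<Rightarrow> 'v \<Rightarrow> 'v" where
  "Y = foldr (\<lambda>(i, k). E (Suc r) i k)"

lemma Y_Nil [simp]: "Y [] v = v"
  and Y_Cons [simp]: "Y ((i, k) # t) v = E (Suc r) i k (Y t v)"
  and Y_append [simp]: "Y (t @ t') v = Y t (Y t' v)"
  by (simp_all add: Y_def)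

abbreviation ys :: "(nat \<times> nat) list set" where
  "ys \<equiv> lists ({1..r} \<times> UNIV)"

lemma ys_mem: "t \<in> ys \<Longrightarrow> (i, k) \<in> set t \<Longrightarrow> 1 \<le> i \<and> i \<le> r"
  by (auto simp: in_lists_conv_set)

lemma endo_Y:
  assumes t: "t \<in> ys"
  shows "endo (Y t)"
  unfolding Y_def
proof (rule endo_foldr)
  fix x assume x: "x \<in> set t"
  show "endo (case x of (i, k) \<Rightarrow> E (Suc r) i k)"
    using ys_mem [OF t, of "fst x" "snd x"] x by (cases x) (auto intro!: endo_E)
qed

lemma Y_perm:
  assumes t: "t \<in> ys" and "mset t = mset t'"
  shows "Y t v = Y t' v"
  unfolding Y_def
proof (rule foldr_perm [OF _ assms(2)])
  fix a b v assume ab: "a \<in> set t" "b \<in> set t"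
  obtain i k j l where a: "a = (i, k)" and b: "b = (j, l)" by (cases a, cases b)
  have "1 \<le> i \<and> i \<le> r" "1 \<le> j \<and> j \<le> r"
    using ys_mem [OF t] ab a b by auto
  then show "(case a of (i, k) \<Rightarrow> E (Suc r) i k) ((case b of (i, k) \<Rightarrow> E (Suc r) i k) v)
      = (case b of (i, k) \<Rightarrow> E (Suc r) i k) ((case a of (i, k) \<Rightarrow> E (Suc r) i k) v)"
    using comm_E [of "Suc r" i "Suc r" j k l v] by (simp add: a b)
qed

text \<open>The commutator of E_{a,b} t^k with E_{r+1,i} t^l is - E_{r+1,b} t^(k+l) if i = a, and 0
  otherwise; so gl_r[t] acts on the commuting letters by derivations.\<close>

lemma E_Y:
  assumes "a \<in> {1..r}" "b \<in> {1..r}"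
  shows "t \<in> ys \<Longrightarrow> E a b k (Y t v) = Y t (E a b k v)
     - (\<Sum>q<length t. if fst (t ! q) = a then Y (t[q := (b, snd (t ! q) + k)]) v else 0)"
proof (induction t)
  case (Cons x t)
  obtain i l where x: "x = (i, l)" by (cases x)
  have i: "i \<in> {1..r}" and t: "t \<in> ys" using Cons.prems x by auto
  have "E a b k (Y (x # t) v) = E (Suc r) i l (E a b k (Y t v)) - (if i = a then E (Suc r) b (k + l) (Y t v) else 0)"
    using comm_E [of a b "Suc r" i k l] assms i x by auto
  also have "E (Suc r) i l (E a b k (Y t v)) = Y (x # t) (E a b k v)
     - (\<Sum>q<length t. if fst (t ! q) = a then Y (x # t[q := (b, snd (t ! q) + k)]) v else 0)"
    using i endo_E [of "Suc r" i l]
    by (simp add: Cons.IH [OF t] x endo_diff endo_sum endo_0 if_distrib [of "E (Suc r) i l"] cong: if_cong)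
  finally show ?case
    by (simp add: x sum.lessThan_Suc_shift add.commute del: sum.lessThan_Suc cong: if_cong)
qed simp

lemma E_relation:
  assumes i: "1 \<le> i" "i \<le> r" and p: "m i < p + length s"
  shows "hsum s (\<lambda>l. foldr (E (Suc i) i) l w) p = 0"
proof -
  have range: "i \<in> {1..Suc r}" "Suc i \<in> {1..Suc r}" using i by auto
  interpret sl2_lowering scale "E (Suc i) i" "\<lambda>k v. E i i k v - E (Suc i) (Suc i) k v" "E i (Suc i) 1" w "m i"
  proof (rule sl2_lowering.intro [OF vector_space_char_0_axioms], rule sl2_lowering_axioms.intro)
    show "(E (Suc i) i 0 ^^ j) w = 0" if "m i < j" for j
    proof -
      have j: "j = (j - Suc (m i)) + Suc (m i)"
        using that by simp
      have "endo (E (Suc i) i 0)" using range endo_E by blast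
      then show ?thesis
        using E_power [OF i] endo_0 [OF endo_funpow] by (subst j) (simp only: funpow_add o_apply)
    qed
    note endo = endo_E [OF range(1) range(1)] endo_E [OF range(2) range(2)]
    show "endo (E (Suc i) i k)" for k
      by (rule endo_E [OF range(2,1)])
    show "endo (E i (Suc i) 1)"
      by (rule endo_E [OF range(1,2)])
    show "endo (\<lambda>v. E i i k v - E (Suc i) (Suc i) k v)" for k
      by (rule endoI) (simp_all add: endo_add [OF endo(1)] endo_add [OF endo(2)]
        endo_scale [OF endo(1)] endo_scale [OF endo(2)] scale_right_diff_distrib)
    show "E (Suc i) i a (E (Suc i) i b v) = E (Suc i) i b (E (Suc i) i a v)" for a b v
      using comm_E [OF range(2,1) range(2,1), of a b v] by simp
    show "E i i k (E (Suc i) i a v) - E (Suc i) (Suc i) k (E (Suc i) i a v)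
        = E (Suc i) i a (E i i k v - E (Suc i) (Suc i) k v) - 2 *s E (Suc i) i (a + k) v" for k a v
      using comm_E [OF range(1,1) range(2,1), of k a v] comm_E [OF range(2,2) range(2,1), of k a v]
      by (simp add: endo_diff [OF endo_E [OF range(2,1)]] scale_2 add.commute)
    show "E i (Suc i) 1 (E (Suc i) i a v)
        = E (Suc i) i a (E i (Suc i) 1 v) + (E i i (Suc a) v - E (Suc i) (Suc i) (Suc a) v)" for a v
      using comm_E [OF range(1,2) range(2,1), of 1 a v] by simp
    show "E i (Suc i) 1 w = 0"
      using i by (simp add: E_upper)
    show "E i i k w - E (Suc i) (Suc i) k w = 0" if "0 < k" for k
      using i that by (simp add: E_diag)
  qed
  show ?thesis by (rule lowering_relation [OF p])
qed

lemma hsum_lift: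
  assumes "endo f" "hsum s F p = 0"
  shows "hsum s (\<lambda>l. f (F l)) p = 0"
  using endo_hsum [OF assms(1), of s F p] endo_0 [OF assms(1)] assms(2) by simp

abbreviation height :: "(nat \<times> nat) list \<Rightarrow> nat" where
  "height t \<equiv> sum_list (map fst t)"

abbreviation degree :: "(nat \<times> nat) list \<Rightarrow> nat" where
  "degree t \<equiv> sum_list (map snd t)"

definition W :: "((nat \<times> nat) list \<Rightarrow> bool) \<Rightarrow> 'v set" where
  "W P = span {act E u (Y t w) |u t. set u \<subseteq> letters r \<and> t \<in> ys \<and> P t}"

lemma subspace_W: "subspace (W P)"
  by (simp add: W_def)

lemma W_base: "t \<in> ys \<Longrightarrow> P t \<Longrightarrow> Y t w \<in> W P"
  unfolding W_def by (rule span_base) (auto intro!: exI [of _ "[]"] exI [of _ t])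

lemma stable_W: "stable r E (W P)"
  unfolding stable_def
proof (intro ballI allI)
  fix a b k v assume ab: "a \<in> {1..r}" "b \<in> {1..r}" and v: "v \<in> W P"
  show "E a b k v \<in> W P"
  proof (rule endo_span [OF _ _ subspace_W v [unfolded W_def]])
    show "endo (E a b k)" using ab by (auto intro: endo_E)
    fix x assume "x \<in> {act E u (Y t w) |u t. set u \<subseteq> letters r \<and> t \<in> ys \<and> P t}"
    then obtain u t where "x = act E u (Y t w)" "set u \<subseteq> letters r" "t \<in> ys" "P t"
      by blast
    then show "E a b k x \<in> W P"
      using ab unfolding W_def
      by (intro span_base CollectI exI [of _ "(a, b, k) # u"] exI [of _ t]) (auto simp: letters_def)
  qed
qed

definition V :: "nat \<Rightarrow> nat \<Rightarrow> 'v set" where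
  "V c q = W (\<lambda>t. length t = c \<and> q < height t)"

lemma subspace_V: "subspace (V c q)"
  and V_base: "t \<in> ys \<Longrightarrow> length t = c \<Longrightarrow> q < height t \<Longrightarrow> Y t w \<in> V c q"
  and stable_V: "stable r E (V c q)"
  by (simp_all add: V_def subspace_W W_base stable_W)

lemma height_update: "q < length t \<Longrightarrow> height (t[q := (b, k)]) + fst (t ! q) = height t + b"
  by (induction t arbitrary: q) (auto split: nat.splits)

lemma degree_update: "q < length t \<Longrightarrow> degree (t[q := (b, k)]) + snd (t ! q) = degree t + k"
  by (induction t arbitrary: q) (auto split: nat.splits)

lemma ys_update: "t \<in> ys \<Longrightarrow> 1 \<le> b \<Longrightarrow> b \<le> r \<Longrightarrow> t[q := (b, k)] \<in> ys"
  by (auto simp: in_lists_conv_set dest!: set_update_subset_insert [THEN subsetD])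

text \<open>Moving E_{i+1,i} to the left either leaves the letters alone or turns an index i + 1
  into i. The height drops by at most one each time, hence stays above q after
  \<open>length b\<close> moves.\<close>

lemma Y_E_in_V:
  assumes i: "1 \<le> i" "i < r"
  shows "t \<in> ys \<Longrightarrow> length t = c \<Longrightarrow> q + length b < height t \<Longrightarrow> Y t (foldr (E (Suc i) i) b w) \<in> V c q"
proof (induction b arbitrary: t)
  case Nil
  then show ?case by (simp add: V_base)
next
  case (Cons x b)
  let ?v = "foldr (E (Suc i) i) b w"
  have "Y t (E (Suc i) i x ?v) = E (Suc i) i x (Y t ?v)
      + (\<Sum>p<length t. if fst (t ! p) = Suc i then Y (t[p := (i, snd (t ! p) + x)]) ?v else 0)"
    using E_Y [of "Suc i" i t x ?v] Cons.prems i by simp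
  also have "\<dots> \<in> V c q"
  proof (intro subspace_add subspace_sum subspace_V)
    have "Y t ?v \<in> V c q"
      using Cons by simp
    then show "E (Suc i) i x (Y t ?v) \<in> V c q"
      using stable_V i by (simp add: stable_def)
    fix p assume p: "p \<in> {..<length t}"
    show "(if fst (t ! p) = Suc i then Y (t[p := (i, snd (t ! p) + x)]) ?v else 0) \<in> V c q"
    proof (cases "fst (t ! p) = Suc i")
      case True
      have "Y (t[p := (i, snd (t ! p) + x)]) ?v \<in> V c q"
      proof (rule Cons.IH)
        show "q + length b < height (t[p := (i, snd (t ! p) + x)])"
          using height_update [of p t i "snd (t ! p) + x"] p True Cons.prems(3) by simp
        show "t[p := (i, snd (t ! p) + x)] \<in> ys"
          by (rule ys_update) (use Cons.prems i in simp_all)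
      qed (use Cons.prems in simp)
      then show ?thesis using True by simp
    qed (simp add: subspace_0 [OF subspace_V])
  qed
  finally show ?case by simp
qed

text \<open>If a sum consists of copies of \<^term>\<open>D\<close> up to elements of \<^term>\<open>L\<close>, then a positive multiple of \<^term>\<open>D\<close> lies in \<^term>\<open>L\<close>.\<close>
lemma multiple_in_subspace:
  assumes L: "subspace L" and f: "\<And>p. p \<in> A \<Longrightarrow> f p = D \<or> f p \<in> L" and D: "D + sum f A \<in> L"
  shows "D \<in> L"
proof -
  have "\<exists>N v. v \<in> L \<and> sum f A = of_nat N *s D + v"
    using f
  proof (induction A rule: infinite_finite_induct)
    case (insert p A)
    then obtain N v where v: "v \<in> L" "sum f A = of_nat N *s D + v"
      by auto
    from insert.prems [of p] show ?case
    proof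
      assume "f p = D"
      then have "sum f (insert p A) = of_nat (Suc N) *s D + v"
        using insert.hyps v by (simp add: scale_left_distrib)
      then show ?thesis using v by blast
    next
      assume "f p \<in> L"
      then have "v + f p \<in> L" "sum f (insert p A) = of_nat N *s D + (v + f p)"
        using insert.hyps v subspace_add [OF L] by simp_all
      then show ?thesis by blast
    qed simp
  qed (auto intro!: exI [of _ 0] exI [of _ "0 :: 'v"] simp: subspace_0 [OF L])
  then obtain N v where v: "v \<in> L" "sum f A = of_nat N *s D + v"
    by blast
  have "of_nat (Suc N) *s D = (D + sum f A) - v"
    by (simp add: v scale_left_distrib)
  then have "of_nat (Suc N) *s D \<in> L"
    using subspace_diff [OF L D v(1)] by simp
  then have "inverse (of_nat (Suc N)) *s of_nat (Suc N) *s D \<in> L"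
    by (rule subspace_scale [OF L])
  moreover have "inverse (of_nat (Suc N)) * of_nat (Suc N) = (1 :: 'a)"
    by (rule left_inverse) (simp del: of_nat_Suc)
  ultimately show ?thesis by (simp only: scale_scale scale_one)
qed

end

section \<open>Transfer of the simple root relations to the letters E_{r+1,i}\<close>

context weyl_step
begin

text \<open>The first j currents E_{i+1,i} have already been replaced by letters E_{r+1,i}. For the
  next one an auxiliary letter E_{r+1,i+1} is adjoined to \<open>t\<close> and the current is moved
  through. This yields the wanted sum, a part in \<open>V c q\<close>, and terms where another
  letter of index i + 1 was hit. The auxiliary letter adds i + 1 to the height: i make up for the
  new letter, and the one left over is the allowance on q for each current still to be
  replaced.\<close>

lemma transfer_step:
  assumes i: "1 \<le> i" "i < r" and p: "m i < p + length s"
  shows "j \<le> length s \<Longrightarrow> t \<in> ys \<Longrightarrow> length t + j = c \<Longrightarrow> q + (length s - j) \<le> height t + i * j \<Longrightarrow>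
    hsum s (\<lambda>b. Y (t @ map (Pair i) (take j b)) (foldr (E (Suc i) i) (drop j b) w)) p \<in> V c q"
  using p
proof (induction j arbitrary: s t)
  case 0
  have "hsum s (\<lambda>b. Y t (foldr (E (Suc i) i) b w)) p = 0"
    by (rule hsum_lift [OF endo_Y E_relation]) (use 0 i in auto)
  then show ?case by (simp add: subspace_0 [OF subspace_V])
next
  case (Suc j)
  define G where "G j t b = Y (t @ map (Pair i) (take j b)) (foldr (E (Suc i) i) (drop j b) w)" for j t b
  from Suc.prems have "hsum s (G (Suc j) t) p \<in> V c q"
  proof (induction "degree t" arbitrary: s t rule: less_induct)
    case (less t)
    note prems = less.prems
    let ?t1 = "(Suc i, 0) # t"
    define R where "R b = E (Suc i) i (b ! j) (Y (?t1 @ map (Pair i) (take j b)) (foldr (E (Suc i) i) (drop (Suc j) b) w))" for b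
    \<comment> \<open>The current hits \<open>t ! x\<close> instead of the auxiliary letter. Up to
      order the two exchange roles: (i + 1, 0) stays in \<open>t\<close> and the exponent of the hit
      letter is added to the \<open>j\<close>-th variable. If that exponent is 0 this is the wanted
      term once more; otherwise \<open>degree t\<close> has dropped.\<close>
    define H where "H x b = (if fst (t ! x) = Suc i
        then G (Suc j) (t[x := (Suc i, 0)]) (b[j := b ! j + snd (t ! x)]) else 0)" for x b
    have t1: "?t1 \<in> ys"
      using prems(2) i by simp
    have split: "G j ?t1 b = R b + (G (Suc j) t b + (\<Sum>x<length t. H x b))" if b: "length b = length s" for b
    proof -
      let ?tt = "?t1 @ map (Pair i) (take j b)"
      let ?v = "foldr (E (Suc i) i) (drop (Suc j) b) w"
      have j: "j < length b" using b prems(1) by simp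
      have tt: "?tt \<in> ys" using t1 i by auto
      have take: "take (Suc j) b = take j b @ [b ! j]"
        by (rule take_Suc_conv_app_nth [OF j])
      have "G j ?t1 b = Y ?tt (E (Suc i) i (b ! j) ?v)"
        using Cons_nth_drop_Suc [OF j, symmetric] by (simp add: G_def)
      also have "\<dots> = R b + (\<Sum>x<length ?tt. if fst (?tt ! x) = Suc i then Y (?tt[x := (i, snd (?tt ! x) + b ! j)]) ?v else 0)"
        using E_Y [of "Suc i" i ?tt "b ! j" ?v] tt i by (simp add: R_def)
      also have "(\<Sum>x<length ?tt. if fst (?tt ! x) = Suc i then Y (?tt[x := (i, snd (?tt ! x) + b ! j)]) ?v else 0)
          = (\<Sum>x<Suc (length t). if fst (?tt ! x) = Suc i then Y (?tt[x := (i, snd (?tt ! x) + b ! j)]) ?v else 0)"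
      proof (rule sum.mono_neutral_right)
        show "\<forall>x\<in>{..<length ?tt} - {..<Suc (length t)}.
            (if fst (?tt ! x) = Suc i then Y (?tt[x := (i, snd (?tt ! x) + b ! j)]) ?v else 0) = 0"
        proof
          fix x assume x: "x \<in> {..<length ?tt} - {..<Suc (length t)}"
          then have "?tt ! x = map (Pair i) (take j b) ! (x - length ?t1)"
            by (simp only: nth_append) simp
          also have "\<dots> = (i, take j b ! (x - length ?t1))"
            using x by (intro nth_map) auto
          finally have "fst (?tt ! x) \<noteq> Suc i" by (simp only: fst_conv)
          then show "(if fst (?tt ! x) = Suc i then Y (?tt[x := (i, snd (?tt ! x) + b ! j)]) ?v else 0) = 0"
            by (simp only: if_False)
        qed
      qed auto
      also have "\<dots> = Y (((i, b ! j) # t) @ map (Pair i) (take j b)) ?v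
          + (\<Sum>x<length t. if fst (t ! x) = Suc i
               then Y (?t1[Suc x := (i, snd (t ! x) + b ! j)] @ map (Pair i) (take j b)) ?v else 0)"
        by (auto simp: sum.lessThan_Suc_shift nth_append list_update_append simp del: sum.lessThan_Suc intro!: sum.cong)
      also have "Y (((i, b ! j) # t) @ map (Pair i) (take j b)) ?v = G (Suc j) t b"
        unfolding G_def by (rule Y_perm) (use prems(2) i in \<open>auto simp: take\<close>)
      also have "(\<Sum>x<length t. if fst (t ! x) = Suc i
               then Y (?t1[Suc x := (i, snd (t ! x) + b ! j)] @ map (Pair i) (take j b)) ?v else 0) = (\<Sum>x<length t. H x b)"
      proof (rule sum.cong [OF refl])
        fix x assume x: "x \<in> {..<length t}"
        have "Y (?t1[Suc x := (i, snd (t ! x) + b ! j)] @ map (Pair i) (take j b)) ?v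
            = G (Suc j) (t[x := (Suc i, 0)]) (b[j := b ! j + snd (t ! x)])"
          unfolding G_def drop_update_cancel [OF lessI]
        proof (rule Y_perm)
          show "?t1[Suc x := (i, snd (t ! x) + b ! j)] @ map (Pair i) (take j b) \<in> ys"
            using ys_update [OF prems(2), of i] i by auto
          have "take (Suc j) (b[j := b ! j + snd (t ! x)]) = take j b @ [b ! j + snd (t ! x)]"
            using j by (simp add: take_Suc_conv_app_nth)
          then show "mset (?t1[Suc x := (i, snd (t ! x) + b ! j)] @ map (Pair i) (take j b))
              = mset (t[x := (Suc i, 0)] @ map (Pair i) (take (Suc j) (b[j := b ! j + snd (t ! x)])))"
            using x by (simp add: mset_update add.commute)
        qed
        then show "(if fst (t ! x) = Suc i
               then Y (?t1[Suc x := (i, snd (t ! x) + b ! j)] @ map (Pair i) (take j b)) ?v else 0) = H x b"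
          by (simp add: H_def)
      qed
      finally show ?thesis .
    qed
    have "hsum s (G j ?t1) p = hsum s (\<lambda>b. R b + (G (Suc j) t b + (\<Sum>x<length t. H x b))) p"
      by (rule hsum_cong) (rule split)
    also have "\<dots> = hsum s R p + (hsum s (G (Suc j) t) p + (\<Sum>x<length t. hsum s (H x) p))"
      by (simp only: hsum_add hsum_sum)
    finally have eq: "hsum s (G (Suc j) t) p + (\<Sum>x<length t. hsum s (H x) p) = hsum s (G j ?t1) p - hsum s R p"
      by simp
    have "hsum s (G j ?t1) p \<in> V c q"
      unfolding G_def by (rule Suc.IH) (use prems t1 in auto)
    moreover have "hsum s R p \<in> V c q"
    proof (rule hsum_in_subspace [OF subspace_V])
      fix b :: "nat list" assume b: "length b = length s"
      have "Y (?t1 @ map (Pair i) (take j b)) (foldr (E (Suc i) i) (drop (Suc j) b) w) \<in> V c q"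
        by (rule Y_E_in_V [OF i]) (use t1 i b prems in \<open>auto simp: sum_list_triv o_def algebra_simps\<close>)
      then show "R b \<in> V c q"
        using stable_V i by (auto simp: R_def stable_def)
    qed
    ultimately have sum: "hsum s (G (Suc j) t) p + (\<Sum>x<length t. hsum s (H x) p) \<in> V c q"
      unfolding eq by (rule subspace_diff [OF subspace_V])
    show ?case
    proof (rule multiple_in_subspace [OF subspace_V _ sum])
      fix x assume "x \<in> {..<length t}"
      then have x: "x < length t" by simp
      show "hsum s (H x) p = hsum s (G (Suc j) t) p \<or> hsum s (H x) p \<in> V c q"
      proof (cases "fst (t ! x) = Suc i")
        case False
        then have "H x = (\<lambda>b. 0)" by (simp add: H_def fun_eq_iff)
        then show ?thesis by (simp add: subspace_0 [OF subspace_V])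
      next
        case True
        let ?k = "snd (t ! x)"
        have H: "hsum s (H x) p = hsum (s[j := s ! j + ?k]) (G (Suc j) (t[x := (Suc i, 0)])) p"
          using True prems(1) by (simp add: H_def [abs_def] hsum_shift)
        show ?thesis
        proof (cases "?k = 0")
          case k: True
          then have "t[x := (Suc i, 0)] = t"
            using True by (metis list_update_id prod.collapse)
          then show ?thesis unfolding H k by simp
        next
          case False
          have "hsum (s[j := s ! j + ?k]) (G (Suc j) (t[x := (Suc i, 0)])) p \<in> V c q"
          proof (rule less.hyps)
            show "degree (t[x := (Suc i, 0)]) < degree t"
              using degree_update [OF x, of "Suc i" 0] False by simp
            show "t[x := (Suc i, 0)] \<in> ys"
              using ys_update [OF prems(2)] i by simp
            show "q + (length (s[j := s ! j + ?k]) - Suc j) \<le> height (t[x := (Suc i, 0)]) + i * Suc j"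
              using height_update [OF x, of "Suc i" 0] True prems(4) by simp
          qed (use prems in simp_all)
          then show ?thesis unfolding H ..
        qed
      qed
    qed
  qed
  then show ?case by (simp add: G_def [abs_def])
qed

lemma Y_relation:
  assumes i: "1 \<le> i" "i \<le> r" and t: "t \<in> ys" and p: "m i < p + length s"
  shows "hsum s (\<lambda>b. Y (t @ map (Pair i) b) w) p \<in> V (length t + length s) (height t + i * length s)"
proof (cases "i = r")
  case True
  have Yr: "Y (map (Pair r) b) w = foldr (E (Suc r) r) b w" for b
    by (induction b) simp_all
  have "hsum s (\<lambda>b. Y t (foldr (E (Suc i) i) b w)) p = 0"
    by (rule hsum_lift [OF endo_Y E_relation]) (use assms in auto)
  then show ?thesis using True by (simp add: Yr subspace_0 [OF subspace_V])
next
  case False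
  then have "hsum s (\<lambda>b. Y (t @ map (Pair i) (take (length s) b)) (foldr (E (Suc i) i) (drop (length s) b) w)) p
      \<in> V (length t + length s) (height t + i * length s)"
    by (intro transfer_step) (use assms in auto)
  also have "hsum s (\<lambda>b. Y (t @ map (Pair i) (take (length s) b)) (foldr (E (Suc i) i) (drop (length s) b) w)) p
      = hsum s (\<lambda>b. Y (t @ map (Pair i) b) w) p"
    by (rule hsum_cong) simp
  finally show ?thesis .
qed

abbreviation mult :: "(nat \<times> nat) list \<Rightarrow> nat \<Rightarrow> nat" where
  "mult t i \<equiv> count_list (map fst t) i"

lemma mset_filter_fst:
  "mset (filter (\<lambda>x. fst x \<noteq> i) t @ map (Pair i) (map snd (filter (\<lambda>x. fst x = i) t))) = mset t"
  by (induction t) auto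

lemma mult_conv_length: "mult t i = length (filter (\<lambda>x. fst x = i) t)"
  by (induction t) auto

lemma Y_box_step:
  assumes t: "t \<in> ys" and i: "1 \<le> i" "i \<le> r"
  shows "Y t w \<in> span ({Y t' w |t'. t' \<in> ys \<and> mset (map fst t') = mset (map fst t) \<and> degree t' = degree t \<and>
      {x \<in> set t'. fst x \<noteq> i} = {x \<in> set t. fst x \<noteq> i} \<and> (\<forall>k. (i, k) \<in> set t' \<longrightarrow> k + mult t i \<le> m i)}
      \<union> V (length t) (height t))"
    (is "_ \<in> span (?B \<union> _)")
proof -
  define t0 where "t0 = filter (\<lambda>x. fst x \<noteq> i) t"
  define s0 where "s0 = map snd (filter (\<lambda>x. fst x = i) t)"
  \<comment> \<open>The relations are homogeneous, so they survive the restriction to one total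
    degree. It forces the spanning monomials to have the degree of \<open>t\<close>, on which the
    later induction on the degree relies.\<close>
  define F where "F s = (if sum_list s = sum_list s0 then Y (t0 @ map (Pair i) s) w else 0)" for s
  have t0: "t0 \<in> ys" using t by (auto simp: t0_def)
  have msett: "mset (t0 @ map (Pair i) s0) = mset t"
    unfolding t0_def s0_def by (rule mset_filter_fst)
  have t1: "t0 @ map (Pair i) s \<in> ys" for s :: "nat list"
    using t0 i by auto
  have fst_eq: "mset (map fst (t0 @ map (Pair i) s)) = mset (map fst t)" if "length s = length s0" for s :: "nat list"
  proof -
    have "mset (map fst t) = mset (map fst (t0 @ map (Pair i) s0))"
      using arg_cong [OF msett, of "image_mset fst"] by (simp only: mset_map)
    then show ?thesis using that by (simp add: o_def map_replicate_const)
  qed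
  have snd_eq: "degree (t0 @ map (Pair i) s) = degree t" if "sum_list s = sum_list s0" for s
  proof -
    have "degree t = degree (t0 @ map (Pair i) s0)"
      using arg_cong [OF msett, of "\<lambda>M. sum_mset (image_mset snd M)"]
      by (simp only: mset_map [symmetric] sum_mset_sum_list)
    then show ?thesis using that by (simp add: o_def)
  qed
  have V: "V (length t) (height t) = V (length t0 + length s) (height t0 + i * length s)" if "length s = length s0" for s :: "nat list"
  proof -
    have "length t = length t0 + length s"
      using arg_cong [OF msett, of size] that by simp
    moreover have "height t = height (t0 @ map (Pair i) s)"
      using fst_eq [OF that] by (metis sum_mset_sum_list)
    ultimately show ?thesis by (simp add: o_def sum_list_triv mult.commute)
  qed
  have "symm F"
  proof (rule symmI)
    fix l l' :: "nat list" assume l: "mset l = mset l'"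
    then have "sum_list l = sum_list l'" by (metis sum_mset_sum_list)
    moreover have "Y (t0 @ map (Pair i) l) w = Y (t0 @ map (Pair i) l') w"
      by (rule Y_perm [OF t1]) (simp add: l)
    ultimately show "F l = F l'" by (simp add: F_def)
  qed
  moreover have "hsum s F p \<in> V (length t) (height t)" if s: "length s = length s0" "m i < p + length s0" for s p
  proof (cases "sum_list s + p = sum_list s0")
    case True
    then have "hsum s F p = hsum s (\<lambda>b. Y (t0 @ map (Pair i) b) w) p"
      by (intro hsum_cong) (simp add: F_def)
    then show ?thesis
      unfolding V [OF s(1)] using Y_relation [OF i t0, of p s] s by simp
  next
    case False
    then have "hsum s F p = hsum s (\<lambda>b. 0) p"
      by (intro hsum_cong) (simp add: F_def)
    then show ?thesis by (simp add: subspace_0 [OF subspace_V])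
  qed
  ultimately have "F s0 \<in> span ({F s |s. length s = length s0 \<and> (\<forall>x\<in>set s. x + length s0 \<le> m i)} \<union> V (length t) (height t))"
    by (intro box_spanning [OF subspace_V]) auto
  moreover have "F s0 = Y t w"
    using Y_perm [OF t1 msett] by (simp add: F_def)
  moreover have "{F s |s. length s = length s0 \<and> (\<forall>x\<in>set s. x + length s0 \<le> m i)} \<union> V (length t) (height t)
      \<subseteq> span (?B \<union> V (length t) (height t))"
  proof -
    have "F s \<in> span (?B \<union> V (length t) (height t))" if s: "length s = length s0" "\<forall>x\<in>set s. x + length s0 \<le> m i" for s
    proof (cases "sum_list s = sum_list s0")
      case True
      let ?t = "t0 @ map (Pair i) s"
      have "?t \<in> ys \<and> mset (map fst ?t) = mset (map fst t) \<and> degree ?t = degree t"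
        using t1 fst_eq [OF s(1)] snd_eq [OF True] by blast
      moreover have "{x \<in> set ?t. fst x \<noteq> i} = {x \<in> set t. fst x \<noteq> i}" "\<forall>k. (i, k) \<in> set ?t \<longrightarrow> k + mult t i \<le> m i"
        using s(2) by (auto simp: t0_def mult_conv_length s0_def)
      ultimately have "Y ?t w \<in> ?B" by blast
      then show ?thesis using True by (simp add: F_def span_base)
    next
      case False
      then show ?thesis by (simp add: F_def span_zero)
    qed
    then show ?thesis by (auto intro: span_base)
  qed
  ultimately show ?thesis
    using span_minimal [OF _ subspace_span] by (metis (no_types, lifting) subsetD)
qed

definition box :: "nat \<Rightarrow> (nat \<times> nat) list \<Rightarrow> (nat \<times> nat) list set" where
  "box j t = {t' \<in> ys. mset (map fst t') = mset (map fst t) \<and> degree t' = degree t \<and>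
     (\<forall>(i, k)\<in>set t'. i \<le> j \<longrightarrow> k + mult t i \<le> m i)}"

text \<open>The indices are treated one after another: the step for \<open>Suc j\<close> changes
  neither the letters of other indices nor any multiplicity, so the bounds already reached
  persist.\<close>

lemma Y_box_induct:
  "t \<in> ys \<Longrightarrow> j \<le> r \<Longrightarrow> Y t w \<in> span ((\<lambda>t'. Y t' w) ` box j t \<union> V (length t) (height t))"
proof (induction j)
  case 0
  then have "t \<in> box 0 t"
    by (auto simp: box_def dest: ys_mem)
  then show ?case by (auto intro: span_base)
next
  case (Suc j)
  let ?S = "span ((\<lambda>t'. Y t' w) ` box (Suc j) t \<union> V (length t) (height t))"
  have "Y t' w \<in> ?S" if t': "t' \<in> box j t" for t'
  proof -
    have eq: "mset (map fst t') = mset (map fst t)" and t'y: "t' \<in> ys"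
      using t' by (auto simp: box_def)
    have "length t' = length t" "height t' = height t" "\<And>i. mult t' i = mult t i"
      using eq by (metis size_mset length_map) (use eq in \<open>metis sum_mset_sum_list\<close>, use eq in \<open>metis count_mset\<close>)
    then have "Y t' w \<in> span ({Y t'' w |t''. t'' \<in> ys \<and> mset (map fst t'') = mset (map fst t') \<and> degree t'' = degree t' \<and>
      {x \<in> set t''. fst x \<noteq> Suc j} = {x \<in> set t'. fst x \<noteq> Suc j} \<and> (\<forall>k. (Suc j, k) \<in> set t'' \<longrightarrow> k + mult t (Suc j) \<le> m (Suc j))}
      \<union> V (length t) (height t))" (is "_ \<in> span (?B \<union> _)")
      using Y_box_step [OF t'y, of "Suc j"] Suc.prems by simp
    moreover have "?B \<subseteq> (\<lambda>t'. Y t' w) ` box (Suc j) t"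
    proof
      fix v assume "v \<in> ?B"
      then obtain t'' where v: "v = Y t'' w" and t'': "t'' \<in> ys" "mset (map fst t'') = mset (map fst t')" "degree t'' = degree t'"
        "{x \<in> set t''. fst x \<noteq> Suc j} = {x \<in> set t'. fst x \<noteq> Suc j}"
        "\<forall>k. (Suc j, k) \<in> set t'' \<longrightarrow> k + mult t (Suc j) \<le> m (Suc j)"
        by blast
      have "k + mult t i \<le> m i" if "(i, k) \<in> set t''" "i \<le> Suc j" for i k
      proof (cases "i = Suc j")
        case True
        then show ?thesis using t'' that by simp
      next
        case False
        then have "(i, k) \<in> {x \<in> set t'. fst x \<noteq> Suc j}"
          using that unfolding t''(4) [symmetric] by simp
        then show ?thesis using t' that False by (auto simp: box_def)
      qed
      then have "t'' \<in> box (Suc j) t"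
        using t'' t' unfolding box_def by auto
      then show "v \<in> (\<lambda>t'. Y t' w) ` box (Suc j) t" using v by blast
    qed
    ultimately show ?thesis
      using span_mono by (meson Un_mono order_refl subsetD)
  qed
  then have "(\<lambda>t'. Y t' w) ` box j t \<union> V (length t) (height t) \<subseteq> ?S"
    by (auto intro: span_base)
  then show ?case
    using Suc span_minimal [OF _ subspace_span] by (meson Suc_leD subsetD)
qed

end

section \<open>Monomials in the letters as Weyl vectors for smaller rank\<close>

context vector_space_char_0
begin

text \<open>The Leibniz rule f^(k+1) y = y f^(k+1) - (k + 1) z f^k, valid since the commutator of f
  and y is - z and z commutes with f.\<close>

lemma nilpotent_on_product:
  assumes endo: "endo f" "endo y" "endo z"
    and comm: "\<And>v. f (y v) = y (f v) - z v" "\<And>v. f (z v) = z (f v)"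
    and v: "(f ^^ N) v = 0"
  shows "(f ^^ Suc N) (y v) = 0"
proof -
  have z: "(f ^^ k) (z v) = z ((f ^^ k) v)" for k
    by (induction k) (simp_all add: comm(2))
  have "(f ^^ Suc k) (y v) = y ((f ^^ Suc k) v) - of_nat (Suc k) *s z ((f ^^ k) v)" for k
  proof (induction k)
    case 0
    then show ?case by (simp add: comm)
  next
    case (Suc k)
    have "(f ^^ Suc (Suc k)) (y v) = f (y ((f ^^ Suc k) v) - of_nat (Suc k) *s z ((f ^^ k) v))"
      unfolding Suc.IH [symmetric] by simp
    also have "\<dots> = y ((f ^^ Suc (Suc k)) v) - z ((f ^^ Suc k) v) - of_nat (Suc k) *s z ((f ^^ Suc k) v)"
      by (simp add: comm endo_diff [OF endo(1)] endo_scale [OF endo(1)] del: of_nat_Suc)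
    finally show ?case by (simp add: scale_left_distrib scale_2)
  qed
  from this [of N] show ?thesis
    using v by (simp add: endo_0 [OF endo(1)] endo_0 [OF endo(2)] endo_0 [OF endo(3)])
qed

end

context weyl_step
begin

text \<open>Any exponent will do here; \<open>lowering_power_in\<close> cuts it down to the one
  dictated by the weight.\<close>

lemma nilpotent_Y:
  assumes i: "1 \<le> i" "i < r"
  shows "t \<in> ys \<Longrightarrow> \<exists>N. (E (Suc i) i 0 ^^ N) (Y t w) = 0"
proof (induction t)
  case Nil
  then show ?case using E_power [of i] i by (auto intro!: exI [of _ "Suc (m i)"] simp del: funpow.simps)
next
  case (Cons x t)
  obtain j k where x: "x = (j, k)" by (cases x)
  have j: "1 \<le> j" "j \<le> r" using Cons.prems x by auto
  obtain N where N: "(E (Suc i) i 0 ^^ N) (Y t w) = 0"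
    using Cons by auto
  let ?z = "\<lambda>v. if j = Suc i then E (Suc r) i k v else 0"
  have "(E (Suc i) i 0 ^^ Suc N) (E (Suc r) j k (Y t w)) = 0"
  proof (rule nilpotent_on_product [where z = ?z, OF _ _ _ _ _ N])
    show "endo (E (Suc i) i 0)" "endo (E (Suc r) j k)"
      using i j by (auto intro!: endo_E)
    have "endo (E (Suc r) i k)"
      using i j by (auto intro!: endo_E)
    then show "endo ?z"
      by (intro endoI) (auto simp: endo_add endo_scale)
    show "E (Suc i) i 0 (E (Suc r) j k v) = E (Suc r) j k (E (Suc i) i 0 v) - ?z v" for v
      using comm_E [of "Suc i" i "Suc r" j 0 k v] i j by simp
    show "E (Suc i) i 0 (?z v) = ?z (E (Suc i) i 0 v)" for v
      using comm_E [of "Suc i" i "Suc r" i 0 k v] i endo_0 [OF endo_E [of "Suc i" i 0]] by simp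
  qed
  then show ?case by (intro exI [of _ "Suc N"]) (simp add: x)
qed

lemma E_upper_Y:
  assumes "1 \<le> a" "a < b" "b \<le> r" "t \<in> ys"
  shows "E a b k (Y t w) \<in> W (\<lambda>t'. length t' = length t \<and> height t < height t')"
proof -
  let ?W = "W (\<lambda>t'. length t' = length t \<and> height t < height t')"
  have "E a b k (Y t w) = - (\<Sum>q<length t. if fst (t ! q) = a then Y (t[q := (b, snd (t ! q) + k)]) w else 0)"
    using E_Y [of a b t k w] E_upper [of a b k] assms endo_0 [OF endo_Y] by simp
  also have "\<dots> \<in> ?W"
  proof (intro subspace_neg subspace_W subspace_sum)
    fix q assume q: "q \<in> {..<length t}"
    show "(if fst (t ! q) = a then Y (t[q := (b, snd (t ! q) + k)]) w else 0) \<in> ?W"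
    proof (cases "fst (t ! q) = a")
      case True
      have "Y (t[q := (b, snd (t ! q) + k)]) w \<in> ?W"
        using height_update [of q t b "snd (t ! q) + k"] q True assms
        by (intro W_base ys_update) auto
      then show ?thesis using True by simp
    qed (simp add: subspace_0 [OF subspace_W])
  qed
  finally show ?thesis .
qed

lemma E_diag_Y:
  assumes "1 \<le> a" "a \<le> r" "0 < k" "t \<in> ys"
  shows "E a a k (Y t w) \<in> W (\<lambda>t'. length t' = length t \<and> height t' = height t \<and> degree t < degree t')"
proof -
  let ?W = "W (\<lambda>t'. length t' = length t \<and> height t' = height t \<and> degree t < degree t')"
  have "E a a k (Y t w) = - (\<Sum>q<length t. if fst (t ! q) = a then Y (t[q := (a, snd (t ! q) + k)]) w else 0)"
    using E_Y [of a a t k w] E_diag [of a k] assms endo_0 [OF endo_Y] by simp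
  also have "\<dots> \<in> ?W"
  proof (intro subspace_neg subspace_W subspace_sum)
    fix q assume q: "q \<in> {..<length t}"
    show "(if fst (t ! q) = a then Y (t[q := (a, snd (t ! q) + k)]) w else 0) \<in> ?W"
    proof (cases "fst (t ! q) = a")
      case True
      have "Y (t[q := (a, snd (t ! q) + k)]) w \<in> ?W"
        using height_update [of q t a "snd (t ! q) + k"] degree_update [of q t a "snd (t ! q) + k"] q True assms
        by (intro W_base ys_update) auto
      then show ?thesis using True by simp
    qed (simp add: subspace_0 [OF subspace_W])
  qed
  finally show ?thesis .
qed

lemma mult_conv_card: "mult t a = card {q. q < length t \<and> fst (t ! q) = a}"
  by (simp add: mult_conv_length length_filter_conv_card)

lemma E_weight_Y:
  assumes a: "1 \<le> a" "a \<le> r" and t: "t \<in> ys" and w: "E a a 0 w = c *s w"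
  shows "E a a 0 (Y t w) = (c - of_nat (mult t a)) *s Y t w"
proof -
  have *: "(if fst (t ! q) = a then Y (t[q := (a, snd (t ! q) + 0)]) w else 0) = (if fst (t ! q) = a then Y t w else 0)"
    if "q \<in> {..<length t}" for q
  proof -
    have "t[q := (a, snd (t ! q))] = t" if "fst (t ! q) = a"
      using that by (metis list_update_id prod.collapse)
    then show ?thesis by simp
  qed
  have "E a a 0 (Y t w) = c *s Y t w - (\<Sum>q<length t. if fst (t ! q) = a then Y t w else 0)"
  proof -
    have "(\<Sum>q<length t. if fst (t ! q) = a then Y (t[q := (a, snd (t ! q) + 0)]) w else 0)
        = (\<Sum>q<length t. if fst (t ! q) = a then Y t w else 0)"
      by (rule sum.cong [OF refl]) (rule *)
    moreover have "E a a 0 (Y t w) = Y t (E a a 0 w)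
        - (\<Sum>q<length t. if fst (t ! q) = a then Y (t[q := (a, snd (t ! q) + 0)]) w else 0)"
      by (rule E_Y) (use a t in auto)
    ultimately show ?thesis
      by (simp only: w endo_scale [OF endo_Y [OF t]])
  qed
  also have "(\<Sum>q<length t. if fst (t ! q) = a then Y t w else 0) = (\<Sum>q | q < length t \<and> fst (t ! q) = a. Y t w)"
    by (rule sum.inter_filter [symmetric, of "{..<length t}", simplified])
  also have "\<dots> = of_nat (mult t a) *s Y t w"
    by (simp only: mult_conv_card sum_constant_scale)
  finally show ?thesis by (simp add: scale_left_diff_distrib)
qed

definition D :: "nat \<Rightarrow> nat \<Rightarrow> nat \<Rightarrow> 'v set" where
  "D c q d = W (\<lambda>t. length t = c \<and> (q < height t \<or> height t = q \<and> d < degree t))"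

lemma W_mono: "(\<And>t. P t \<Longrightarrow> Q t) \<Longrightarrow> W P \<subseteq> W Q"
  unfolding W_def by (rule span_mono) blast

text \<open>Raising operators increase the height; positive diagonal currents keep it and increase
  the degree; both results lie in \<open>D\<close>. Each letter of index i lowers the eigenvalue of
  E_{i,i} by one, which turns m_i into m_i + l_{i+1} - l_i, and \<open>le\<close> makes the
  truncated subtraction exact. The power relation then follows from the weight by sl2
  theory.\<close>

lemma weyl_vector_Y:
  assumes t: "t \<in> ys" and le: "\<And>i. 1 \<le> i \<Longrightarrow> i < r \<Longrightarrow> mult t i \<le> m i"
  shows "weyl_vector r (\<lambda>i. m i + mult t (Suc i) - mult t i) E (D (length t) (height t) (degree t)) (Y t w)"
proof -
  let ?D = "D (length t) (height t) (degree t)"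
  have D: "subspace ?D" "stable r E ?D"
    by (simp_all add: D_def subspace_W stable_W)
  have up: "E a b k (Y t w) \<in> ?D" if "1 \<le> a" "a < b" "b \<le> r" for a b k
    unfolding D_def by (rule subsetD [OF W_mono E_upper_Y [OF that t]]) auto
  obtain \<mu> where \<mu>: "\<And>a. 1 \<le> a \<Longrightarrow> a \<le> Suc r \<Longrightarrow> E a a 0 w = \<mu> a *s w"
    "\<And>i. 1 \<le> i \<Longrightarrow> i \<le> r \<Longrightarrow> \<mu> i - \<mu> (Suc i) = of_nat (m i)"
    using ex_weight by blast
  have wt: "E a a 0 (Y t w) = (\<mu> a - of_nat (mult t a)) *s Y t w" if "1 \<le> a" "a \<le> r" for a
    using E_weight_Y [OF that t \<mu>(1)] that by simp
  have m': "(\<mu> i - of_nat (mult t i)) - (\<mu> (Suc i) - of_nat (mult t (Suc i)))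
      = of_nat (m i + mult t (Suc i) - mult t i)" if "1 \<le> i" "i < r" for i
    using \<mu>(2) [of i] le [OF that] that by (simp add: of_nat_diff algebra_simps)
  have pow: "(E (Suc i) i 0 ^^ Suc (m i + mult t (Suc i) - mult t i)) (Y t w) \<in> ?D" if i: "1 \<le> i" "i < r" for i
  proof -
    have range: "i \<in> {1..r}" "Suc i \<in> {1..r}" "i \<in> {1..Suc r}" "Suc i \<in> {1..Suc r}" using i by auto
    obtain N where N: "(E (Suc i) i 0 ^^ N) (Y t w) = 0"
      using nilpotent_Y [OF i t] by blast
    let ?h = "\<lambda>v. E i i 0 v - E (Suc i) (Suc i) 0 v"
    have h: "?h (Y t w) = of_nat (m i + mult t (Suc i) - mult t i) *s Y t w"
      unfolding m' [OF i, symmetric] using wt i by (simp add: scale_left_diff_distrib)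
    show ?thesis
    proof (rule lowering_power_in [OF D(1), of "E i (Suc i) 0" _ ?h _ _ N])
      show "endo (E i (Suc i) 0)" "endo (E (Suc i) i 0)"
        by (rule endo_E [OF range(3,4)], rule endo_E [OF range(4,3)])
      show "endo ?h"
        by (rule endoI) (simp_all add: endo_add [OF endo_E [OF range(3,3)]] endo_add [OF endo_E [OF range(4,4)]]
          endo_scale [OF endo_E [OF range(3,3)]] endo_scale [OF endo_E [OF range(4,4)]] scale_right_diff_distrib)
      show "E i (Suc i) 0 v \<in> ?D" "E (Suc i) i 0 v \<in> ?D" "?h v \<in> ?D" if "v \<in> ?D" for v
        using D(2) that range subspace_diff [OF D(1)] by (auto simp: stable_def)
      show "E i (Suc i) 0 (E (Suc i) i 0 v) = E (Suc i) i 0 (E i (Suc i) 0 v) + ?h v" for v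
        using comm_E [OF range(3,4,4,3), of 0 0 v] by simp
      show "?h (E (Suc i) i 0 v) = E (Suc i) i 0 (?h v) - 2 *s E (Suc i) i 0 v" for v
        using comm_E [OF range(3,3,4,3), of 0 0 v] comm_E [OF range(4,4,4,3), of 0 0 v]
        by (simp add: endo_diff [OF endo_E [OF range(4,3)]] scale_2)
      show "E i (Suc i) 0 (Y t w) \<in> ?D"
        using up i by simp
      show "?h (Y t w) - of_nat (m i + mult t (Suc i) - mult t i) *s Y t w \<in> ?D"
        by (simp add: h subspace_0 [OF D(1)])
      show "(E (Suc i) i 0 ^^ N) (Y t w) \<in> ?D"
        by (simp add: N subspace_0 [OF D(1)])
    qed
  qed
  show ?thesis
    unfolding weyl_vector_def
  proof (intro conjI allI impI exI [of _ "\<lambda>a. \<mu> a - of_nat (mult t a)"])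
    show "E a a k (Y t w) \<in> ?D" if "1 \<le> a \<and> a \<le> r \<and> 0 < k" for a k
      unfolding D_def by (rule subsetD [OF W_mono E_diag_Y [of a k t]]) (use that t in auto)
  qed (use up wt m' pow subspace_0 [OF D(1)] in auto)
qed

end

section \<open>Basis words and the recursion for the numbers m_{i,j}\<close>

definition lower_word :: "nat \<Rightarrow> (nat \<Rightarrow> nat \<Rightarrow> nat list) \<Rightarrow> (nat \<times> nat \<times> nat) list" where
  "lower_word r S = concat (map (\<lambda>j. concat (map (\<lambda>i. map (\<lambda>k. (j + 1, i, k)) (S i j)) [1..<j + 1])) [1..<r + 1])"

definition admissible :: "nat \<Rightarrow> (nat \<Rightarrow> nat) \<Rightarrow> (nat \<Rightarrow> nat \<Rightarrow> nat list) \<Rightarrow> bool" where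
  "admissible r m S \<longleftrightarrow> (\<forall>i j. 1 \<le> i \<and> i \<le> j \<and> j \<le> r \<longrightarrow> inF (mij r m S i j) (S i j))"

lemma lower_word_0: "lower_word 0 S = []"
  by (simp add: lower_word_def)

lemma lower_word_Suc:
  "lower_word (Suc r) S = lower_word r S @ concat (map (\<lambda>i. map (\<lambda>k. (Suc (Suc r), i, k)) (S i (Suc r))) [1..<Suc (Suc r)])"
  by (simp add: lower_word_def)

lemma lower_word_letters: "set (lower_word r S) \<subseteq> letters (Suc r)"
  by (auto simp: lower_word_def letters_def)

lemma lower_word_cong:
  "(\<And>i j. 1 \<le> i \<Longrightarrow> i \<le> j \<Longrightarrow> j \<le> r \<Longrightarrow> S i j = S' i j) \<Longrightarrow> lower_word r S = lower_word r S'"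
  unfolding lower_word_def by (intro arg_cong [where f = concat] map_cong refl) auto

lemma mij_last: "mij r m S i r = int (m i)"
  by (simp add: mij_def)

text \<open>The last column enters m_{i,j} only through its lengths, and these are absorbed into the
  weights m' in the same way as in \<open>weyl_vector_Y\<close>.\<close>

lemma mij_Suc:
  assumes "i \<le> j" "j \<le> r" and "\<And>i s. 1 \<le> i \<Longrightarrow> i \<le> s \<Longrightarrow> s \<le> r \<Longrightarrow> S i s = S' i s" and "1 \<le> i"
    and "int (m' i) = int (m i) + (int (length (S (i + 1) (Suc r))) - int (length (S i (Suc r))))"
  shows "mij (Suc r) m S i j = mij r m' S' i j"
proof -
  have "{j + 1..Suc r} = insert (Suc r) {j + 1..r}"
    using assms(2) by auto
  then show ?thesis
    using assms by (simp add: mij_def)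
qed

context weyl_step
begin

lemma Y_conv_act: "Y t v = act E (map (\<lambda>(i, k). (Suc r, i, k)) t) v"
  by (induction t) auto

lemma mset_grouped:
  assumes "distinct xs"
  shows "mset (concat (map (\<lambda>i. map (Pair i) (sort (map snd (filter (\<lambda>x. fst x = i) t)))) xs))
    = mset (filter (\<lambda>x. fst x \<in> set xs) t)"
  using assms
proof (induction xs)
  case (Cons i xs)
  have 1: "mset (map (Pair i) (sort (map snd (filter (\<lambda>x. fst x = i) t)))) = mset (filter (\<lambda>x. fst x = i) t)"
    by (induction t) auto
  have 2: "mset (filter (\<lambda>x. fst x \<in> set (i # xs)) t) = mset (filter (\<lambda>x. fst x = i) t) + mset (filter (\<lambda>x. fst x \<in> set xs) t)"
    using Cons.prems by (induction t) auto
  show ?case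
    using Cons 1 2 by simp
qed simp

text \<open>The sorted exponents of \<open>t\<close> become the column j = r of the array. As
  m_{i,r} = m_i, lying in the box is the condition \<open>inF\<close> for this column.\<close>

lemma box_Y_spanned:
  assumes r: "0 < r" and t: "t \<in> box r t" and S': "admissible (r - 1) (\<lambda>i. m i + mult t (Suc i) - mult t i) S'"
  shows "\<exists>S. admissible r m S \<and> act E (lower_word (r - 1) S') (Y t w) = act E (lower_word r S) w"
proof -
  obtain r' where r': "r = Suc r'" using r by (cases r) auto
  define L where "L i = sort (map snd (filter (\<lambda>x. fst x = i) t))" for i
  define S where "S i j = (if j = r then L i else S' i j)" for i j
  have Sr: "S i (Suc r') = L i" and S_less: "j < Suc r' \<Longrightarrow> S i j = S' i j" for i j
    by (simp_all add: S_def r')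
  have ty: "t \<in> ys"
    using t by (simp add: box_def)
  have tm: "k + mult t i \<le> m i" if "(i, k) \<in> set t" for i k
    using t ys_mem [OF ty that] that by (auto simp: box_def)
  have L: "length (L i) = mult t i" "set (L i) = {k. (i, k) \<in> set t}" for i
    by (force simp: L_def mult_conv_length)+
  have le: "mult t i \<le> m i" for i
  proof (cases "mult t i = 0")
    case False
    then obtain k where "(i, k) \<in> set t"
      by (auto simp: count_list_0_iff)
    then show ?thesis using tm [of i k] by simp
  qed simp
  have "inF (mij r m S i j) (S i j)" if ij: "1 \<le> i" "i \<le> j" "j \<le> r" for i j
  proof (cases "j = r")
    case True
    have "int (last (L i)) \<le> int (m i) - int (length (L i))" if "L i \<noteq> []"
      using tm [of i "last (L i)"] L last_in_set [OF that] by auto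
    moreover have "sorted (L i)" by (simp add: L_def)
    ultimately show ?thesis
      using True by (auto simp: inF_def mij_last S_def)
  next
    case False
    then have j: "j \<le> r'" using ij r' by simp
    have "mij r m S i j = mij r' (\<lambda>i. m i + mult t (Suc i) - mult t i) S' i j"
      unfolding r'
    proof (rule mij_Suc)
      show "int (m i + mult t (Suc i) - mult t i) = int (m i) + (int (length (S (i + 1) (Suc r'))) - int (length (S i (Suc r'))))"
        using le [of i] unfolding Sr L(1) by (simp add: of_nat_diff)
      show "S i s = S' i s" if "1 \<le> i" "i \<le> s" "s \<le> r'" for i s
        using that by (intro S_less) simp
    qed (rule ij j)+
    moreover have "S i j = S' i j" using False by (simp add: S_def)
    moreover have "admissible r' (\<lambda>i. m i + mult t (Suc i) - mult t i) S'"
      using S' by (simp only: r' diff_Suc_1)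
    ultimately show ?thesis
      using ij j unfolding admissible_def by metis
  qed
  then have "admissible r m S" by (simp add: admissible_def)
  moreover have "act E (lower_word (r - 1) S') (Y t w) = act E (lower_word r S) w"
  proof -
    let ?t = "concat (map (\<lambda>i. map (Pair i) (L i)) [1..<Suc r])"
    have "mset ?t = mset (filter (\<lambda>x. fst x \<in> set [1..<Suc r]) t)"
      unfolding L_def by (rule mset_grouped) simp
    also have "filter (\<lambda>x. fst x \<in> set [1..<Suc r]) t = t"
      by (rule filter_True) (use ys_mem [OF ty] in force)
    finally have "Y t w = Y ?t w"
      by (intro Y_perm [OF ty]) (rule sym)
    also have "Y ?t w = act E (concat (map (\<lambda>i. map (\<lambda>k. (Suc r, i, k)) (S i r)) [1..<Suc r])) w"
      unfolding Y_conv_act by (simp add: map_concat o_def S_def del: upt_Suc)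
    finally have "act E (lower_word r' S) (Y t w) = act E (lower_word r S) w"
      unfolding r' lower_word_Suc by (simp del: upt_Suc)
    moreover have "lower_word r' S = lower_word r' S'"
      by (rule lower_word_cong) (simp add: S_def r')
    ultimately show ?thesis by (simp add: r')
  qed
  ultimately show ?thesis by blast
qed

end

section \<open>Spanning\<close>

context vector_space_char_0
begin

text \<open>The image of the projection is a copy of \<^term>\<open>C\<close> modulo \<^term>\<open>K\<close>.\<close>
lemma quotient_projection:
  assumes "subspace K" "subspace C" "K \<subseteq> C"
  shows "\<exists>\<pi>. endo \<pi> \<and> (\<forall>v\<in>K. \<pi> v = 0) \<and> (\<forall>v. \<pi> v \<in> C) \<and> (\<forall>v\<in>C. v - \<pi> v \<in> K)"
proof -
  interpret vector_space_pair scale scale ..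
  obtain B where B: "B \<subseteq> K" "independent B" "K \<subseteq> span B"
    by (rule maximal_independent_subset)
  have "B \<subseteq> C" using B(1) assms(3) by blast
  then obtain B' where B': "B \<subseteq> B'" "B' \<subseteq> C" "independent B'" "C \<subseteq> span B'"
    by (rule maximal_independent_subset_extend [OF _ B(2)])
  define \<pi> where "\<pi> = construct B' (\<lambda>b. if b \<in> B then 0 else b)"
  have \<pi>: "endo \<pi>"
    unfolding \<pi>_def module_hom_iff_linear by (rule linear_construct [OF B'(3)])
  have basis: "\<pi> b = (if b \<in> B then 0 else b)" if "b \<in> B'" for b
    unfolding \<pi>_def using construct_basis [OF B'(3) that] by simp
  have "\<pi> v \<in> {0}" if "v \<in> K" for v
    by (rule endo_span [OF \<pi>, of B]) (use that B(3) B'(1) in \<open>auto simp: basis\<close>)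
  moreover have "\<pi> v \<in> C" for v
  proof -
    have "\<pi> v \<in> span ((\<lambda>b. if b \<in> B then 0 else b) ` B')"
      unfolding \<pi>_def by (rule construct_in_span [OF B'(3)])
    also have "\<dots> \<subseteq> C"
      using B'(2) subspace_0 [OF assms(2)] by (intro span_minimal assms) auto
    finally show ?thesis .
  qed
  moreover have "v - \<pi> v \<in> K" if "v \<in> C" for v
  proof (rule endo_span [of "\<lambda>v. v - \<pi> v" B'])
    show "endo (\<lambda>v. v - \<pi> v)"
      by (rule endoI) (simp_all add: endo_add [OF \<pi>] endo_scale [OF \<pi>] scale_right_diff_distrib)
    show "b - \<pi> b \<in> K" if "b \<in> B'" for b
      using basis [OF that] B(1) subspace_0 [OF assms(1)] by auto
  qed (use that B' assms in auto)
  ultimately show ?thesis using \<pi> by blast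
qed

end

context weyl_step
begin

lemma height_le: "t \<in> ys \<Longrightarrow> height t \<le> r * length t"
  by (induction t) auto

lemma degree_le: "(\<And>x. x \<in> set t \<Longrightarrow> snd x \<le> M) \<Longrightarrow> degree t \<le> length t * M"
  by (induction t) (auto intro!: add_mono)

lemma W_subset:
  "subspace T \<Longrightarrow> (\<And>u t. set u \<subseteq> letters r \<Longrightarrow> t \<in> ys \<Longrightarrow> P t \<Longrightarrow> act E u (Y t w) \<in> T) \<Longrightarrow> W P \<subseteq> T"
  unfolding W_def by (rule span_minimal) blast

text \<open>The corrections in \<open>D\<close> have greater height, or the same height and greater
  degree. Height is bounded for fixed length, and the degree of a monomial in the box is at most
  \<open>c * M\<close>; so an induction on the height deficit with an inner one on the degree
  deficit terminates.\<close>

lemma Y_spanned: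
  assumes r: "0 < r"
    and IH: "\<And>m' L v u. subspace L \<Longrightarrow> stable r E L \<Longrightarrow> weyl_vector r m' E L v \<Longrightarrow> set u \<subseteq> letters r \<Longrightarrow>
      act E u v \<in> span ({act E (lower_word (r - 1) S) v |S. admissible (r - 1) m' S} \<union> L)"
  shows "t \<in> ys \<Longrightarrow> set u \<subseteq> letters r \<Longrightarrow> act E u (Y t w) \<in> span {act E (lower_word r S) w |S. admissible r m S}"
    (is "_ \<Longrightarrow> _ \<Longrightarrow> _ \<in> ?T")
proof (induction "r * length t - height t" arbitrary: t u rule: less_induct)
  case less
  define c where "c = length t"
  define h where "h = height t"
  define M where "M = (\<Sum>i\<in>{1..r}. m i)"
  have V: "V c h \<subseteq> ?T"
    unfolding V_def
  proof (rule W_subset [OF subspace_span])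
    fix u t' assume t': "set u \<subseteq> letters r" "t' \<in> ys" "length t' = c \<and> h < height t'"
    have "r * length t' - height t' < r * length t - height t"
      using height_le [OF t'(2)] t'(3) by (auto simp: c_def h_def intro: diff_less_mono2)
    then show "act E u (Y t' w) \<in> ?T"
      using t' by (intro less.hyps)
  qed
  have "t \<in> ys \<Longrightarrow> length t = c \<Longrightarrow> height t = h \<Longrightarrow> set u \<subseteq> letters r \<Longrightarrow> act E u (Y t w) \<in> ?T" for t u
  \<comment> \<open>The truncated measure does decrease where needed: the hypothesis is used only
    below some \<open>t'\<close> in the box of \<open>t\<close>, whose existence gives
    \<open>degree t \<le> c * M\<close>.\<close>
  proof (induction "Suc (c * M) - degree t" arbitrary: t u rule: less_induct)
    case less
    note hyps = less.hyps and t = less.prems(1) and c = less.prems(2) and h = less.prems(3) and u = less.prems(4)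
    have box: "act E u (Y t' w) \<in> ?T" if t': "t' \<in> box r t" for t'
    proof -
      have t'y: "t' \<in> ys" and eq: "mset (map fst t') = mset (map fst t)" and d: "degree t' = degree t"
        using t' by (auto simp: box_def)
      have len: "length t' = c"
        using eq c by (metis size_mset length_map)
      have ht: "height t' = h"
        using eq h by (metis sum_mset_sum_list)
      have mult: "mult t' i = mult t i" for i
        using eq by (metis count_mset)
      have t'box: "t' \<in> box r t'"
        using t' by (simp add: box_def mult)
      have le: "k + mult t' i \<le> m i" "1 \<le> i" "i \<le> r" if "(i, k) \<in> set t'" for i k
        using t'box that ys_mem [OF t'y that] by (auto simp: box_def)
      have "degree t' \<le> length t' * M"
      proof (rule degree_le)
        fix x assume "x \<in> set t'"
        then have ik: "(fst x, snd x) \<in> set t'" by simp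
        have "m (fst x) \<le> M"
          unfolding M_def using le [OF ik] by (intro member_le_sum) auto
        then show "snd x \<le> M" using le [OF ik] by simp
      qed
      then have deg: "degree t \<le> c * M"
        using d len by simp
      have D: "D (length t') (height t') (degree t') \<subseteq> ?T"
        unfolding D_def
      proof (rule W_subset [OF subspace_span])
        fix u' t'' assume u': "set u' \<subseteq> letters r" and t'': "t'' \<in> ys"
          and "length t'' = length t' \<and> (height t' < height t'' \<or> height t'' = height t' \<and> degree t' < degree t'')"
        then have len'': "length t'' = length t'"
          and *: "height t' < height t'' \<or> height t'' = height t' \<and> degree t' < degree t''"
          by simp_all
        show "act E u' (Y t'' w) \<in> ?T"
        proof (cases "height t' < height t''")
          case True
          then have "act E u' (Y t'' w) \<in> V c h"
            using stable_act [OF stable_V u' V_base] t'' len'' len ht by simp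
          then show ?thesis using V by blast
        next
          case False
          then have "Suc (c * M) - degree t'' < Suc (c * M) - degree t"
            using * d deg by auto
          then show ?thesis
            using t'' u' len'' len ht * False by (intro hyps) auto
        qed
      qed
      have "mult t' i \<le> m i" for i
      proof (cases "mult t' i = 0")
        case False
        then obtain k where "(i, k) \<in> set t'"
          by (auto simp: count_list_0_iff)
        then show ?thesis using le(1) [of i k] by simp
      qed simp
      then have "act E u (Y t' w) \<in> span ({act E (lower_word (r - 1) S) (Y t' w) |S.
          admissible (r - 1) (\<lambda>i. m i + mult t' (Suc i) - mult t' i) S} \<union> D (length t') (height t') (degree t'))"
        by (intro IH weyl_vector_Y t'y u) (simp_all add: D_def subspace_W stable_W)
      moreover have "{act E (lower_word (r - 1) S) (Y t' w) |S.
          admissible (r - 1) (\<lambda>i. m i + mult t' (Suc i) - mult t' i) S} \<union> D (length t') (height t') (degree t') \<subseteq> ?T"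
      proof -
        have "act E (lower_word (r - 1) S) (Y t' w) \<in> ?T"
          if "admissible (r - 1) (\<lambda>i. m i + mult t' (Suc i) - mult t' i) S" for S
          using box_Y_spanned [OF r t'box that] by (auto intro: span_base)
        then show ?thesis using D by blast
      qed
      ultimately show ?thesis
        using span_minimal [OF _ subspace_span] by blast
    qed
    show "act E u (Y t w) \<in> ?T"
    proof (rule endo_span [OF endo_act _ subspace_span Y_box_induct [OF t order_refl]])
      show "set u \<subseteq> letters (Suc r)" using u by (auto simp: letters_def)
      fix v assume "v \<in> (\<lambda>t'. Y t' w) ` box r t \<union> V (length t) (height t)"
      then show "act E u v \<in> ?T"
      proof
        assume "v \<in> V (length t) (height t)"
        then have "act E u v \<in> V c h"
          using stable_act [OF stable_V u] c h by simp
        then show ?thesis using V by blast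
      qed (use box in auto)
    qed
  qed
  then show ?case using less.prems by (simp add: c_def h_def)
qed

lemma Y_in_W: "t \<in> ys \<Longrightarrow> Y t w \<in> W (\<lambda>_. True)"
  by (rule W_base) auto

text \<open>With the next two lemmas: products of gl_r[t] with letters, applied to \<open>w\<close>,
  form a space stable under the rest of gl_{r+1}[t]. The last row comes first, then the corner
  entry, then the last column, each using the earlier ones.\<close>

lemma stable_W_lower:
  assumes "b \<in> {1..r}" "v \<in> W (\<lambda>_. True)"
  shows "E (Suc r) b k v \<in> W (\<lambda>_. True)"
proof -
  have "E (Suc r) b k (act E u (Y t w)) \<in> W (\<lambda>_. True)" if "set u \<subseteq> letters r" "t \<in> ys" "b \<in> {1..r}" for u t b k
    using that
  proof (induction u arbitrary: b k)
    case Nil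
    then have "Y ((b, k) # t) w \<in> W (\<lambda>_. True)"
      by (intro Y_in_W) auto
    then show ?case by simp
  next
    case (Cons x u)
    obtain c d l where x: "x = (c, d, l)" by (cases x)
    have cd: "c \<in> {1..r}" "d \<in> {1..r}" and u: "set u \<subseteq> letters r"
      using Cons.prems(1) x by (auto simp: letters_def)
    let ?v = "act E u (Y t w)"
    have "E (Suc r) b k (act E (x # u) (Y t w))
        = E c d l (E (Suc r) b k ?v) + (if b = c then E (Suc r) d (k + l) ?v else 0)"
      using comm_E [of "Suc r" b c d k l ?v] cd Cons.prems(3) x by simp
    also have "\<dots> \<in> W (\<lambda>_. True)"
      using stable_W cd Cons.IH [OF u Cons.prems(2)] Cons.prems(3)
      by (intro subspace_add [OF subspace_W]) (auto simp: stable_def subspace_0 [OF subspace_W])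
    finally show ?case .
  qed
  note * = this
  show ?thesis
    by (rule endo_span [OF endo_E _ subspace_W assms(2) [unfolded W_def]]) (use * assms(1) in auto)
qed

lemma stable_W_corner:
  assumes "v \<in> W (\<lambda>_. True)"
  shows "E (Suc r) (Suc r) k v \<in> W (\<lambda>_. True)"
proof -
  have Y: "E (Suc r) (Suc r) k (Y t w) \<in> W (\<lambda>_. True)" if "t \<in> ys" for t
    using that
  proof (induction t rule: list.induct)
    case Nil
    have w: "w \<in> W (\<lambda>_. True)"
      using Y_in_W [of "[]"] by simp
    obtain c where "E (Suc r) (Suc r) 0 w = c *s w"
      using ex_weight by auto
    then show ?case
      using w E_diag [of "Suc r" k] by (cases "k = 0") (auto intro: subspace_scale [OF subspace_W] subspace_0 [OF subspace_W])
  next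
    case (Cons x t)
    obtain i l where x: "x = (i, l)" by (cases x)
    have i: "i \<in> {1..r}" and t: "t \<in> ys" using Cons.prems unfolding x by auto
    have "E (Suc r) (Suc r) k (Y (x # t) w) = E (Suc r) i l (E (Suc r) (Suc r) k (Y t w)) + Y ((i, k + l) # t) w"
      using comm_E [of "Suc r" "Suc r" "Suc r" i k l "Y t w"] i x by simp
    also have "\<dots> \<in> W (\<lambda>_. True)"
      using i t by (intro subspace_add [OF subspace_W] stable_W_lower Cons.IH Y_in_W) auto
    finally show ?case .
  qed
  have "E (Suc r) (Suc r) k (act E u (Y t w)) \<in> W (\<lambda>_. True)" if "set u \<subseteq> letters r" "t \<in> ys" for u t
    using that
  proof (induction u)
    case Nil
    then show ?case using Y by simp
  next
    case (Cons x u)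
    obtain c d l where x: "x = (c, d, l)" by (cases x)
    have cd: "c \<in> {1..r}" "d \<in> {1..r}" and u: "set u \<subseteq> letters r"
      using Cons.prems(1) x by (auto simp: letters_def)
    have "E (Suc r) (Suc r) k (act E (x # u) (Y t w)) = E c d l (E (Suc r) (Suc r) k (act E u (Y t w)))"
      using comm_E [of "Suc r" "Suc r" c d k l "act E u (Y t w)"] cd x by auto
    also have "\<dots> \<in> W (\<lambda>_. True)"
      using stable_W cd Cons.IH [OF u Cons.prems(2)] by (auto simp: stable_def)
    finally show ?case .
  qed
  note * = this
  show ?thesis
    by (rule endo_span [OF endo_E _ subspace_W assms [unfolded W_def]]) (use * in auto)
qed

lemma stable_W_upper:
  assumes "a \<in> {1..r}" "v \<in> W (\<lambda>_. True)"
  shows "E a (Suc r) k v \<in> W (\<lambda>_. True)"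
proof -
  have Y: "E a (Suc r) k (Y t w) \<in> W (\<lambda>_. True)" if "t \<in> ys" "a \<in> {1..r}" for t a k
    using that
  proof (induction t rule: list.induct)
    case Nil
    then show ?case using E_upper [of a "Suc r" k] by (simp add: subspace_0 [OF subspace_W])
  next
    case (Cons x t)
    obtain i l where x: "x = (i, l)" by (cases x)
    have i: "i \<in> {1..r}" and t: "t \<in> ys" using Cons.prems unfolding x by auto
    have "E a (Suc r) k (Y (x # t) w) = E (Suc r) i l (E a (Suc r) k (Y t w)) + E a i (k + l) (Y t w)
        - (if i = a then E (Suc r) (Suc r) (k + l) (Y t w) else 0)"
      using comm_E [of a "Suc r" "Suc r" i k l "Y t w"] i Cons.prems(2) x by auto
    also have "\<dots> \<in> W (\<lambda>_. True)"
    proof (intro subspace_diff [OF subspace_W] subspace_add [OF subspace_W])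
      show "E (Suc r) i l (E a (Suc r) k (Y t w)) \<in> W (\<lambda>_. True)"
        using i t Cons by (intro stable_W_lower Cons.IH) auto
      show "E a i (k + l) (Y t w) \<in> W (\<lambda>_. True)"
        using stable_W i t Cons.prems(2) Y_in_W by (auto simp: stable_def)
      show "(if i = a then E (Suc r) (Suc r) (k + l) (Y t w) else 0) \<in> W (\<lambda>_. True)"
        using stable_W_corner Y_in_W t by (auto simp: subspace_0 [OF subspace_W])
    qed
    finally show ?case .
  qed
  have "E a (Suc r) k (act E u (Y t w)) \<in> W (\<lambda>_. True)" if "set u \<subseteq> letters r" "t \<in> ys" "a \<in> {1..r}" for u t a k
    using that
  proof (induction u arbitrary: a k)
    case Nil
    then show ?case using Y by simp
  next
    case (Cons x u)
    obtain c d l where x: "x = (c, d, l)" by (cases x)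
    have cd: "c \<in> {1..r}" "d \<in> {1..r}" and u: "set u \<subseteq> letters r"
      using Cons.prems(1) x by (auto simp: letters_def)
    let ?v = "act E u (Y t w)"
    have "E a (Suc r) k (act E (x # u) (Y t w))
        = E c d l (E a (Suc r) k ?v) - (if d = a then E c (Suc r) (k + l) ?v else 0)"
      using comm_E [of a "Suc r" c d k l ?v] cd Cons.prems(3) x by auto
    also have "\<dots> \<in> W (\<lambda>_. True)"
      using stable_W cd Cons.IH [OF u Cons.prems(2)] Cons.prems(3)
      by (intro subspace_diff [OF subspace_W]) (auto simp: stable_def subspace_0 [OF subspace_W])
    finally show ?case .
  qed
  note * = this
  show ?thesis
    by (rule endo_span [OF endo_E _ subspace_W assms(2) [unfolded W_def]]) (use * assms(1) in auto)
qed

lemma act_in_W: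
  assumes "set u \<subseteq> letters (Suc r)"
  shows "act E u w \<in> W (\<lambda>_. True)"
proof (rule stable_act [OF _ assms])
  show "w \<in> W (\<lambda>_. True)"
    using Y_in_W [of "[]"] by simp
  show "stable (Suc r) E (W (\<lambda>_. True))"
    unfolding stable_def
  proof (intro ballI allI)
    fix a b k v assume *: "a \<in> {1..Suc r}" "b \<in> {1..Suc r}" "v \<in> W (\<lambda>_. True)"
    consider "a \<in> {1..r}" "b \<in> {1..r}" | "a \<in> {1..r}" "b = Suc r" | "a = Suc r" "b \<in> {1..r}" | "a = Suc r" "b = Suc r"
      using *(1,2) by force
    then show "E a b k v \<in> W (\<lambda>_. True)"
      using stable_W stable_W_upper stable_W_lower stable_W_corner *(3) by cases (auto simp: stable_def)
  qed
qed

lemma act_spanned: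
  assumes r: "0 < r"
    and IH: "\<And>m' L v u. subspace L \<Longrightarrow> stable r E L \<Longrightarrow> weyl_vector r m' E L v \<Longrightarrow> set u \<subseteq> letters r \<Longrightarrow>
      act E u v \<in> span ({act E (lower_word (r - 1) S) v |S. admissible (r - 1) m' S} \<union> L)"
    and u: "set u \<subseteq> letters (Suc r)"
  shows "act E u w \<in> span {act E (lower_word r S) w |S. admissible r m S}"
proof -
  have "W (\<lambda>_. True) \<subseteq> span {act E (lower_word r S) w |S. admissible r m S}"
    using Y_spanned [OF r IH] by (intro W_subset) auto
  then show ?thesis using act_in_W [OF u] by blast
qed

end

section \<open>Quotients realised by projections\<close>

context vector_space_char_0
begin

context
  fixes n and E :: "nat \<Rightarrow> nat \<Rightarrow> nat \<Rightarrow> 'v \<Rightarrow> 'v" and K C \<pi>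
  assumes endo_E: "\<And>a b k. a \<in> {1..n} \<Longrightarrow> b \<in> {1..n} \<Longrightarrow> endo (E a b k)"
    and stable: "stable n E K" "stable n E C"
    and comm_mod: "\<And>a b c d k l v. a \<in> {1..n} \<Longrightarrow> b \<in> {1..n} \<Longrightarrow> c \<in> {1..n} \<Longrightarrow> d \<in> {1..n} \<Longrightarrow> v \<in> C \<Longrightarrow>
      E a b k (E c d l v) - (E c d l (E a b k v)
        + (if b = c then E a d (k + l) v else 0) - (if d = a then E c b (k + l) v else 0)) \<in> K"
    and \<pi>: "endo \<pi>" "\<And>v. v \<in> K \<Longrightarrow> \<pi> v = 0" "\<And>v. \<pi> v \<in> C" "\<And>v. v \<in> C \<Longrightarrow> v - \<pi> v \<in> K"
begin

lemma projection_eq: "v \<in> C \<Longrightarrow> \<pi> (\<pi> v) = \<pi> v"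
  using \<pi>(2) [OF \<pi>(4), of v] endo_diff [OF \<pi>(1), of v "\<pi> v"] by simp

lemma projection_E:
  assumes "a \<in> {1..n}" "b \<in> {1..n}" "v \<in> C"
  shows "\<pi> (E a b k (\<pi> v)) = \<pi> (E a b k v)"
proof -
  have "E a b k (v - \<pi> v) \<in> K"
    using stable(1) \<pi>(4) assms by (simp add: stable_def)
  then have "\<pi> (E a b k v - E a b k (\<pi> v)) = 0"
    using \<pi>(2) endo_diff [OF endo_E [OF assms(1,2)]] by simp
  then show ?thesis by (simp add: endo_diff [OF \<pi>(1)])
qed

text \<open>A module on the original carrier that models C / K: \<open>\<pi>\<close> selects
  representatives, so relations known only on \<open>C\<close> and only modulo \<open>K\<close>
  become exact identities for all vectors.\<close>

abbreviation E_quot :: "nat \<Rightarrow> nat \<Rightarrow> nat \<Rightarrow> 'v \<Rightarrow> 'v" where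
  "E_quot a b k v \<equiv> \<pi> (E a b k (\<pi> v))"

lemma quotient_module: "current_module scale n E_quot"
proof (rule current_module.intro [OF vector_space_char_0_axioms], rule current_module_axioms.intro)
  show "endo (E_quot a b k)" if "a \<in> {1..n}" "b \<in> {1..n}" for a b k
    using endo_E [OF that] \<pi>(1) by (auto intro!: endoI simp: endo_add endo_scale)
  fix a b c d k l v
  assume ab: "a \<in> {1..n}" "b \<in> {1..n}" and cd: "c \<in> {1..n}" "d \<in> {1..n}"
  have C: "E a b k (\<pi> v) \<in> C" "E c d l (\<pi> v) \<in> C"
    using stable(2) \<pi>(3) ab cd by (simp_all add: stable_def)
  have 1: "E_quot a b k (E_quot c d l v) = \<pi> (E a b k (E c d l (\<pi> v)))"
    using projection_E [OF ab C(2)] projection_eq [OF C(2)] by simp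
  have 2: "E_quot c d l (E_quot a b k v) = \<pi> (E c d l (E a b k (\<pi> v)))"
    using projection_E [OF cd C(1)] projection_eq [OF C(1)] by simp
  have "\<pi> (E a b k (E c d l (\<pi> v)) - (E c d l (E a b k (\<pi> v))
        + (if b = c then E a d (k + l) (\<pi> v) else 0) - (if d = a then E c b (k + l) (\<pi> v) else 0))) = 0"
    by (rule \<pi>(2) [OF comm_mod [OF ab cd \<pi>(3)]])
  then have "\<pi> (E a b k (E c d l (\<pi> v))) = \<pi> (E c d l (E a b k (\<pi> v)))
        + \<pi> (if b = c then E a d (k + l) (\<pi> v) else 0) - \<pi> (if d = a then E c b (k + l) (\<pi> v) else 0)"
    by (simp add: endo_diff [OF \<pi>(1)] endo_add [OF \<pi>(1)])
  then show "E_quot a b k (E_quot c d l v) = E_quot c d l (E_quot a b k v)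
        + (if b = c then E_quot a d (k + l) v else 0) - (if d = a then E_quot c b (k + l) v else 0)"
    unfolding 1 2 by (simp add: if_distrib [of \<pi>] endo_0 [OF \<pi>(1)] cong: if_cong)
qed

lemma act_quot:
  assumes v: "v \<in> C"
  shows "set u \<subseteq> letters n \<Longrightarrow> act E_quot u (\<pi> v) = \<pi> (act E u v)"
proof (induction u)
  case (Cons x u)
  obtain a b k where x: "x = (a, b, k)" by (cases x)
  have ab: "a \<in> {1..n}" "b \<in> {1..n}" and u: "set u \<subseteq> letters n"
    using Cons.prems unfolding x by (auto simp: letters_def)
  have "act E u v \<in> C"
    by (rule stable_act [OF stable(2) u v])
  then show ?case
    using Cons.IH [OF u] projection_E [OF ab, of "act E u v" k] projection_eq [of "act E u v"] by (simp add: x)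
qed simp

lemma weyl_vector_quot:
  assumes v: "v \<in> C" and w: "weyl_vector n m E K v"
  shows "weyl_vector n m E_quot {0} (\<pi> v)"
proof -
  have E: "E_quot a b k (\<pi> v) = \<pi> (E a b k v)" if "a \<in> {1..n}" "b \<in> {1..n}" for a b k
    using act_quot [OF v, of "[(a, b, k)]"] that by (simp add: letters_def)
  have power: "(E_quot a b k ^^ N) (\<pi> v) = \<pi> ((E a b k ^^ N) v)" if "a \<in> {1..n}" "b \<in> {1..n}" for a b k N
  proof -
    have p: "(f a b k ^^ N) x = act f (replicate N (a, b, k)) x" for f and x :: 'v
      by (induction N) simp_all
    moreover have "set (replicate N (a, b, k)) \<subseteq> letters n"
      using that by (auto simp: letters_def)
    ultimately show ?thesis
      using act_quot [OF v, of "replicate N (a, b, k)"] p [of E_quot "\<pi> v"] p [of E v] by simp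
  qed
  obtain \<mu> where \<mu>: "\<And>a. 1 \<le> a \<Longrightarrow> a \<le> n \<Longrightarrow> E a a 0 v - \<mu> a *s v \<in> K"
      "\<And>i. 1 \<le> i \<and> i < n \<Longrightarrow> \<mu> i - \<mu> (Suc i) = of_nat (m i)"
    using w unfolding weyl_vector_def by blast
  have "E_quot a a 0 (\<pi> v) - \<mu> a *s \<pi> v \<in> {0}" if "1 \<le> a \<and> a \<le> n" for a
    using \<pi>(2) [OF \<mu>(1), of a] that by (simp add: E endo_diff [OF \<pi>(1)] endo_scale [OF \<pi>(1)])
  moreover have "(E_quot (Suc i) i 0 ^^ Suc (m i)) (\<pi> v) \<in> {0}" if "1 \<le> i \<and> i < n" for i
  proof -
    have "\<pi> ((E (Suc i) i 0 ^^ Suc (m i)) v) = 0"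
      using w that unfolding weyl_vector_def by (intro \<pi>(2)) blast
    then show ?thesis
      using power [of "Suc i" i "Suc (m i)" 0] that by simp
  qed
  ultimately show ?thesis
    using w \<pi>(2) \<mu>(2) unfolding weyl_vector_def
    by (intro conjI allI impI exI [of _ \<mu>]) (auto simp: E)
qed

lemma span_quot:
  assumes v: "v \<in> C" and C: "subspace C" and K: "subspace K" and u: "set u \<subseteq> letters n"
    and U: "\<And>u'. u' \<in> U \<Longrightarrow> set u' \<subseteq> letters n"
    and span: "act E_quot u (\<pi> v) \<in> span ((\<lambda>u'. act E_quot u' (\<pi> v)) ` U)"
  shows "act E u v \<in> span ((\<lambda>u'. act E u' v) ` U \<union> K)"
proof -
  let ?B = "(\<lambda>u'. act E u' v) ` U"
  have "(\<lambda>u'. act E_quot u' (\<pi> v)) ` U = \<pi> ` ?B"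
    unfolding image_image by (rule image_cong [OF refl act_quot [OF v U]])
  then have "\<pi> (act E u v) \<in> \<pi> ` span ?B"
    using span unfolding act_quot [OF v u] by (simp add: module_hom.span_image [OF \<pi>(1)])
  then obtain x where x: "x \<in> span ?B" "\<pi> (act E u v) = \<pi> x"
    by auto
  have "x \<in> C"
    using x(1) by (rule span_minimal [OF _ C, THEN subsetD, rotated]) (use stable_act [OF stable(2) U v] in auto)
  moreover have "act E u v \<in> C"
    by (rule stable_act [OF stable(2) u v])
  ultimately have "(act E u v - \<pi> (act E u v)) - (x - \<pi> x) \<in> K"
    by (intro subspace_diff [OF K] \<pi>(4))
  then have "((act E u v - \<pi> (act E u v)) - (x - \<pi> x)) + x \<in> span (?B \<union> K)"
    using x(1) span_mono [of ?B "?B \<union> K"] by (intro span_add [OF span_base]) auto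
  then show ?thesis using x(2) by simp
qed

end

text \<open>A general \<open>L\<close> is needed because the induction applies the statement to
  \<open>Y t w\<close>, a Weyl vector only modulo \<open>D\<close>. Dividing out \<open>L\<close>
  first provides the exact Weyl vector that \<open>weyl_step\<close> demands.\<close>

theorem weyl_module_spanning:
  "current_module scale (Suc r) E \<Longrightarrow> subspace L \<Longrightarrow> stable (Suc r) E L \<Longrightarrow> weyl_vector (Suc r) m E L w \<Longrightarrow>
    set u \<subseteq> letters (Suc r) \<Longrightarrow> act E u w \<in> span ({act E (lower_word r S) w |S. admissible r m S} \<union> L)"
proof (induction r arbitrary: E L m w u)
  case 0
  interpret current_module scale "Suc 0" E by fact
  have eq: "{act E (lower_word 0 S) w |S. admissible 0 m S} = {w}"
    by (auto simp: lower_word_0 admissible_def)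
  let ?T = "span ({w} \<union> L)"
  obtain \<mu> where "E 1 1 0 w - \<mu> *s w \<in> L"
    using 0 unfolding weyl_vector_def by auto
  then have "(E 1 1 0 w - \<mu> *s w) + \<mu> *s w \<in> ?T"
    by (intro span_add span_scale) (auto intro: span_base)
  then have "E 1 1 0 w \<in> ?T" by simp
  moreover have "E 1 1 k w \<in> ?T" if "0 < k" for k
    using 0 that unfolding weyl_vector_def by (auto intro: span_base)
  ultimately have w: "E 1 1 k w \<in> ?T" for k
    by (cases "k = 0") auto
  have "E 1 1 k v \<in> ?T" if "v \<in> ?T" for k v
    by (rule endo_span [OF endo_E _ subspace_span that]) (use w 0(3) in \<open>auto simp: stable_def intro: span_base\<close>)
  then have "stable (Suc 0) E ?T"
    by (simp add: stable_def)
  then show ?case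
    unfolding eq by (rule stable_act [OF _ 0(5)]) (simp add: span_base)
next
  case (Suc r)
  interpret current_module scale "Suc (Suc r)" E by fact
  obtain \<pi> where \<pi>: "endo \<pi>" "\<And>v. v \<in> L \<Longrightarrow> \<pi> v = 0" "\<And>v. v - \<pi> v \<in> L"
    using quotient_projection [OF Suc.prems(2) subspace_UNIV] by auto
  let ?E = "\<lambda>a b k v. \<pi> (E a b k (\<pi> v))"
  have UNIV: "stable (Suc (Suc r)) E UNIV"
    by (simp add: stable_def)
  have comm: "E a b k (E c d l v) - (E c d l (E a b k v)
        + (if b = c then E a d (k + l) v else 0) - (if d = a then E c b (k + l) v else 0)) \<in> L"
    if "a \<in> {1..Suc (Suc r)}" "b \<in> {1..Suc (Suc r)}" "c \<in> {1..Suc (Suc r)}" "d \<in> {1..Suc (Suc r)}" for a b c d k l v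
    using comm_E [OF that, of k l v] subspace_0 [OF Suc.prems(2)] by simp
  note quot = endo_E Suc.prems(3) UNIV comm \<pi>(1,2) UNIV_I \<pi>(3)
  interpret Q: current_module scale "Suc (Suc r)" ?E
    by (rule quotient_module [OF quot])
  interpret Q: weyl_step scale "Suc r" ?E m "\<pi> w"
    using weyl_vector_quot [OF quot UNIV_I Suc.prems(4)] by unfold_locales
  have IH: "act ?E u v \<in> span ({act ?E (lower_word (Suc r - 1) S) v |S. admissible (Suc r - 1) m' S} \<union> L')"
    if "subspace L'" "stable (Suc r) ?E L'" "weyl_vector (Suc r) m' ?E L' v" "set u \<subseteq> letters (Suc r)" for m' L' v u
    using Suc.IH [OF Q.current_submodule that] by simp
  let ?U = "{lower_word (Suc r) S |S. admissible (Suc r) m S}"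
  have setcompr: "{act F (lower_word (Suc r) S) x |S. admissible (Suc r) m S} = (\<lambda>u. act F u x) ` ?U" for F and x :: 'v
    by auto
  show ?case
    unfolding setcompr
  proof (rule span_quot [OF quot UNIV_I subspace_UNIV Suc.prems(2,5)])
    show "set u' \<subseteq> letters (Suc (Suc r))" if "u' \<in> ?U" for u'
      using that lower_word_letters by blast
    show "act ?E u (\<pi> w) \<in> span ((\<lambda>u'. act ?E u' (\<pi> w)) ` ?U)"
      using Q.act_spanned [OF zero_less_Suc IH Suc.prems(5)] unfolding setcompr .
  qed
qed

end

section \<open>The fermionic Fock space\<close>

lemma vector_space_fun: "vector_space_char_0 (\<lambda>(c :: 'a::field_char_0) (f :: 'b \<Rightarrow> 'a) x. c * f x)"
  by unfold_locales (auto simp: fun_eq_iff algebra_simps)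

type_synonym fock = "nat set \<Rightarrow> complex"

definition fscale :: "complex \<Rightarrow> fock \<Rightarrow> fock" where
  "fscale c f = (\<lambda>S. c * f S)"

text \<open>The Jordan-Wigner sign, which makes creation and annihilation operators
  anticommute.\<close>

definition sg :: "nat \<Rightarrow> nat set \<Rightarrow> complex" where
  "sg x S = (- 1) ^ card {y \<in> S. y < x}"

definition cr :: "nat \<Rightarrow> fock \<Rightarrow> fock" where
  "cr x f = (\<lambda>S. if x \<in> S then sg x S * f (S - {x}) else 0)"

definition an :: "nat \<Rightarrow> fock \<Rightarrow> fock" where
  "an x f = (\<lambda>S. if x \<in> S then 0 else sg x S * f (insert x S))"

interpretation fock: vector_space_char_0 fscale
  using vector_space_fun unfolding fscale_def [abs_def] .

lemma sg_square [simp]: "sg x S * (sg x S * z) = z"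
  by (simp add: sg_def flip: mult.assoc power_add mult_2)

lemma sg_nonzero [simp]: "sg x S \<noteq> 0"
  by (simp add: sg_def)

lemma sg_insert: "y \<notin> S \<Longrightarrow> sg x (insert y S) = (if y < x then - sg x S else sg x S)"
proof (cases "y < x")
  case True
  assume "y \<notin> S"
  have "{z \<in> insert y S. z < x} = insert y {z \<in> S. z < x}"
    using True by auto
  then show ?thesis
    using True \<open>y \<notin> S\<close> by (simp add: sg_def)
next
  case False
  have "{z \<in> insert y S. z < x} = {z \<in> S. z < x}"
    using False by auto
  then show ?thesis
    using False by (simp add: sg_def)
qed

lemma sg_remove: "y \<in> S \<Longrightarrow> sg x (S - {y}) = (if y < x then - sg x S else sg x S)"
  using sg_insert [of y "S - {y}" x] by (auto simp: insert_absorb)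

lemma an_cr: "an x (cr y f) = (if x = y then f else 0) - cr y (an x f)"
proof (rule ext)
  fix S
  show "an x (cr y f) S = ((if x = y then f else 0) - cr y (an x f)) S"
  proof (cases "x = y")
    case True
    then show ?thesis
      by (auto simp: an_def cr_def sg_insert sg_remove insert_absorb)
  next
    case False
    then show ?thesis
      by (auto simp: an_def cr_def sg_insert sg_remove insert_Diff_if)
  qed
qed

lemma an_an: "an x (an y f) = - an y (an x f)"
proof (rule ext)
  fix S
  show "an x (an y f) S = (- an y (an x f)) S"
    by (cases "x = y") (auto simp: an_def sg_insert insert_commute)
qed

lemma cr_cr: "cr x (cr y f) = - cr y (cr x f)"
proof (rule ext)
  fix S
  have "S - {x} - {y} = S - {y} - {x}" by blast
  then show "cr x (cr y f) S = (- cr y (cr x f)) S"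
    by (cases "x = y") (auto simp: cr_def sg_remove)
qed

lemma an_diff: "an x (f - g) = an x f - an x g"
  and cr_diff: "cr x (f - g) = cr x f - cr x g"
  and an_uminus: "an x (- f) = - an x f"
  and cr_uminus: "cr x (- f) = - cr x f"
  and an_add: "an x (f + g) = an x f + an x g"
  and cr_add: "cr x (f + g) = cr x f + cr x g"
  and an_0: "an x 0 = 0"
  and cr_0: "cr x 0 = 0"
  and an_scale: "an x (fscale c f) = fscale c (an x f)"
  and cr_scale: "cr x (fscale c f) = fscale c (cr x f)"
  by (auto simp: an_def cr_def fscale_def fun_eq_iff algebra_simps)

definition hop :: "nat \<Rightarrow> nat \<Rightarrow> fock \<Rightarrow> fock" where
  "hop x y f = cr x (an y f)"

lemma endo_hop: "fock.endo (hop x y)"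
  by (rule fock.endoI) (simp_all add: hop_def an_add cr_add an_scale cr_scale)

text \<open>The parts with four operators agree because both pairs are exchanged, at the cost of two
  signs. The contractions that remain are those of matrix units.\<close>

lemma hop_comm: "hop x y (hop z w f) = hop z w (hop x y f) + (if y = z then hop x w f else 0) - (if w = x then hop z y f else 0)"
proof -
  have *: "cr x (cr z (an y (an w f))) = cr z (cr x (an w (an y f)))"
    by (subst cr_cr, subst an_an) (simp add: cr_uminus)
  have "hop x y (hop z w f) = (if y = z then hop x w f else 0) - cr x (cr z (an y (an w f)))"
    by (auto simp: hop_def an_cr cr_diff cr_uminus cr_0)
  moreover have "hop z w (hop x y f) = (if w = x then hop z y f else 0) - cr z (cr x (an w (an y f)))"
    by (auto simp: hop_def an_cr cr_diff cr_uminus cr_0)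
  ultimately show ?thesis
    by (simp add: *)
qed

definition mode :: "nat \<Rightarrow> nat \<Rightarrow> nat" where
  "mode p a = prod_encode (p, a)"

lemma mode_eq [simp]: "mode p a = mode q b \<longleftrightarrow> p = q \<and> a = b"
  by (simp add: mode_def prod_encode_eq)

definition EF :: "nat \<Rightarrow> nat \<Rightarrow> nat \<Rightarrow> nat \<Rightarrow> fock \<Rightarrow> fock" where
  "EF N a b k f = (\<Sum>p<N. fscale (of_nat p ^ k) (hop (mode p a) (mode p b) f))"

lemma endo_EF: "fock.endo (EF N a b k)"
  by (rule fock.endoI)
    (simp_all add: EF_def fock.endo_add [OF endo_hop] fock.endo_scale [OF endo_hop] fock.scale_right_distrib
      sum.distrib fock.scale_sum_right fock.scale_left_commute mult.commute)

lemma sum_fscale_delta: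
  "(\<Sum>p<N. \<Sum>q<N. fscale (of_nat p ^ k) (fscale (of_nat q ^ l) (if p = q \<and> Q then g p q else 0)))
    = (if Q then \<Sum>p<N. fscale (of_nat p ^ (k + l)) (g p p) else 0)"
proof -
  have "(\<Sum>q<N. fscale (of_nat p ^ k) (fscale (of_nat q ^ l) (if p = q \<and> Q then g p q else 0)))
      = (if Q then fscale (of_nat p ^ (k + l)) (g p p) else 0)" if "p \<in> {..<N}" for p
  proof -
    have "fscale (of_nat p ^ k) (fscale (of_nat q ^ l) (if p = q \<and> Q then g p q else 0))
        = (if p = q then if Q then fscale (of_nat p ^ (k + l)) (g p p) else 0 else 0)" for q
      by (simp add: power_add)
    then show ?thesis
      using that by (simp add: sum.delta')
  qed
  then show ?thesis by simp
qed

lemma EF_comm: "EF N a b k (EF N c d l f) = EF N c d l (EF N a b k f)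
    + (if b = c then EF N a d (k + l) f else 0) - (if d = a then EF N c b (k + l) f else 0)"
proof -
  let ?s = "\<lambda>k p. fscale (of_nat p ^ k)"
  have expand: "EF N a b k (EF N c d l f) = (\<Sum>p<N. \<Sum>q<N. ?s k p (?s l q (hop (mode p a) (mode p b) (hop (mode q c) (mode q d) f))))"
    for a b k c d l
    by (simp only: EF_def fock.endo_sum [OF endo_hop] fock.endo_scale [OF endo_hop] fock.scale_sum_right)
  have "EF N a b k (EF N c d l f)
      = (\<Sum>p<N. \<Sum>q<N. ?s k p (?s l q (hop (mode q c) (mode q d) (hop (mode p a) (mode p b) f))))
      + (\<Sum>p<N. \<Sum>q<N. ?s k p (?s l q (if p = q \<and> b = c then hop (mode p a) (mode q d) f else 0)))
      - (\<Sum>p<N. \<Sum>q<N. ?s k p (?s l q (if p = q \<and> d = a then hop (mode q c) (mode p b) f else 0)))"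
    unfolding expand sum.distrib [symmetric] sum_subtractf [symmetric]
  proof (intro sum.cong refl)
    fix p q
    show "?s k p (?s l q (hop (mode p a) (mode p b) (hop (mode q c) (mode q d) f)))
        = ?s k p (?s l q (hop (mode q c) (mode q d) (hop (mode p a) (mode p b) f)))
        + ?s k p (?s l q (if p = q \<and> b = c then hop (mode p a) (mode q d) f else 0))
        - ?s k p (?s l q (if p = q \<and> d = a then hop (mode q c) (mode p b) f else 0))"
      using hop_comm [of "mode p a" "mode p b" "mode q c" "mode q d" f]
      by (auto simp: fock.scale_right_distrib fock.scale_right_diff_distrib)
  qed
  also have "(\<Sum>p<N. \<Sum>q<N. ?s k p (?s l q (hop (mode q c) (mode q d) (hop (mode p a) (mode p b) f)))) = EF N c d l (EF N a b k f)"
    unfolding expand by (subst sum.swap) (simp add: mult.commute)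
  finally show ?thesis
    unfolding sum_fscale_delta by (simp only: EF_def)
qed

lemma current_module_EF: "current_module fscale n (EF N)"
  by (rule current_module.intro [OF fock.vector_space_char_0_axioms], rule current_module_axioms.intro)
    (rule endo_EF, rule EF_comm)

definition ev :: "nat set \<Rightarrow> fock" where
  "ev S = (\<lambda>U. if U = S then 1 else 0)"

lemma an_ev: "an x (ev S) = (if x \<in> S then fscale (sg x (S - {x})) (ev (S - {x})) else 0)"
  by (auto simp: an_def ev_def fscale_def fun_eq_iff)

lemma cr_ev: "cr x (ev S) = (if x \<in> S then 0 else fscale (sg x (insert x S)) (ev (insert x S)))"
  by (auto simp: cr_def ev_def fscale_def fun_eq_iff)

lemma hop_ev:
  "hop x y (ev S) = (if y \<in> S \<and> x \<notin> S - {y}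
    then fscale (sg y (S - {y}) * sg x (insert x (S - {y}))) (ev (insert x (S - {y}))) else 0)"
  by (auto simp: hop_def an_ev cr_scale cr_ev cr_0 mult.commute)

section \<open>Matchings between letters and points\<close>

text \<open>\<^term>\<open>weight \<tau> T ps\<close> is the sum of \<open>\<Prod> p\<^sup>k\<close> over the bijections between the multiset \<^term>\<open>T\<close>
  of pairs \<^term>\<open>(i, k)\<close> and the list \<^term>\<open>ps\<close> of points matching \<^term>\<open>i\<close> with the type \<^term>\<open>\<tau> p\<close>.\<close>
primrec weight :: "(nat \<Rightarrow> nat) \<Rightarrow> (nat \<times> nat) multiset \<Rightarrow> nat list \<Rightarrow> complex" where
  "weight \<tau> T [] = (if T = {#} then 1 else 0)"
| "weight \<tau> T (p # ps) = (\<Sum>x\<in>#filter_mset (\<lambda>x. fst x = \<tau> p) T. of_nat p ^ snd x * weight \<tau> (T - {#x#}) ps)"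

lemma sum_mset_sum_swap: "(\<Sum>x\<in>#M. \<Sum>p\<in>A. f x p) = (\<Sum>p\<in>A. \<Sum>x\<in>#M. f x p)"
  by (induction M) (simp_all add: sum.distrib)

text \<open>The definition expands the sum over matchings along a point; this is the expansion along
  a letter.\<close>

lemma weight_add:
  "distinct ps \<Longrightarrow> weight \<tau> (add_mset x T) ps
    = (\<Sum>p | p \<in> set ps \<and> \<tau> p = fst x. of_nat p ^ snd x * weight \<tau> T (remove1 p ps))"
proof (induction ps arbitrary: T)
  case Nil
  then show ?case by simp
next
  case (Cons p ps)
  have IH: "weight \<tau> (add_mset x T') ps = (\<Sum>p' | p' \<in> set ps \<and> \<tau> p' = fst x. of_nat p' ^ snd x * weight \<tau> T' (remove1 p' ps))" for T'
    using Cons by simp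
  let ?F = "filter_mset (\<lambda>x. fst x = \<tau> p) T"
  have "(\<Sum>y\<in>#?F. of_nat p ^ snd y * weight \<tau> (add_mset x T - {#y#}) ps)
      = (\<Sum>y\<in>#?F. \<Sum>p' | p' \<in> set ps \<and> \<tau> p' = fst x.
           of_nat p ^ snd y * (of_nat p' ^ snd x * weight \<tau> (T - {#y#}) (remove1 p' ps)))"
    by (intro arg_cong [where f = sum_mset] image_mset_cong) (auto simp: IH sum_distrib_left)
  also have "\<dots> = (\<Sum>p' | p' \<in> set ps \<and> \<tau> p' = fst x. of_nat p' ^ snd x * weight \<tau> T (p # remove1 p' ps))"
    unfolding sum_mset_sum_swap by (simp add: sum_mset_distrib_left mult.left_commute)
  also have "\<dots> = (\<Sum>p' | p' \<in> set ps \<and> \<tau> p' = fst x. of_nat p' ^ snd x * weight \<tau> T (remove1 p' (p # ps)))"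
    using Cons.prems by (intro sum.cong) auto
  finally have *: "(\<Sum>y\<in>#?F. of_nat p ^ snd y * weight \<tau> (add_mset x T - {#y#}) ps)
      = (\<Sum>p' | p' \<in> set ps \<and> \<tau> p' = fst x. of_nat p' ^ snd x * weight \<tau> T (remove1 p' (p # ps)))" .
  show ?case
  proof (cases "\<tau> p = fst x")
    case True
    then have "{p' \<in> set (p # ps). \<tau> p' = fst x} = insert p {p' \<in> set ps. \<tau> p' = fst x}"
      by auto
    then show ?thesis
      using True Cons.prems * by simp
  next
    case False
    then have "{p' \<in> set (p # ps). \<tau> p' = fst x} = {p' \<in> set ps. \<tau> p' = fst x}"
      by auto
    then show ?thesis
      using False * by simp
  qed
qed

lemma weight_nonzero:
  "weight \<tau> T ps \<noteq> 0 \<Longrightarrow> image_mset fst T = mset (map \<tau> ps)"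
proof (induction ps arbitrary: T)
  case (Cons p ps)
  have "\<exists>x. x \<in># T \<and> fst x = \<tau> p \<and> weight \<tau> (T - {#x#}) ps \<noteq> 0"
  proof (rule ccontr)
    assume "\<not> ?thesis"
    then have "weight \<tau> T (p # ps) = (\<Sum>x\<in>#filter_mset (\<lambda>x. fst x = \<tau> p) T. 0)"
      unfolding weight.simps by (intro arg_cong [where f = sum_mset] image_mset_cong) auto
    then show False using Cons.prems by simp
  qed
  then obtain x where x: "x \<in># T" "fst x = \<tau> p" "weight \<tau> (T - {#x#}) ps \<noteq> 0"
    by blast
  have "image_mset fst (T - {#x#}) = mset (map \<tau> ps)"
    by (rule Cons.IH) (rule x)
  then have "add_mset (fst x) (image_mset fst (T - {#x#})) = mset (map \<tau> (p # ps))"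
    using x by simp
  also have "add_mset (fst x) (image_mset fst (T - {#x#})) = image_mset fst T"
    using x(1) by (metis image_mset_add_mset insert_DiffM)
  finally show ?case .
qed (simp split: if_splits)

lemma sum_mset_filter_pairs:
  fixes g :: "nat \<times> nat \<Rightarrow> complex"
  shows "(\<And>x. x \<in># T \<Longrightarrow> fst x = i \<Longrightarrow> snd x \<le> d) \<Longrightarrow>
    (\<Sum>x\<in>#filter_mset (\<lambda>x. fst x = i) T. g x) = (\<Sum>k\<le>d. of_nat (count T (i, k)) * g (i, k))"
proof (induction T)
  case (add x T)
  have IH: "(\<Sum>x\<in>#filter_mset (\<lambda>x. fst x = i) T. g x) = (\<Sum>k\<le>d. of_nat (count T (i, k)) * g (i, k))"
    using add by simp
  show ?case
  proof (cases "fst x = i")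
    case True
    then obtain k where x: "x = (i, k)" by (cases x) auto
    have k: "k \<le> d" using add.prems [of x] x by simp
    have "(\<Sum>k'\<le>d. of_nat (count (add_mset x T) (i, k')) * g (i, k'))
        = (\<Sum>k'\<le>d. (if k' = k then g (i, k') else 0) + of_nat (count T (i, k')) * g (i, k'))"
      by (intro sum.cong) (auto simp: x algebra_simps)
    also have "\<dots> = g (i, k) + (\<Sum>k'\<le>d. of_nat (count T (i, k')) * g (i, k'))"
      using k by (simp add: sum.distrib)
    finally show ?thesis using IH by (simp add: x)
  next
    case False
    then have "of_nat (count (add_mset x T) (i, k)) = (of_nat (count T (i, k)) :: complex)" for k
      by auto
    then show ?thesis using False IH by simp
  qed
qed simp

lemma polynomial_coeffs_zero:
  fixes C :: "nat \<Rightarrow> complex"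
  assumes "finite A" "card A > d" "\<And>x. x \<in> A \<Longrightarrow> (\<Sum>k\<le>d. C k * x ^ k) = 0" "k \<le> d"
  shows "C k = 0"
proof (rule ccontr)
  assume C: "C k \<noteq> 0"
  have "card A \<le> card {z. (\<Sum>k\<le>d. C k * z ^ k) = 0}"
    using assms(3) by (intro card_mono polyfun_roots_finite [of C k d, OF C assms(4)]) auto
  also have "\<dots> \<le> d"
    by (rule polyfun_roots_card [of C k d, OF C assms(4)])
  finally show False using assms(2) by simp
qed

text \<open>Viewed as a function of one point \<^term>\<open>p\<close>, the relation is a polynomial whose degree is
  smaller than the number of points available for \<^term>\<open>p\<close>; so its coefficients vanish.\<close>
lemma weight_separation:
  assumes "finite X"
    and "\<And>T. T \<in> X \<Longrightarrow> size T = n"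
    and "\<And>T i. T \<in> X \<Longrightarrow> count (image_mset fst T) i = l i"
    and "\<And>T i k. T \<in> X \<Longrightarrow> (i, k) \<in># T \<Longrightarrow> k + l i \<le> card {p. p < N \<and> \<tau> p = i}"
    and "\<And>ps. distinct ps \<Longrightarrow> set ps \<subseteq> {..<N} \<Longrightarrow> (\<And>i. card {p \<in> set ps. \<tau> p = i} = l i) \<Longrightarrow>
      (\<Sum>T\<in>X. c T * weight \<tau> T ps) = 0"
    and "T \<in> X"
  shows "c T = 0"
  using assms
proof (induction n arbitrary: X l c T)
  case 0
  then have "X = {{#}}" "l = (\<lambda>_. 0)"
    by (auto simp: fun_eq_iff) (use 0 in fastforce)+
  then show ?case using 0(5) [of "[]"] 0(6) by simp
next
  case (Suc n)
  note X = Suc.prems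
  obtain x where x: "x \<in># T" using X(2) [OF X(6)] by (metis size_eq_Suc_imp_elem)
  obtain i k0 where ik: "x = (i, k0)" by (cases x)
  define M where "M = card {p. p < N \<and> \<tau> p = i}"
  define d where "d = M - l i"
  define l' where "l' = l(i := l i - 1)"
  define X' where "X' = {T \<in> X. x \<in># T}"
  have "fst x \<in># image_mset fst T"
    using x by (simp del: set_image_mset add: in_image_mset)
  then have li: "l i > 0"
    unfolding X(3) [OF X(6), symmetric] by (simp add: ik count_greater_zero_iff del: set_image_mset)
  have kd: "k \<le> d" if "T \<in> X" "(i, k) \<in># T" for T k
    using X(4) [OF that] by (simp add: d_def M_def)
  have lM: "l i \<le> M"
    using X(4) [OF X(6), of i k0] x ik by (simp add: M_def)
  \<comment> \<open>The factor \<open>count\<close> is the number of copies of \<open>x\<close> that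
    can be matched with the removed point. It is not 0 because \<open>T\<close> contains
    \<open>x\<close>, so it can be cancelled at the end.\<close>
  have "c ((T - {#x#}) + {#x#}) * of_nat (count ((T - {#x#}) + {#x#}) x) = 0"
  proof (rule Suc.IH [of "(\<lambda>T. T - {#x#}) ` X'" l' "\<lambda>T. c (T + {#x#}) * of_nat (count (T + {#x#}) x)"])
    show "finite ((\<lambda>T. T - {#x#}) ` X')" using X(1) by (simp add: X'_def)
    show "T - {#x#} \<in> (\<lambda>T. T - {#x#}) ` X'" using X(6) x by (simp add: X'_def)
    fix T' assume "T' \<in> (\<lambda>T. T - {#x#}) ` X'"
    then obtain T where T: "T \<in> X" "x \<in># T" "T' = T - {#x#}" by (auto simp: X'_def)
    then have add: "T = add_mset x T'" by simp
    show "size T' = n" using X(2) [OF T(1)] add by simp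
    show "count (image_mset fst T') j = l' j" for j
      using X(3) [OF T(1), of j] add ik by (auto simp: l'_def)
    show "k + l' j \<le> card {p. p < N \<and> \<tau> p = j}" if "(j, k) \<in># T'" for j k
      using X(4) [OF T(1), of j k] that add by (auto simp: l'_def)
  next
    fix ps assume ps: "distinct ps" "set ps \<subseteq> {..<N}" "\<And>j. card {p \<in> set ps. \<tau> p = j} = l' j"
    define A where "A = {p. p < N \<and> \<tau> p = i} - set ps"
    define C where "C k = (\<Sum>T\<in>X. c T * of_nat (count T (i, k)) * weight \<tau> (T - {#(i, k)#}) ps)" for k
    have "{p. p < N \<and> \<tau> p = i} \<inter> set ps = {p \<in> set ps. \<tau> p = i}"
      using ps(2) by auto
    \<comment> \<open>With l i - 1 points of type i used up, M - l i + 1 = d + 1 choices remain for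
      the new point: one more than a nonzero polynomial of degree at most d has roots.\<close>
    then have cardA: "card A = M - (l i - 1)"
      using ps(3) [of i] unfolding A_def M_def by (subst card_Diff_subset_Int) (auto simp: l'_def)
    have roots: "(\<Sum>k\<le>d. C k * z ^ k) = 0" if "z \<in> of_nat ` A" for z
    proof -
      from that obtain p where p: "p \<in> A" "z = of_nat p" by blast
      have "card {q \<in> set (p # ps). \<tau> q = j} = l j" for j
      proof (cases "j = i")
        case True
        have "{q \<in> set (p # ps). \<tau> q = j} = insert p {q \<in> set ps. \<tau> q = j}"
          using True p by (auto simp: A_def)
        then show ?thesis
          using True p li ps(3) [of j] by (simp add: A_def l'_def)
      next
        case False
        have "{q \<in> set (p # ps). \<tau> q = j} = {q \<in> set ps. \<tau> q = j}"
          using False p by (auto simp: A_def)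
        then show ?thesis
          using False ps(3) [of j] by (simp add: l'_def)
      qed
      then have "0 = (\<Sum>T\<in>X. c T * weight \<tau> T (p # ps))"
        using X(5) [of "p # ps"] ps p by (simp add: A_def)
      also have "\<dots> = (\<Sum>T\<in>X. \<Sum>k\<le>d. c T * (of_nat (count T (i, k)) * (of_nat p ^ k * weight \<tau> (T - {#(i, k)#}) ps)))"
      proof (rule sum.cong [OF refl])
        fix T assume T: "T \<in> X"
        have "weight \<tau> T (p # ps) = (\<Sum>k\<le>d. of_nat (count T (i, k)) * (of_nat p ^ k * weight \<tau> (T - {#(i, k)#}) ps))"
          using sum_mset_filter_pairs [of T i d "\<lambda>x. of_nat p ^ snd x * weight \<tau> (T - {#x#}) ps"] kd [OF T] p
          by (auto simp: A_def)
        then show "c T * weight \<tau> T (p # ps)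
            = (\<Sum>k\<le>d. c T * (of_nat (count T (i, k)) * (of_nat p ^ k * weight \<tau> (T - {#(i, k)#}) ps)))"
          by (simp add: sum_distrib_left)
      qed
      also have "\<dots> = (\<Sum>k\<le>d. C k * z ^ k)"
        unfolding C_def p(2) sum_distrib_right by (subst sum.swap) (simp only: mult_ac)
      finally show ?thesis by simp
    qed
    have C0: "C k0 = 0"
    proof (rule polynomial_coeffs_zero [OF _ _ roots])
      show "finite (of_nat ` A :: complex set)" by (simp add: A_def)
      have "card (of_nat ` A :: complex set) = card A"
        by (intro card_image inj_onI) simp
      then show "d < card (of_nat ` A :: complex set)"
        using cardA li lM by (simp add: d_def)
      show "k0 \<le> d"
        using kd [OF X(6), of k0] x ik by simp
    qed
    have "C k0 = (\<Sum>T\<in>X'. c T * of_nat (count T x) * weight \<tau> (T - {#x#}) ps)"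
      unfolding C_def X'_def ik using X(1) by (intro sum.mono_neutral_right) (auto simp: not_in_iff)
    also have "\<dots> = (\<Sum>T\<in>(\<lambda>T. T - {#x#}) ` X'. c (T + {#x#}) * of_nat (count (T + {#x#}) x) * weight \<tau> T ps)"
    proof (subst sum.reindex)
      show "inj_on (\<lambda>T. T - {#x#}) X'"
        unfolding X'_def by (rule inj_onI) (metis (mono_tags, lifting) insert_DiffM mem_Collect_eq)
    qed (auto simp: X'_def intro!: sum.cong)
    finally show "(\<Sum>T\<in>(\<lambda>T. T - {#x#}) ` X'. c (T + {#x#}) * of_nat (count (T + {#x#}) x) * weight \<tau> T ps) = 0"
      using C0 by simp
  qed
  then show ?case using x by (auto simp: insert_DiffM2 count_eq_zero_iff)
qed

section \<open>Independence in the Fock space\<close>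

lemma hop_apply: "hop x y f U = (if x \<in> U \<and> y \<notin> U - {x} then sg x U * sg y (U - {x}) * f (insert y (U - {x})) else 0)"
  by (simp add: hop_def cr_def an_def)

lemma EF_apply: "EF N a b k f U = (\<Sum>p<N. of_nat p ^ k * hop (mode p a) (mode p b) f U)"
  unfolding EF_def by (induction N) (simp_all add: fscale_def)

text \<open>\<open>ev S\<close> is a product of highest weight vectors, of the \<tau> p-th exterior
  power in copy p. \<open>S\<close> is prescribed only for indices up to \<open>Suc R\<close>: after
  a reduction of the rank it also contains modes of larger index, which the smaller algebra does not
  touch.\<close>

locale fock_highest =
  fixes N R :: nat and \<tau> :: "nat \<Rightarrow> nat" and S :: "nat set"
  assumes \<tau>: "p < N \<Longrightarrow> \<tau> p \<le> Suc R"
    and mode_S: "p < N \<Longrightarrow> 1 \<le> a \<Longrightarrow> a \<le> Suc R \<Longrightarrow> mode p a \<in> S \<longleftrightarrow> a \<le> \<tau> p"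
begin

definition tops :: "nat set \<Rightarrow> nat set" where
  "tops U = {p. p < N \<and> mode p (Suc R) \<in> U}"

lemma tops_S: "tops S = {p. p < N \<and> \<tau> p = Suc R}"
  using \<tau> mode_S by (force simp: tops_def)

definition moved_part :: "nat set \<Rightarrow> fock \<Rightarrow> fock" where
  "moved_part J f = (\<lambda>U. if tops U = J \<union> tops S then f U else 0)"

lemma endo_moved_part: "fock.endo (moved_part J)"
  by (rule fock.endoI) (auto simp: moved_part_def fscale_def fun_eq_iff)

definition yv :: "(nat \<times> nat) list \<Rightarrow> fock" where
  "yv t = act (EF N) (map (\<lambda>(i, k). (Suc R, i, k)) t) (ev S)"

lemma yv_Nil: "yv [] = ev S"
  and yv_Cons: "yv ((i, k) # t) = EF N (Suc R) i k (yv t)"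
  by (simp_all add: yv_def)

abbreviation ys :: "(nat \<times> nat) list set" where
  "ys \<equiv> lists ({1..R} \<times> UNIV)"

text \<open>The letters only empty modes of index at most R and fill modes of index
  \<open>Suc R\<close>.\<close>

lemma yv_support:
  "t \<in> ys \<Longrightarrow> yv t U \<noteq> 0 \<Longrightarrow> tops S \<subseteq> tops U \<and> (\<forall>p a. 1 \<le> a \<and> a \<le> R \<and> mode p a \<in> U \<longrightarrow> mode p a \<in> S)"
proof (induction t arbitrary: U)
  case Nil
  then show ?case by (simp add: yv_Nil ev_def split: if_splits)
next
  case (Cons x t)
  obtain i k where x: "x = (i, k)" by (cases x)
  have i: "1 \<le> i" "i \<le> R" and t: "t \<in> ys" using Cons.prems(1) unfolding x by auto
  from Cons.prems(2) have "\<exists>p. p < N \<and> hop (mode p (Suc R)) (mode p i) (yv t) U \<noteq> 0"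
    unfolding x yv_Cons EF_apply by (rule contrapos_np) (auto intro: sum.neutral)
  then obtain p where p: "p < N" "hop (mode p (Suc R)) (mode p i) (yv t) U \<noteq> 0"
    by blast
  let ?U = "insert (mode p i) (U - {mode p (Suc R)})"
  have "yv t ?U \<noteq> 0"
    using p(2) by (auto simp: hop_apply split: if_splits)
  then have "tops S \<subseteq> tops ?U \<and> (\<forall>p a. 1 \<le> a \<and> a \<le> R \<and> mode p a \<in> ?U \<longrightarrow> mode p a \<in> S)"
    using Cons.IH [OF t] by blast
  moreover have "tops ?U \<subseteq> tops U"
    using i by (auto simp: tops_def)
  moreover have "mode q a \<in> ?U" if "mode q a \<in> U" "a \<le> R" for q a
    using that by auto
  ultimately show ?case by blast
qed

lemma moved_part_hop:
  assumes i: "1 \<le> i" "i \<le> R" and p: "p < N" and J: "J \<inter> tops S = {}"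
    and f: "\<And>U. f U \<noteq> 0 \<Longrightarrow> tops S \<subseteq> tops U"
  shows "moved_part J (hop (mode p (Suc R)) (mode p i) f) = (if p \<in> J then hop (mode p (Suc R)) (mode p i) (moved_part (J - {p}) f) else 0)"
proof (rule ext)
  fix U
  define V where "V = insert (mode p i) (U - {mode p (Suc R)})"
  have tops: "tops V = tops U - {p}"
    using i by (auto simp: tops_def V_def)
  have hop: "hop (mode p (Suc R)) (mode p i) g U = (if mode p (Suc R) \<in> U \<and> mode p i \<notin> U - {mode p (Suc R)}
      then sg (mode p (Suc R)) U * sg (mode p i) (U - {mode p (Suc R)}) * g V else 0)" for g
    unfolding V_def by (rule hop_apply)
  show "moved_part J (hop (mode p (Suc R)) (mode p i) f) U = (if p \<in> J then hop (mode p (Suc R)) (mode p i) (moved_part (J - {p}) f) else 0) U"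
  proof (cases "mode p (Suc R) \<in> U")
    case True
    then have pU: "p \<in> tops U" using p by (simp add: tops_def)
    show ?thesis
    proof (cases "p \<in> J")
      case True
      then have "p \<notin> tops S" using J by blast
      then have "tops U = J \<union> tops S \<longleftrightarrow> tops V = (J - {p}) \<union> tops S"
        unfolding tops using True pU by blast
      then show ?thesis
        using True by (auto simp: moved_part_def hop)
    next
      case False
      have "f V = 0" if "tops U = J \<union> tops S"
      proof (rule ccontr)
        assume "f V \<noteq> 0"
        then have "p \<notin> tops S" using f tops by blast
        then show False using that False pU by blast
      qed
      then show ?thesis using False by (simp add: moved_part_def hop)
    qed
  next
    case False
    then show ?thesis by (simp add: moved_part_def hop)
  qed
qed

lemma moved_part_EF:
  assumes "1 \<le> a" "a \<le> R" "1 \<le> b" "b \<le> R"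
  shows "moved_part J (EF N a b k f) = EF N a b k (moved_part J f)"
proof (rule ext)
  fix U
  have "tops (insert (mode p b) (U - {mode p a})) = tops U" for p
    using assms by (auto simp: tops_def)
  then have *: "hop (mode p a) (mode p b) (moved_part J f) U = (if tops U = J \<union> tops S then hop (mode p a) (mode p b) f U else 0)" for p
    by (auto simp: hop_apply moved_part_def)
  show "moved_part J (EF N a b k f) U = EF N a b k (moved_part J f) U"
    unfolding EF_apply * by (simp add: moved_part_def EF_apply)
qed

lemma moved_part_act: "set u \<subseteq> letters R \<Longrightarrow> moved_part J (act (EF N) u f) = act (EF N) u (moved_part J f)"
proof (induction u)
  case (Cons x u)
  obtain a b k where x: "x = (a, b, k)" by (cases x)
  have "moved_part J (act (EF N) u f) = act (EF N) u (moved_part J f)"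
    using Cons by simp
  moreover have "1 \<le> a" "a \<le> R" "1 \<le> b" "b \<le> R"
    using Cons.prems unfolding x by (auto simp: letters_def)
  ultimately show ?case by (simp add: x moved_part_EF)
qed simp

definition xi :: "nat list \<Rightarrow> fock" where
  "xi ps = foldr (\<lambda>p. hop (mode p (Suc R)) (mode p (\<tau> p))) ps (ev S)"

definition moved :: "nat set \<Rightarrow> nat set" where
  "moved J = (S \<union> (\<lambda>p. mode p (Suc R)) ` J) - (\<lambda>p. mode p (\<tau> p)) ` J"

abbreviation points :: "nat list set" where
  "points \<equiv> {ps. distinct ps \<and> set ps \<subseteq> {p. p < N \<and> 1 \<le> \<tau> p \<and> \<tau> p \<le> R}}"

lemma xi_perm:
  assumes "ps \<in> points" "mset ps = mset ps'"
  shows "xi ps = xi ps'"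
  unfolding xi_def
proof (rule foldr_perm [OF _ assms(2)])
  fix p q v assume "p \<in> set ps" "q \<in> set ps"
  then have "\<tau> p \<noteq> Suc R" "\<tau> q \<noteq> Suc R" using assms(1) by auto
  then show "hop (mode p (Suc R)) (mode p (\<tau> p)) (hop (mode q (Suc R)) (mode q (\<tau> q)) v)
      = hop (mode q (Suc R)) (mode q (\<tau> q)) (hop (mode p (Suc R)) (mode p (\<tau> p)) v)"
    using hop_comm [of "mode p (Suc R)" "mode p (\<tau> p)" "mode q (Suc R)" "mode q (\<tau> q)" v] by simp
qed

lemma xi_ev: "ps \<in> points \<Longrightarrow> \<exists>c. c \<noteq> 0 \<and> xi ps = fscale c (ev (moved (set ps)))"
proof (induction ps)
  case Nil
  then show ?case by (auto simp: xi_def moved_def fscale_def intro!: exI [of _ 1])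
next
  case (Cons p ps)
  then obtain c where c: "c \<noteq> 0" "xi ps = fscale c (ev (moved (set ps)))"
    by auto
  let ?x = "mode p (Suc R)" and ?y = "mode p (\<tau> p)" and ?M = "moved (set ps)"
  have p: "p < N" "1 \<le> \<tau> p" "\<tau> p \<le> R" "p \<notin> set ps"
    using Cons.prems by auto
  have y: "?y \<in> ?M"
    using p mode_S [of p "\<tau> p"] by (auto simp: moved_def)
  have "?x \<notin> S"
    using p mode_S [of p "Suc R"] by simp
  then have x: "?x \<notin> ?M - {?y}"
    using p by (auto simp: moved_def)
  have "moved (set (p # ps)) = insert ?x (?M - {?y})"
    using p Cons.prems by (auto simp: moved_def)
  then have "xi (p # ps) = fscale (c * (sg ?y (?M - {?y}) * sg ?x (insert ?x (?M - {?y})))) (ev (moved (set (p # ps))))"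
    using c(2) x y by (simp add: xi_def fock.endo_scale [OF endo_hop] hop_ev)
  moreover have "c * (sg ?y (?M - {?y}) * sg ?x (insert ?x (?M - {?y}))) \<noteq> 0"
    using c(1) by simp
  ultimately show ?case by blast
qed

abbreviation height :: "(nat \<times> nat) list \<Rightarrow> nat" where
  "height t \<equiv> sum_list (map fst t)"

text \<open>The letter \<open>E\<^bsub>R+1,i\<^esub>\<close> only moves the blocks of type at least \<^term>\<open>i\<close>.  If the types of the moved blocks
  add up to the height, then every letter must have acted on a block of its own type.\<close>
lemma moved_part_yv:
  "t \<in> ys \<Longrightarrow> ps \<in> points \<Longrightarrow> sum_list (map \<tau> ps) \<le> height t \<Longrightarrow> moved_part (set ps) (yv t) = fscale (weight \<tau> (mset t) ps) (xi ps)"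
proof (induction t arbitrary: ps)
  case Nil
  have "ps = []"
    using Nil by (cases ps) auto
  then show ?case
    by (auto simp: yv_Nil moved_part_def ev_def xi_def fscale_def fun_eq_iff)
next
  case (Cons x t)
  obtain i k where x: "x = (i, k)" by (cases x)
  have i: "1 \<le> i" "i \<le> R" and t: "t \<in> ys" using Cons.prems(1) unfolding x by auto
  have J: "set ps \<inter> tops S = {}"
    using Cons.prems(2) by (auto simp: tops_S)
  let ?B = "\<lambda>p. hop (mode p (Suc R)) (mode p i)"
  have psN: "set ps \<subseteq> {..<N}" using Cons.prems(2) by auto
  have "moved_part (set ps) (yv (x # t)) = (\<Sum>p<N. fscale (of_nat p ^ k) (moved_part (set ps) (?B p (yv t))))"
    unfolding x yv_Cons EF_def by (simp only: fock.endo_sum [OF endo_moved_part] fock.endo_scale [OF endo_moved_part])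
  also have "\<dots> = (\<Sum>p<N. if p \<in> set ps then fscale (of_nat p ^ k) (?B p (moved_part (set (remove1 p ps)) (yv t))) else 0)"
  proof (rule sum.cong [OF refl])
    fix p assume "p \<in> {..<N}"
    then have "moved_part (set ps) (?B p (yv t)) = (if p \<in> set ps then ?B p (moved_part (set ps - {p}) (yv t)) else 0)"
      using yv_support [OF t] by (intro moved_part_hop i J) auto
    then show "fscale (of_nat p ^ k) (moved_part (set ps) (?B p (yv t)))
        = (if p \<in> set ps then fscale (of_nat p ^ k) (?B p (moved_part (set (remove1 p ps)) (yv t))) else 0)"
      using Cons.prems(2) by simp
  qed
  also have "\<dots> = (\<Sum>p\<in>set ps. fscale (of_nat p ^ k) (?B p (moved_part (set (remove1 p ps)) (yv t))))"
    using psN by (subst sum.inter_restrict [symmetric]) (auto simp: Int_absorb1)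
  also have "\<dots> = (\<Sum>p\<in>set ps. if \<tau> p = i then fscale (of_nat p ^ k * weight \<tau> (mset t) (remove1 p ps)) (xi ps) else 0)"
  proof (rule sum.cong [OF refl])
    fix p assume p: "p \<in> set ps"
    have ps': "remove1 p ps \<in> points"
      using Cons.prems(2) by auto
    have sum: "sum_list (map \<tau> ps) = \<tau> p + sum_list (map \<tau> (remove1 p ps))"
      by (rule sum_list_map_remove1 [OF p])
    show "fscale (of_nat p ^ k) (?B p (moved_part (set (remove1 p ps)) (yv t)))
        = (if \<tau> p = i then fscale (of_nat p ^ k * weight \<tau> (mset t) (remove1 p ps)) (xi ps) else 0)"
    proof (cases "\<tau> p < i")
      case True
      have "mode p i \<notin> S"
        using mode_S [of p i] p i True psN by auto
      then have "yv t (insert (mode p i) U) = 0" for U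
        using yv_support [OF t, of "insert (mode p i) U"] i by blast
      then have "?B p (moved_part (set (remove1 p ps)) (yv t)) = 0"
        by (auto simp: fun_eq_iff hop_apply moved_part_def)
      then show ?thesis using True by simp
    next
      case False
      then have IH: "moved_part (set (remove1 p ps)) (yv t) = fscale (weight \<tau> (mset t) (remove1 p ps)) (xi (remove1 p ps))"
        using Cons.prems(3) sum x by (intro Cons.IH [OF t ps']) simp
      show ?thesis
      proof (cases "\<tau> p = i")
        case True
        have "?B p (xi (remove1 p ps)) = xi (p # remove1 p ps)"
          by (simp add: xi_def True)
        also have "\<dots> = xi ps"
          using p Cons.prems(2) by (intro xi_perm [symmetric]) auto
        finally show ?thesis
          using True IH by (simp add: fock.endo_scale [OF endo_hop])
      next
        case neq: False
        \<comment> \<open>Now \<tau> p > i, so the types of the remaining points add up to less than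
          \<open>height t\<close> and no matching exists.\<close>
        have "weight \<tau> (mset t) (remove1 p ps) = 0"
        proof (rule ccontr)
          assume "weight \<tau> (mset t) (remove1 p ps) \<noteq> 0"
          then have "sum_mset (image_mset fst (mset t)) = sum_mset (mset (map \<tau> (remove1 p ps)))"
            using weight_nonzero by metis
          then have "height t = sum_list (map \<tau> (remove1 p ps))"
            by (simp add: sum_mset_sum_list flip: mset_map)
          then show False
            using Cons.prems(3) sum x False neq by simp
        qed
        then show ?thesis
          using IH neq fock.endo_0 [OF endo_hop] by simp
      qed
    qed
  qed
  also have "\<dots> = (\<Sum>p | p \<in> set ps \<and> \<tau> p = i. fscale (of_nat p ^ k * weight \<tau> (mset t) (remove1 p ps)) (xi ps))"
    by (rule sum.inter_filter [symmetric]) simp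
  also have "\<dots> = fscale (weight \<tau> (mset (x # t)) ps) (xi ps)"
    using Cons.prems(2) weight_add [of ps \<tau> "(i, k)" "mset t"] by (simp add: x fock.scale_sum_left)
  finally show ?case .
qed

end

definition row_pairs :: "nat \<Rightarrow> (nat \<Rightarrow> nat \<Rightarrow> nat list) \<Rightarrow> (nat \<times> nat) list" where
  "row_pairs R S = concat (map (\<lambda>i. map (Pair i) (S i R)) [1..<Suc R])"

lemma lower_word_row:
  "lower_word (Suc r) S = lower_word r S @ map (\<lambda>(i, k). (Suc (Suc r), i, k)) (row_pairs (Suc r) S)"
  unfolding lower_word_Suc row_pairs_def by (simp add: map_concat o_def del: upt_Suc)

lemma set_row_pairs: "set (row_pairs R S) = {(i, k). 1 \<le> i \<and> i \<le> R \<and> k \<in> set (S i R)}"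
  by (auto simp: row_pairs_def image_iff simp del: upt_Suc)

lemma filter_row_pairs:
  assumes "1 \<le> i" "i \<le> R"
  shows "filter (\<lambda>x. fst x = i) (row_pairs R S) = map (Pair i) (S i R)"
proof -
  have "distinct xs \<Longrightarrow> filter (\<lambda>x. fst x = i) (concat (map (\<lambda>i. map (Pair i) (S i R)) xs))
      = (if i \<in> set xs then map (Pair i) (S i R) else [])" for xs
  proof (induction xs)
    case (Cons j xs)
    have "filter (\<lambda>x. fst x = i) (map (Pair j) (S j R)) = (if i = j then map (Pair i) (S i R) else [])"
      by (auto simp: filter_map o_def)
    then show ?case using Cons by auto
  qed simp
  then show ?thesis
    unfolding row_pairs_def using assms by (simp del: upt_Suc)
qed

lemma count_row_pairs:
  assumes "1 \<le> i" "i \<le> R"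
  shows "count (image_mset fst (mset (row_pairs R S))) i = length (S i R)"
proof -
  have "count (image_mset fst (mset t)) i = length (filter (\<lambda>x. fst x = i) t)" for t :: "(nat \<times> nat) list"
    by (induction t) auto
  then show ?thesis by (simp add: filter_row_pairs [OF assms])
qed

lemma row_pairs_eqI:
  assumes "mset (row_pairs R S) = mset (row_pairs R S')"
    and "\<And>i. 1 \<le> i \<Longrightarrow> i \<le> R \<Longrightarrow> sorted (S i R)" "\<And>i. 1 \<le> i \<Longrightarrow> i \<le> R \<Longrightarrow> sorted (S' i R)"
  shows "row_pairs R S = row_pairs R S'"
proof -
  have "S i R = S' i R" if i: "1 \<le> i" "i \<le> R" for i
  proof -
    have "mset (map snd (filter (\<lambda>x. fst x = i) (row_pairs R S))) = mset (map snd (filter (\<lambda>x. fst x = i) (row_pairs R S')))"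
      using assms(1) by (simp only: mset_map mset_filter)
    then have "mset (S i R) = mset (S' i R)"
      by (simp add: filter_row_pairs [OF i] o_def)
    then show ?thesis
      using assms(2,3) [OF i] by (metis properties_for_sort)
  qed
  then show ?thesis
    unfolding row_pairs_def by (intro arg_cong [where f = concat] map_cong refl) auto
qed

lemma inF_bound:
  assumes "inF (int M) s" "k \<in> set s"
  shows "k + length s \<le> M"
proof -
  have "s \<noteq> []" "sorted s" using assms by (auto simp: inF_def)
  moreover obtain j where "j < length s" "k = s ! j"
    using assms(2) by (metis in_set_conv_nth)
  ultimately have "k \<le> last s"
    using sorted_nth_mono [of s j "length s - 1"] by (simp add: last_conv_nth)
  then show ?thesis using assms by (auto simp: inF_def)
qed

lemma inF_length: "inF (int M) s \<Longrightarrow> length s \<le> M"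
  using inF_bound [of M s "last s"] by (cases "s = []") auto

context fock_highest
begin

text \<open>For gl_R a moved copy has merely lost its vector of index \<tau> p, and a copy of type
  \<open>Suc R\<close> counts as the full exterior power of type R. The moved vector is thus again
  of the kind that the induction on the rank needs.\<close>

lemma moved_highest:
  assumes R: "R = Suc r" and J: "J \<subseteq> {p. p < N \<and> 1 \<le> \<tau> p \<and> \<tau> p \<le> R}"
  shows "fock_highest N r (\<lambda>p. if p \<in> J then \<tau> p - 1 else min (\<tau> p) R) (moved J)"
proof
  fix p assume p: "p < N"
  show "(if p \<in> J then \<tau> p - 1 else min (\<tau> p) R) \<le> Suc r"
    using J R by auto
  fix a assume a: "1 \<le> a" "a \<le> Suc r"
  have aR: "a \<le> R" using a(2) R by simp
  have "mode p a \<in> moved J \<longleftrightarrow> a \<le> \<tau> p \<and> \<not> (p \<in> J \<and> a = \<tau> p)"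
    using mode_S [OF p a(1)] aR by (auto simp: moved_def)
  then show "mode p a \<in> moved J \<longleftrightarrow> a \<le> (if p \<in> J then \<tau> p - 1 else min (\<tau> p) R)"
    using a(1) aR J by auto
qed

text \<open>The numbers of copies change by the rule m_i + l_{i+1} - l_i met in the spanning part,
  so admissibility in rank r is preserved.\<close>

lemma card_moved_type:
  assumes J: "J \<subseteq> {p. p < N \<and> 1 \<le> \<tau> p \<and> \<tau> p \<le> R}" and i: "1 \<le> i" "i < R"
  shows "card {p. p < N \<and> (if p \<in> J then \<tau> p - 1 else min (\<tau> p) R) = i}
    = card {p. p < N \<and> \<tau> p = i} + card {p \<in> J. \<tau> p = Suc i} - card {p \<in> J. \<tau> p = i}"
proof -
  have fin: "finite J" using J by (rule finite_subset) simp
  have type: "(if p \<in> J then \<tau> p - 1 else min (\<tau> p) R) = i \<longleftrightarrow> (if p \<in> J then \<tau> p = Suc i else \<tau> p = i)"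
    if "p < N" for p
    using J i by auto
  have eq: "{p. p < N \<and> (if p \<in> J then \<tau> p - 1 else min (\<tau> p) R) = i}
      = ({p. p < N \<and> \<tau> p = i} - {p \<in> J. \<tau> p = i}) \<union> {p \<in> J. \<tau> p = Suc i}"
  proof -
    have "{p. p < N \<and> (if p \<in> J then \<tau> p - 1 else min (\<tau> p) R) = i}
        = {p. p < N \<and> (if p \<in> J then \<tau> p = Suc i else \<tau> p = i)}"
      using type by blast
    also have "\<dots> = ({p. p < N \<and> \<tau> p = i} - {p \<in> J. \<tau> p = i}) \<union> {p \<in> J. \<tau> p = Suc i}"
      using J by auto
    finally show ?thesis .
  qed
  have c1: "card (({p. p < N \<and> \<tau> p = i} - {p \<in> J. \<tau> p = i}) \<union> {p \<in> J. \<tau> p = Suc i})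
      = card ({p. p < N \<and> \<tau> p = i} - {p \<in> J. \<tau> p = i}) + card {p \<in> J. \<tau> p = Suc i}"
    using fin by (intro card_Un_disjoint) auto
  have c2: "card ({p. p < N \<and> \<tau> p = i} - {p \<in> J. \<tau> p = i}) = card {p. p < N \<and> \<tau> p = i} - card {p \<in> J. \<tau> p = i}"
    using J fin by (intro card_Diff_subset) auto
  have c3: "card {p \<in> J. \<tau> p = i} \<le> card {p. p < N \<and> \<tau> p = i}"
    using J by (intro card_mono) auto
  show ?thesis
    unfolding eq c1 c2 using c3 by simp
qed

end

text \<open>The relation is projected to the component in which points with the types of a word
  \<open>w0\<close> of least height have been moved. Words with other types have weight 0 there; the
  induction hypothesis separates the words by their part of smaller rank, and
  \<open>weight_separation\<close> separates the last columns.\<close>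

theorem lower_words_independent:
  assumes "fock_highest N R \<tau> S" and "\<And>i. 1 \<le> i \<Longrightarrow> i \<le> R \<Longrightarrow> m i = card {p. p < N \<and> \<tau> p = i}"
    and "finite A" "A \<subseteq> {lower_word R S' |S'. admissible R m S'}"
    and "(\<Sum>w\<in>A. fscale (c w) (act (EF N) w (ev S))) = 0" and "w \<in> A"
  shows "c w = 0"
  using assms
proof (induction R arbitrary: \<tau> S m A c w)
  case 0
  then have A: "A = {[]}" by (auto simp: lower_word_0)
  have "c [] = fscale (c []) (ev S) S"
    by (simp add: fscale_def ev_def)
  also have "\<dots> = (0 :: fock) S"
    using 0(5) A by simp
  finally show ?case using 0(6) A by simp
next
  case (Suc r)
  let ?R = "Suc r"
  interpret fock_highest N ?R \<tau> S by fact
  note m = Suc.prems(2) and finA = Suc.prems(3) and rel = Suc.prems(5)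
  have "\<forall>w\<in>A. \<exists>S'. admissible ?R m S' \<and> w = lower_word ?R S'"
    using Suc.prems(4) by blast
  then obtain s where s: "\<And>w. w \<in> A \<Longrightarrow> admissible ?R m (s w)" "\<And>w. w \<in> A \<Longrightarrow> w = lower_word ?R (s w)"
    by metis
  define hd where "hd w = lower_word r (s w)" for w
  define t where "t w = row_pairs ?R (s w)" for w
  define T where "T w = mset (t w)" for w
  have row: "inF (int (m i)) (s w i ?R)" if "w \<in> A" "1 \<le> i" "i \<le> ?R" for w i
    using s(1) [OF that(1)] that by (force simp: admissible_def mij_last)
  have w_eq: "w = hd w @ map (\<lambda>(i, k). (Suc ?R, i, k)) (t w)" if "w \<in> A" for w
    using s(2) [OF that] by (simp add: hd_def t_def lower_word_row)
  have inj: "w = w'" if "w \<in> A" "w' \<in> A" "hd w = hd w'" "T w = T w'" for w w'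
  proof -
    have "t w = t w'"
      unfolding t_def
    proof (rule row_pairs_eqI)
      show "mset (row_pairs ?R (s w)) = mset (row_pairs ?R (s w'))"
        using that(4) by (simp add: T_def t_def)
    qed (use row that in \<open>auto simp: inF_def\<close>)
    then show ?thesis
      using w_eq that by metis
  qed
  have t_ys: "t w \<in> ys" for w
    by (auto simp: t_def set_row_pairs)
  have act_w: "act (EF N) w (ev S) = act (EF N) (hd w) (yv (t w))" if "w \<in> A" for w
    by (subst w_eq [OF that]) (simp add: yv_def)
  have hd_letters: "set (hd w) \<subseteq> letters ?R" for w
    unfolding hd_def by (rule lower_word_letters)
  have endo_act: "fock.endo (act (EF N) u)" if "set u \<subseteq> letters ?R" for u
    using current_module.endo_act [OF current_module_EF that] .
  show ?case
  proof (rule ccontr)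
    assume "c w \<noteq> 0"
    define A0 where "A0 = {w \<in> A. c w \<noteq> 0}"
    have "A0 \<noteq> {}" "finite A0"
      using \<open>c w \<noteq> 0\<close> Suc.prems(6) finA by (auto simp: A0_def)
    then obtain w0 where w0: "w0 \<in> A0" and min: "\<And>w. w \<in> A0 \<Longrightarrow> height (t w0) \<le> height (t w)"
      using arg_min_if_finite [of A0 "\<lambda>w. height (t w)"] by (metis linorder_not_less)
    have w0A: "w0 \<in> A" using w0 by (simp add: A0_def)
    define l where "l i = count (image_mset fst (T w0)) i" for i
    define X where "X = {w \<in> A0. image_mset fst (T w) = image_mset fst (T w0)}"
    have XA0: "X \<subseteq> A0" by (auto simp: X_def)
    have XA: "X \<subseteq> A" "finite X" "w0 \<in> X"
      using finite_subset [OF XA0 \<open>finite A0\<close>] w0 by (auto simp: X_def A0_def)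
    have l: "length (s w i ?R) = l i" if "w \<in> X" "1 \<le> i" "i \<le> ?R" for w i
    proof -
      have "image_mset fst (T w) = image_mset fst (T w0)" using that by (simp add: X_def)
      then show ?thesis
        unfolding l_def T_def t_def using count_row_pairs [OF that(2,3), of "s w"] by simp
    qed
    have lm: "l i \<le> m i" if "1 \<le> i" "i \<le> ?R" for i
      using inF_length [OF row [OF w0A that]] l [OF XA(3) that] by simp
    \<comment> \<open>Words with the same part of smaller rank as \<open>w0\<close>. On these the
      multiset \<open>T w\<close> determines the word, because the columns are sorted.\<close>
    define Z where "Z = {w \<in> X. hd w = hd w0}"
    have Z: "Z \<subseteq> A" "finite Z" "w0 \<in> Z"
      using XA by (auto simp: Z_def)
    have key: "(\<Sum>w\<in>Z. c w * weight \<tau> (T w) ps) = 0"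
      if ps: "distinct ps" "set ps \<subseteq> {..<N}" and type: "\<And>i. card {p \<in> set ps. \<tau> p = i} = l i" for ps
    proof -
      have types: "mset (map \<tau> ps) = image_mset fst (T w0)"
      proof (rule multiset_eqI)
        fix i
        have "count (mset (map \<tau> ps)) i = length (filter (\<lambda>p. \<tau> p = i) ps)"
          by (induction ps) auto
        also have "\<dots> = card {p \<in> set ps. \<tau> p = i}"
          using ps(1) by (metis distinct_card distinct_filter set_filter)
        finally show "count (mset (map \<tau> ps)) i = count (image_mset fst (T w0)) i"
          using type by (simp add: l_def)
      qed
      have "\<tau> p \<in> {1..?R}" if "p \<in> set ps" for p
      proof -
        have "\<tau> p \<in># mset (map \<tau> ps)" using that by simp
        then show ?thesis
          unfolding types T_def using t_ys [of w0] by auto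
      qed
      then have points: "ps \<in> points"
        using ps by force
      have height: "sum_list (map \<tau> ps) = height (t w0)"
        using arg_cong [OF types, of sum_mset] by (simp add: T_def sum_mset_sum_list flip: mset_map)
      obtain \<kappa> where \<kappa>: "\<kappa> \<noteq> 0" "xi ps = fscale \<kappa> (ev (moved (set ps)))"
        using xi_ev [OF points] by blast
      let ?v = "ev (moved (set ps))"
      have "0 = moved_part (set ps) (\<Sum>w\<in>A. fscale (c w) (act (EF N) w (ev S)))"
        unfolding rel by (simp add: fock.endo_0 [OF endo_moved_part])
      also have "\<dots> = (\<Sum>w\<in>A. fscale (c w) (moved_part (set ps) (act (EF N) (hd w) (yv (t w)))))"
        by (simp add: fock.endo_sum [OF endo_moved_part] fock.endo_scale [OF endo_moved_part] act_w)
      also have "\<dots> = (\<Sum>w\<in>A. fscale (c w) (act (EF N) (hd w) (moved_part (set ps) (yv (t w)))))"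
        by (simp only: moved_part_act [OF hd_letters])
      also have "\<dots> = (\<Sum>w\<in>A0. fscale (c w) (act (EF N) (hd w) (moved_part (set ps) (yv (t w)))))"
        using finA by (intro sum.mono_neutral_right) (auto simp: A0_def)
      also have "\<dots> = (\<Sum>w\<in>A0. fscale (c w * weight \<tau> (T w) ps * \<kappa>) (act (EF N) (hd w) ?v))"
      proof (rule sum.cong [OF refl])
        fix w assume w: "w \<in> A0"
        have "moved_part (set ps) (yv (t w)) = fscale (weight \<tau> (T w) ps) (xi ps)"
          unfolding T_def using min [OF w] height by (intro moved_part_yv t_ys points) simp
        then show "fscale (c w) (act (EF N) (hd w) (moved_part (set ps) (yv (t w))))
            = fscale (c w * weight \<tau> (T w) ps * \<kappa>) (act (EF N) (hd w) ?v)"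
          using fock.endo_scale [OF endo_act [OF hd_letters]] by (simp add: \<kappa>(2) mult.assoc)
      qed
      also have "\<dots> = (\<Sum>w\<in>X. fscale (c w * weight \<tau> (T w) ps * \<kappa>) (act (EF N) (hd w) ?v))"
      proof (rule sum.mono_neutral_right [OF \<open>finite A0\<close>])
        show "X \<subseteq> A0" by (auto simp: X_def)
        have "weight \<tau> (T w) ps = 0" if "w \<in> A0 - X" for w
          using weight_nonzero [of \<tau> "T w" ps] that types by (auto simp: X_def)
        then show "\<forall>w\<in>A0 - X. fscale (c w * weight \<tau> (T w) ps * \<kappa>) (act (EF N) (hd w) ?v) = 0"
          by simp
      qed
      also have "\<dots> = (\<Sum>h\<in>hd ` X. \<Sum>w\<in>{w \<in> X. hd w = h}. fscale (c w * weight \<tau> (T w) ps * \<kappa>) (act (EF N) (hd w) ?v))"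
        by (rule sum.image_gen [OF XA(2)])
      also have "\<dots> = (\<Sum>h\<in>hd ` X. fscale (\<Sum>w\<in>{w \<in> X. hd w = h}. c w * weight \<tau> (T w) ps * \<kappa>) (act (EF N) h ?v))"
        by (intro sum.cong refl) (simp add: fock.scale_sum_left)
      finally have rel': "(\<Sum>h\<in>hd ` X. fscale (\<Sum>w\<in>{w \<in> X. hd w = h}. c w * weight \<tau> (T w) ps * \<kappa>) (act (EF N) h ?v)) = 0"
        by simp
      define m' where "m' i = m i + l (Suc i) - l i" for i
      have J: "set ps \<subseteq> {p. p < N \<and> 1 \<le> \<tau> p \<and> \<tau> p \<le> ?R}"
        using points by blast
      have "(\<Sum>w\<in>{w \<in> X. hd w = hd w0}. c w * weight \<tau> (T w) ps * \<kappa>) = 0"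
      proof (rule Suc.IH [OF moved_highest [OF refl J] _ _ _ rel'])
        show "m' i = card {p. p < N \<and> (if p \<in> set ps then \<tau> p - 1 else min (\<tau> p) ?R) = i}" if "1 \<le> i" "i \<le> r" for i
          using card_moved_type [OF J, of i] m [of i] type that by (simp add: m'_def)
        show "finite (hd ` X)" using XA by simp
        show "hd ` X \<subseteq> {lower_word r S' |S'. admissible r m' S'}"
        proof
          fix h assume "h \<in> hd ` X"
          then obtain w where w: "w \<in> X" "h = hd w" by blast
          have wA: "w \<in> A" using w XA by blast
          have "inF (mij r m' (s w) i j) (s w i j)" if ij: "1 \<le> i" "i \<le> j" "j \<le> r" for i j
          proof -
            have "int (m' i) = int (m i) + (int (length (s w (i + 1) ?R)) - int (length (s w i ?R)))"
              using l [OF w(1), of i] l [OF w(1), of "i + 1"] lm [of i] ij by (simp add: m'_def of_nat_diff)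
            then have "mij ?R m (s w) i j = mij r m' (s w) i j"
              using ij by (intro mij_Suc) auto
            then show ?thesis
              using s(1) [OF wA] ij unfolding admissible_def by (metis le_Suc_eq)
          qed
          then show "h \<in> {lower_word r S' |S'. admissible r m' S'}"
            unfolding w(2) hd_def admissible_def by blast
        qed
        show "hd w0 \<in> hd ` X" using XA by blast
      qed
      then have "(\<Sum>w\<in>Z. c w * weight \<tau> (T w) ps) * \<kappa> = 0"
        by (simp add: Z_def sum_distrib_right)
      then show ?thesis using \<kappa>(1) by simp
    qed
    have injT: "inj_on T Z"
      by (rule inj_onI, rule inj) (use Z in \<open>auto simp: Z_def\<close>)
    have "c (the_inv_into Z T (T w0)) = 0"
    proof (rule weight_separation [where X = "T ` Z" and c = "\<lambda>M. c (the_inv_into Z T M)" and n = "size (T w0)" and l = l and N = N and \<tau> = \<tau>])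
      show "finite (T ` Z)" using Z by simp
      show "T w0 \<in> T ` Z" using Z by simp
      fix M assume "M \<in> T ` Z"
      then obtain w where w: "w \<in> Z" "M = T w" by blast
      then have fst: "image_mset fst M = image_mset fst (T w0)" and wX: "w \<in> X" and wA: "w \<in> A"
        using Z by (auto simp: Z_def X_def)
      show "size M = size (T w0)"
        using arg_cong [OF fst, of size] by simp
      show "count (image_mset fst M) i = l i" for i
        by (simp only: fst l_def)
      show "k + l i \<le> card {p. p < N \<and> \<tau> p = i}" if "(i, k) \<in># M" for i k
      proof -
        have ik: "1 \<le> i" "i \<le> ?R" "k \<in> set (s w i ?R)"
          using that unfolding w(2) T_def t_def by (auto simp: set_row_pairs)
        show ?thesis
          using inF_bound [OF row [OF wA ik(1,2)] ik(3)] l [OF wX ik(1,2)] m [OF ik(1,2)] by simp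
      qed
    next
      fix ps assume "distinct ps" "set ps \<subseteq> {..<N}" "\<And>i. card {p \<in> set ps. \<tau> p = i} = l i"
      then have "(\<Sum>w\<in>Z. c w * weight \<tau> (T w) ps) = 0" by (rule key)
      then show "(\<Sum>M\<in>T ` Z. c (the_inv_into Z T M) * weight \<tau> M ps) = 0"
        by (simp add: sum.reindex [OF injT] the_inv_into_f_f [OF injT])
    qed
    then have "c w0 = 0"
      by (simp only: the_inv_into_f_f [OF injT Z(3)])
    then show False
      using w0 unfolding A0_def by blast
  qed
qed

section \<open>The Weyl module as a module over currents\<close>

interpretation tens: vector_space_char_0 smul
  using vector_space_fun unfolding smul_def [abs_def] .

text \<open>Left multiplication by the letter \<open>x\<close>, so that \<open>foldr lm u\<close> is
  multiplication by \<open>tmono u\<close>.\<close>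

definition lm :: "cur \<Rightarrow> tens \<Rightarrow> tens" where
  "lm x F = (\<lambda>w. case w of [] \<Rightarrow> 0 | y # w' \<Rightarrow> if y = x then F w' else 0)"

lemma endo_lm: "tens.endo (lm x)"
  by (rule tens.endoI) (auto simp: lm_def smul_def fun_eq_iff split: list.splits)

lemma lm_tmono: "lm x (tmono u) = tmono (x # u)"
  by (auto simp: lm_def tmono_def fun_eq_iff split: list.splits)

lemma lm_tmul: "tmul (lm x F) G = lm x (tmul F G)"
proof (rule ext)
  fix w
  show "tmul (lm x F) G w = lm x (tmul F G) w"
    by (cases w) (simp_all add: tmul_def lm_def atLeast0AtMost sum.atMost_Suc_shift del: sum.atMost_Suc)
qed

lemma tmul_Nil: "tmul (tmono []) F = F"
proof (rule ext)
  fix w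
  have "tmul (tmono []) F w = (\<Sum>i\<in>{0..length w}. if i = 0 then F w else 0)"
    unfolding tmul_def by (intro sum.cong) (auto simp: tmono_def)
  then show "tmul (tmono []) F w = F w" by simp
qed

lemma tmul_tmono: "tmul (tmono u) F = foldr lm u F"
  by (induction u) (simp_all add: tmul_Nil lm_tmul flip: lm_tmono)

lemma foldr_lm_tmono: "foldr lm u (tmono v) = tmono (u @ v)"
  by (induction u) (simp_all add: lm_tmono)

lemma endo_foldr_lm: "tens.endo (foldr lm u)"
  by (rule tens.endo_foldr) (rule endo_lm)

lemma tmul_minus_left: "tmul (F - G) H = tmul F H - tmul G H"
  by (auto simp: tmul_def fun_eq_iff left_diff_distrib sum_subtractf)

lemma tmul_smul_left: "tmul (smul c F) G = smul c (tmul F G)"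
  by (auto simp: tmul_def smul_def fun_eq_iff sum_distrib_left mult.assoc)

lemma relator_expand:
  "tmul (tmul (tmono u) (tmono x - tmono y - tmono z)) (tmono v) = foldr lm u (tmono (x @ v) - tmono (y @ v) - tmono (z @ v))"
  "tmul (tmul (tmono u) (tmono x - smul c (tmono y))) (tmono v) = foldr lm u (tmono (x @ v) - smul c (tmono (y @ v)))"
  by (simp_all add: tmul_tmono tens.endo_diff [OF endo_foldr_lm] tens.endo_scale [OF endo_foldr_lm]
      foldr_lm_tmono tmul_minus_left tmul_smul_left)

lemma subspace_Kw: "tens.subspace (Kw r m)"
  using Kw.zero [of r m] Kw.add [of _ r m] Kw.smult [of _ r m]
  by (intro tens.subspaceI) (auto simp: zero_fun_def)

lemma lm_Kw:
  assumes x: "x \<in> gt r"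
  shows "F \<in> Kw r m \<Longrightarrow> lm x F \<in> Kw r m"
proof (induction rule: Kw.induct)
  case zero
  have "lm x (\<lambda>_. 0) = (\<lambda>_. 0)"
    by (auto simp: lm_def fun_eq_iff split: list.splits)
  then show ?case using Kw.zero by simp
next
  case (add F G)
  show ?case unfolding tens.endo_add [OF endo_lm] by (rule Kw.add [OF add.IH])
next
  case (smult F c)
  then show ?case using Kw.smult by (simp add: tens.endo_scale [OF endo_lm])
next
  case (lin_add y z u v)
  then show ?case using Kw.lin_add [of y r z "x # u" v m] x by (simp add: lm_tmul flip: lm_tmono)
next
  case (lin_smult y u v c)
  then show ?case using Kw.lin_smult [of y r "x # u" v c m] x by (simp add: lm_tmul flip: lm_tmono)
next
  case (lie y z u v)
  then show ?case using Kw.lie [of y r z "x # u" v m] x by (simp add: lm_tmul flip: lm_tmono)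
next
  case (weyl R u)
  then show ?case using Kw.weyl [of R r m "x # u"] x by (simp add: lm_tmul flip: lm_tmono)
qed

text \<open>\<open>tens\<close> also contains functions of infinite support and words with letters
  outside \<open>gt r\<close>. The relations of the enveloping algebra are available modulo
  \<open>Kw\<close> on this subspace only.\<close>

definition words :: "nat \<Rightarrow> (nat \<Rightarrow> nat) \<Rightarrow> tens set" where
  "words r m = tens.span (tmono ` lists (gt r) \<union> Kw r m)"

lemma Kw_words: "Kw r m \<subseteq> words r m"
  by (auto simp: words_def intro: tens.span_base)

lemma tmono_words: "u \<in> lists (gt r) \<Longrightarrow> tmono u \<in> words r m"
  by (auto simp: words_def intro!: tens.span_base)

lemma lm_words:
  assumes x: "x \<in> gt r" and F: "F \<in> words r m"
  shows "lm x F \<in> words r m"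
proof (rule tens.endo_span [OF endo_lm _ _ F [unfolded words_def]])
  fix G assume "G \<in> tmono ` lists (gt r) \<union> Kw r m"
  then show "lm x G \<in> words r m"
  proof
    assume "G \<in> tmono ` lists (gt r)"
    then show ?thesis using x by (auto simp: lm_tmono intro!: tmono_words)
  next
    assume "G \<in> Kw r m"
    then show ?thesis using lm_Kw [OF x] Kw_words by blast
  qed
qed (simp add: words_def)

lemma relation_on_words:
  assumes T: "tens.endo T" "\<And>v. v \<in> lists (gt r) \<Longrightarrow> T (tmono v) \<in> Kw r m" "\<And>F. F \<in> Kw r m \<Longrightarrow> T F \<in> Kw r m"
    and F: "F \<in> words r m"
  shows "T F \<in> Kw r m"
  by (rule tens.endo_span [OF T(1) _ subspace_Kw F [unfolded words_def]]) (use T in auto)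

lemma lm_add_mod:
  assumes "x \<in> gt r" "y \<in> gt r" "x + y \<in> gt r" "F \<in> words r m"
  shows "lm (x + y) F - lm x F - lm y F \<in> Kw r m"
proof (rule relation_on_words [OF _ _ _ assms(4)])
  show "tens.endo (\<lambda>F. lm (x + y) F - lm x F - lm y F)"
    by (rule tens.endoI) (simp_all add: tens.endo_add [OF endo_lm] tens.endo_scale [OF endo_lm] tens.scale_right_diff_distrib)
  show "lm (x + y) (tmono v) - lm x (tmono v) - lm y (tmono v) \<in> Kw r m" if "v \<in> lists (gt r)" for v
    using Kw.lin_add [OF assms(1,2), of "[]" v m] that by (simp add: relator_expand lm_tmono)
  show "lm (x + y) F - lm x F - lm y F \<in> Kw r m" if "F \<in> Kw r m" for F
    using assms that by (intro tens.subspace_diff [OF subspace_Kw] lm_Kw)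
qed

abbreviation cscale :: "complex \<Rightarrow> cur \<Rightarrow> cur" where
  "cscale c x \<equiv> (\<lambda>k a b. c * x k a b)"

lemma lm_scale_mod:
  assumes "x \<in> gt r" "cscale c x \<in> gt r" "F \<in> words r m"
  shows "lm (cscale c x) F - smul c (lm x F) \<in> Kw r m"
proof (rule relation_on_words [OF _ _ _ assms(3)])
  show "tens.endo (\<lambda>F. lm (cscale c x) F - smul c (lm x F))"
    by (rule tens.endoI) (simp_all add: tens.endo_add [OF endo_lm] tens.endo_scale [OF endo_lm]
      tens.scale_right_diff_distrib tens.scale_right_distrib mult.commute)
  show "lm (cscale c x) (tmono v) - smul c (lm x (tmono v)) \<in> Kw r m" if "v \<in> lists (gt r)" for v
    using Kw.lin_smult [OF assms(1), of "[]" v c m] that by (simp add: relator_expand lm_tmono)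
  show "lm (cscale c x) F - smul c (lm x F) \<in> Kw r m" if "F \<in> Kw r m" for F
    using assms that by (intro tens.subspace_diff [OF subspace_Kw] lm_Kw tens.subspace_scale [OF subspace_Kw])
qed

lemma lm_lie_mod:
  assumes "x \<in> gt r" "y \<in> gt r" "br r x y \<in> gt r" "F \<in> words r m"
  shows "lm x (lm y F) - lm y (lm x F) - lm (br r x y) F \<in> Kw r m"
proof (rule relation_on_words [OF _ _ _ assms(4)])
  show "tens.endo (\<lambda>F. lm x (lm y F) - lm y (lm x F) - lm (br r x y) F)"
    by (rule tens.endoI) (simp_all add: tens.endo_add [OF endo_lm] tens.endo_scale [OF endo_lm] tens.scale_right_diff_distrib)
  show "lm x (lm y (tmono v)) - lm y (lm x (tmono v)) - lm (br r x y) (tmono v) \<in> Kw r m" if "v \<in> lists (gt r)" for v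
    using Kw.lie [OF assms(1,2), of "[]" v m] that by (simp add: relator_expand lm_tmono)
  show "lm x (lm y F) - lm y (lm x F) - lm (br r x y) F \<in> Kw r m" if "F \<in> Kw r m" for F
    using assms that by (intro tens.subspace_diff [OF subspace_Kw] lm_Kw)
qed

section \<open>Trace-zero currents and projected matrix units\<close>

lemma gtI:
  assumes "\<And>k a b. N \<le> k \<Longrightarrow> x k a b = 0" "\<And>k a b. x k a b \<noteq> 0 \<Longrightarrow> a \<in> {1..r+1} \<and> b \<in> {1..r+1}"
    "\<And>k. (\<Sum>a\<in>{1..r+1}. x k a a) = 0"
  shows "x \<in> gt r"
  using assms unfolding gt_def by blast

lemma gtD:
  assumes "x \<in> gt r"
  shows "\<exists>N. \<forall>k\<ge>N. \<forall>a b. x k a b = 0" "x k a b \<noteq> 0 \<Longrightarrow> a \<in> {1..r+1} \<and> b \<in> {1..r+1}"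
    "(\<Sum>a\<in>{1..r+1}. x k a a) = 0"
  using assms unfolding gt_def by blast+

lemma gt_add:
  assumes x: "x \<in> gt r" and y: "y \<in> gt r"
  shows "x + y \<in> gt r"
proof -
  obtain N N' where N: "\<forall>k\<ge>N. \<forall>a b. x k a b = 0" "\<forall>k\<ge>N'. \<forall>a b. y k a b = 0"
    using gtD(1) [OF x] gtD(1) [OF y] by blast
  show ?thesis
  proof (rule gtI [of "max N N'"])
    show "(x + y) k a b = 0" if "max N N' \<le> k" for k a b
      using N that by simp
    show "a \<in> {1..r+1} \<and> b \<in> {1..r+1}" if "(x + y) k a b \<noteq> 0" for k a b
    proof -
      have "x k a b \<noteq> 0 \<or> y k a b \<noteq> 0" using that by auto
      then show ?thesis using gtD(2) [OF x] gtD(2) [OF y] by blast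
    qed
    show "(\<Sum>a\<in>{1..r+1}. (x + y) k a a) = 0" for k
      using gtD(3) [OF x, of k] gtD(3) [OF y, of k] by (simp only: plus_fun_apply sum.distrib) simp
  qed
qed

lemma gt_scale:
  assumes x: "x \<in> gt r"
  shows "cscale c x \<in> gt r"
proof -
  obtain N where N: "\<forall>k\<ge>N. \<forall>a b. x k a b = 0"
    using gtD(1) [OF x] by blast
  show ?thesis
  proof (rule gtI [of N])
    show "a \<in> {1..r+1} \<and> b \<in> {1..r+1}" if "c * x k a b \<noteq> 0" for k a b
      using gtD(2) [OF x, of k a b] that by simp
    show "(\<Sum>a\<in>{1..r+1}. c * x k a a) = 0" for k
      using gtD(3) [OF x, of k] by (simp only: sum_distrib_left [symmetric]) simp
  qed (use N in simp)
qed

lemma lm_sum_mod: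
  assumes "finite I" "\<And>i. i \<in> I \<Longrightarrow> x i \<in> gt r" and F: "F \<in> words r m"
  shows "(\<lambda>k a b. \<Sum>i\<in>I. c i * x i k a b) \<in> gt r
    \<and> lm (\<lambda>k a b. \<Sum>i\<in>I. c i * x i k a b) F - (\<Sum>i\<in>I. smul (c i) (lm (x i) F)) \<in> Kw r m"
  using assms(1,2)
proof (induction I)
  case empty
  have 0: "(\<lambda>k a b. 0) \<in> gt r" by (simp add: gt_def)
  then show ?case
    using lm_scale_mod [OF 0 _ F, of 0] by simp
next
  case (insert i I)
  let ?s = "\<lambda>I k a b. \<Sum>i\<in>I. c i * x i k a b"
  have s: "?s (insert i I) = cscale (c i) (x i) + ?s I"
    using insert.hyps by (auto simp: fun_eq_iff)
  have xi: "x i \<in> gt r" "cscale (c i) (x i) \<in> gt r"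
    using insert.prems by (simp_all add: gt_scale)
  have sI: "?s I \<in> gt r" and IH: "lm (?s I) F - (\<Sum>i\<in>I. smul (c i) (lm (x i) F)) \<in> Kw r m"
    using insert.IH [OF insert.prems] by blast+
  have "lm (?s (insert i I)) F - (\<Sum>i\<in>insert i I. smul (c i) (lm (x i) F))
      = (lm (cscale (c i) (x i) + ?s I) F - lm (cscale (c i) (x i)) F - lm (?s I) F)
        + (lm (cscale (c i) (x i)) F - smul (c i) (lm (x i) F)) + (lm (?s I) F - (\<Sum>i\<in>I. smul (c i) (lm (x i) F)))"
    unfolding s using insert.hyps by simp
  also have "\<dots> \<in> Kw r m"
    using xi sI IH F by (intro tens.subspace_add [OF subspace_Kw] lm_add_mod lm_scale_mod gt_add)
  finally show ?case
    unfolding s using gt_add [OF xi(2) sI] by blast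
qed

text \<open>The matrix unit \<open>E\<^bsub>a,b\<^esub> \<otimes> t\<^sup>k\<close> projected to trace zero, so that the full algebra \<open>gl\<^bsub>r+1\<^esub>[t]\<close>
  acts on the Weyl module, with \<open>1 \<otimes> t\<^sup>k\<close> acting by zero.\<close>
definition eps :: "nat \<Rightarrow> nat \<Rightarrow> nat \<Rightarrow> nat \<Rightarrow> cur" where
  "eps r a b k = (\<lambda>k' x y. (if k' = k \<and> x = a \<and> y = b then 1 else 0)
     - (if a = b \<and> k' = k \<and> x = y \<and> x \<in> {1..r+1} then 1 / of_nat (r + 1) else 0))"

lemma eps_gt:
  assumes "a \<in> {1..r+1}" "b \<in> {1..r+1}"
  shows "eps r a b k \<in> gt r"
proof -
  have "(\<Sum>x\<in>{1..r+1}. eps r a b k k' x x) = 0" for k'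
  proof -
    have "(\<Sum>x\<in>{1..r+1}. eps r a b k k' x x)
        = (\<Sum>x\<in>{1..r+1}. (if x = a then if k' = k \<and> a = b then 1 else 0 else 0) - (if a = b \<and> k' = k then 1 / of_nat (r + 1) else 0))"
      by (intro sum.cong) (auto simp: eps_def)
    also have "\<dots> = 0"
      using assms unfolding sum_subtractf sum.delta' [OF finite_atLeastAtMost] sum.delta [OF finite_atLeastAtMost]
      by (simp del: of_nat_Suc of_nat_add)
    finally show ?thesis .
  qed
  moreover have "\<forall>k'\<ge>Suc k. \<forall>x y. eps r a b k k' x y = 0"
    by (simp add: eps_def)
  moreover have "\<forall>k' x y. eps r a b k k' x y \<noteq> 0 \<longrightarrow> x \<in> {1..r+1} \<and> y \<in> {1..r+1}"
    using assms by (auto simp: eps_def split: if_splits)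
  ultimately show ?thesis unfolding gt_def by blast
qed

lemma xminus_eps: "i \<noteq> j + 1 \<Longrightarrow> xminus i j k = eps r (j + 1) i k"
  by (auto simp: xminus_def eps_def fun_eq_iff)

definition unit_cur :: "nat \<Rightarrow> nat \<Rightarrow> nat \<Rightarrow> cur" where
  "unit_cur a b k = (\<lambda>k' x y. if k' = k \<and> x = a \<and> y = b then 1 else 0)"

definition id_cur :: "nat \<Rightarrow> nat \<Rightarrow> cur" where
  "id_cur r k = (\<lambda>k' x y. if k' = k \<and> x = y \<and> x \<in> {1..r+1} then 1 else 0)"

lemma eps_unit: "eps r a b k = unit_cur a b k - cscale (if a = b then 1 / of_nat (r + 1) else 0) (id_cur r k)"
  by (auto simp: eps_def unit_cur_def id_cur_def fun_eq_iff)

lemma br_diff_left: "br r (x - cscale c y) z = br r x z - cscale c (br r y z)"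
  by (simp add: br_def fun_eq_iff left_diff_distrib right_diff_distrib sum_subtractf sum_distrib_left algebra_simps
    flip: sum.distrib del: sum.cl_ivl_Suc)

lemma br_antisym: "br r x y k a b = - br r y x k a b"
  by (simp add: br_def flip: sum_negf)

lemma sum_unit_unit:
  assumes "b \<in> {1..r+1}"
  shows "(\<Sum>i\<in>{0..k0}. \<Sum>e\<in>{1..r+1}. unit_cur a b k i x e * unit_cur c d l (k0 - i) e y)
    = (if b = c then unit_cur a d (k + l) k0 x y else 0)"
proof -
  have "(\<Sum>e\<in>{1..r+1}. unit_cur a b k i x e * unit_cur c d l (k0 - i) e y)
      = (if i = k then if x = a \<and> b = c \<and> k0 - k = l \<and> y = d then 1 else 0 else 0)" for i
  proof -
    have "(\<Sum>e\<in>{1..r+1}. unit_cur a b k i x e * unit_cur c d l (k0 - i) e y)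
        = (\<Sum>e\<in>{1..r+1}. if e = b then if i = k \<and> x = a \<and> b = c \<and> k0 - k = l \<and> y = d then 1 else 0 else 0)"
      by (intro sum.cong) (auto simp: unit_cur_def)
    then show ?thesis
      using assms by (simp only: sum.delta finite_atLeastAtMost) simp
  qed
  then have "(\<Sum>i\<in>{0..k0}. \<Sum>e\<in>{1..r+1}. unit_cur a b k i x e * unit_cur c d l (k0 - i) e y)
      = (if k \<le> k0 then if x = a \<and> b = c \<and> k0 - k = l \<and> y = d then 1 else 0 else 0)"
    by (simp only: sum.delta finite_atLeastAtMost) simp
  then show ?thesis by (auto simp: unit_cur_def)
qed

lemma br_unit:
  assumes "b \<in> {1..r+1}" "d \<in> {1..r+1}"
  shows "br r (unit_cur a b k) (unit_cur c d l)
    = (if b = c then unit_cur a d (k + l) else 0) - (if d = a then unit_cur c b (k + l) else 0)"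
proof (intro ext)
  fix k0 x y
  show "br r (unit_cur a b k) (unit_cur c d l) k0 x y
    = ((if b = c then unit_cur a d (k + l) else 0) - (if d = a then unit_cur c b (k + l) else 0)) k0 x y"
    unfolding br_def sum_subtractf sum_unit_unit [OF assms(1)] sum_unit_unit [OF assms(2)] by (simp add: add.commute)
qed

lemma br_id:
  assumes Y: "\<And>k a b. Y k a b \<noteq> 0 \<Longrightarrow> a \<in> {1..r+1} \<and> b \<in> {1..r+1}"
  shows "br r (id_cur r k) Y = 0"
proof (intro ext)
  fix k0 x y
  have 1: "(\<Sum>i\<in>{0..k0}. \<Sum>e\<in>{1..r+1}. id_cur r k i x e * Y (k0 - i) e y) = (if k \<le> k0 then Y (k0 - k) x y else 0)"
  proof -
    have "(\<Sum>e\<in>{1..r+1}. id_cur r k i x e * Y (k0 - i) e y) = (if i = k then Y (k0 - k) x y else 0)" for i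
    proof -
      have "(\<Sum>e\<in>{1..r+1}. id_cur r k i x e * Y (k0 - i) e y)
          = (\<Sum>e\<in>{1..r+1}. if e = x then if i = k then Y (k0 - k) x y else 0 else 0)"
        by (intro sum.cong) (auto simp: id_cur_def)
      then show ?thesis
        using Y [of "k0 - k" x y] by (simp only: sum.delta finite_atLeastAtMost) auto
    qed
    then show ?thesis by (simp only: sum.delta finite_atLeastAtMost) simp
  qed
  have 2: "(\<Sum>i\<in>{0..k0}. \<Sum>e\<in>{1..r+1}. Y i x e * id_cur r k (k0 - i) e y) = (if k \<le> k0 then Y (k0 - k) x y else 0)"
  proof -
    have "(\<Sum>e\<in>{1..r+1}. Y i x e * id_cur r k (k0 - i) e y) = (if i = k0 - k then if k \<le> k0 then Y (k0 - k) x y else 0 else 0)"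
      if "i \<in> {0..k0}" for i
    proof -
      have "(\<Sum>e\<in>{1..r+1}. Y i x e * id_cur r k (k0 - i) e y)
          = (\<Sum>e\<in>{1..r+1}. if e = y then if i = k0 - k \<and> k \<le> k0 then Y (k0 - k) x y else 0 else 0)"
        using that by (intro sum.cong) (auto simp: id_cur_def)
      then show ?thesis
        using Y [of "k0 - k" x y] by (simp only: sum.delta finite_atLeastAtMost) auto
    qed
    then have "(\<Sum>i\<in>{0..k0}. \<Sum>e\<in>{1..r+1}. Y i x e * id_cur r k (k0 - i) e y)
        = (\<Sum>i\<in>{0..k0}. if i = k0 - k then if k \<le> k0 then Y (k0 - k) x y else 0 else 0)"
      by (rule sum.cong [OF refl])
    then show ?thesis by (simp only: sum.delta finite_atLeastAtMost) simp
  qed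
  show "br r (id_cur r k) Y k0 x y = 0 k0 x y"
    unfolding br_def sum_subtractf 1 2 by simp
qed

text \<open>The identity currents are central and do not contribute on the left. On the right they
  occur only if a = d and b = c, and then twice with opposite signs.\<close>

lemma br_eps:
  assumes "a \<in> {1..r+1}" "b \<in> {1..r+1}" "c \<in> {1..r+1}" "d \<in> {1..r+1}"
  shows "br r (eps r a b k) (eps r c d l)
    = (if b = c then eps r a d (k + l) else 0) - (if d = a then eps r c b (k + l) else 0)"
proof -
  have id: "br r (id_cur r k) (eps r c d l) = 0"
    by (rule br_id) (rule gtD(2) [OF eps_gt [OF assms(3,4)]])
  have "br r (id_cur r l) (unit_cur a b k) = 0"
    by (rule br_id) (use assms in \<open>auto simp: unit_cur_def split: if_splits\<close>)
  then have id': "br r (eps r c d l) (unit_cur a b k) = br r (unit_cur c d l) (unit_cur a b k)"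
    unfolding eps_unit [of r c d l] br_diff_left by (simp add: fun_eq_iff)
  have "br r (eps r a b k) (eps r c d l) = br r (unit_cur a b k) (eps r c d l)"
    unfolding eps_unit [of r a b k] br_diff_left id by (simp add: fun_eq_iff)
  also have "\<dots> = br r (unit_cur a b k) (unit_cur c d l)"
    using id' by (simp add: fun_eq_iff br_antisym [of r "unit_cur a b k"])
  also have "\<dots> = (if b = c then eps r a d (k + l) else 0) - (if d = a then eps r c b (k + l) else 0)"
    unfolding br_unit [OF assms(2,4)] eps_unit by (auto simp: fun_eq_iff)
  finally show ?thesis .
qed

definition ET :: "nat \<Rightarrow> nat \<Rightarrow> nat \<Rightarrow> nat \<Rightarrow> tens \<Rightarrow> tens" where
  "ET r a b k = lm (eps r a b k)"

lemma ET_comm_mod: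
  assumes ab: "a \<in> {1..Suc r}" "b \<in> {1..Suc r}" and cd: "c \<in> {1..Suc r}" "d \<in> {1..Suc r}" and F: "F \<in> words r m"
  shows "ET r a b k (ET r c d l F) - (ET r c d l (ET r a b k F)
      + (if b = c then ET r a d (k + l) F else 0) - (if d = a then ET r c b (k + l) F else 0)) \<in> Kw r m"
proof -
  let ?x = "eps r a b k" and ?y = "eps r c d l"
  let ?z = "\<lambda>i. if i then eps r a d (k + l) else eps r c b (k + l)"
  let ?c = "\<lambda>i. if i then (if b = c then 1 else 0) else (if d = a then - 1 else 0) :: complex"
  have gt: "?x \<in> gt r" "?y \<in> gt r" "?z i \<in> gt r" for i
    using ab cd by (auto intro!: eps_gt)
  have br: "br r ?x ?y = (\<lambda>k a b. \<Sum>i\<in>UNIV. ?c i * ?z i k a b)"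
    using br_eps [of a r b c d k l] ab cd by (auto simp: UNIV_bool fun_eq_iff)
  have sum: "br r ?x ?y \<in> gt r" "lm (br r ?x ?y) F - (\<Sum>i\<in>UNIV. smul (?c i) (lm (?z i) F)) \<in> Kw r m"
    using lm_sum_mod [where I = UNIV and c = ?c and x = ?z, OF finite gt(3) F] unfolding br by blast+
  have "ET r a b k (ET r c d l F) - (ET r c d l (ET r a b k F)
      + (if b = c then ET r a d (k + l) F else 0) - (if d = a then ET r c b (k + l) F else 0))
    = (lm ?x (lm ?y F) - lm ?y (lm ?x F) - lm (br r ?x ?y) F) + (lm (br r ?x ?y) F - (\<Sum>i\<in>UNIV. smul (?c i) (lm (?z i) F)))"
    by (auto simp: ET_def UNIV_bool tens.scale_minus_left)
  also have "\<dots> \<in> Kw r m"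
    by (rule tens.subspace_add [OF subspace_Kw lm_lie_mod [OF gt(1,2) sum(1) F] sum(2)])
  finally show ?thesis .
qed

text \<open>The identity corrections in \<open>eps\<close> add up to multiples of the traces of the
  coefficients of \<open>x\<close>, which are 0.\<close>

lemma cur_expand:
  assumes x: "x \<in> gt r" and N: "\<forall>k\<ge>N. \<forall>a b. x k a b = 0"
  shows "x = (\<lambda>k' a' b'. \<Sum>(k, a, b)\<in>{..<N} \<times> {1..r+1} \<times> {1..r+1}. x k a b * eps r a b k k' a' b')"
proof (intro ext)
  fix k' a' b'
  let ?I = "{1..r+1}"
  let ?J = "{..<N} \<times> ?I \<times> ?I"
  have "(\<Sum>(k, a, b)\<in>?J. x k a b * eps r a b k k' a' b')
      = (\<Sum>(k, a, b)\<in>?J. x k a b * unit_cur a b k k' a' b')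
        - (\<Sum>(k, a, b)\<in>?J. if a = b then x k a b * id_cur r k k' a' b' / of_nat (r + 1) else 0)"
    unfolding sum_subtractf [symmetric] by (intro sum.cong) (auto simp: eps_unit algebra_simps)
  also have "(\<Sum>(k, a, b)\<in>?J. if a = b then x k a b * id_cur r k k' a' b' / of_nat (r + 1) else 0) = 0"
  proof -
    have "(\<Sum>(k, a, b)\<in>?J. if a = b then x k a b * id_cur r k k' a' b' / of_nat (r + 1) else 0)
        = (\<Sum>k<N. \<Sum>a\<in>?I. \<Sum>b\<in>?I. if b = a then x k a a * id_cur r k k' a' b' / of_nat (r + 1) else 0)"
      by (simp only: sum.cartesian_product [symmetric]) (auto intro!: sum.cong)
    also have "\<dots> = (\<Sum>k<N. (\<Sum>a\<in>?I. x k a a) * id_cur r k k' a' b' / of_nat (r + 1))"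
      by (simp only: sum.delta finite_atLeastAtMost if_True sum_distrib_right sum_divide_distrib) simp
    also have "\<dots> = 0"
      by (simp only: gtD(3) [OF x]) simp
    finally show ?thesis .
  qed
  also have "(\<Sum>(k, a, b)\<in>?J. x k a b * unit_cur a b k k' a' b') = (\<Sum>j\<in>?J. if j = (k', a', b') then x k' a' b' else 0)"
    by (intro sum.cong) (auto simp: unit_cur_def split: if_splits)
  also have "\<dots> = x k' a' b'"
  proof (cases "(k', a', b') \<in> ?J")
    case True
    then show ?thesis by (simp only: sum.delta finite_cartesian_product finite_lessThan finite_atLeastAtMost) simp
  next
    case False
    then have "k' \<ge> N \<or> \<not> (a' \<in> ?I \<and> b' \<in> ?I)" by auto
    then have "x k' a' b' = 0"
      using N gtD(2) [OF x, of k' a' b'] by blast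
    then show ?thesis by simp
  qed
  finally show "x k' a' b' = (\<Sum>(k, a, b)\<in>?J. x k a b * eps r a b k k' a' b')" by simp
qed

lemma stable_ET: "tens.stable (Suc r) (ET r) (Kw r m)" "tens.stable (Suc r) (ET r) (words r m)"
  unfolding tens.stable_def ET_def by (auto intro!: lm_Kw lm_words eps_gt)

lemma tmono_spanned_by_letters:
  "u \<in> lists (gt r) \<Longrightarrow> tmono u \<in> tens.span ((\<lambda>e. act (ET r) e (tmono [])) ` {e. set e \<subseteq> letters (Suc r)} \<union> Kw r m)"
proof (induction u rule: list.induct)
  case Nil
  show ?case
    by (rule tens.span_base) (auto intro!: image_eqI [of _ _ "[]"])
next
  case (Cons x u)
  let ?U = "(\<lambda>e. act (ET r) e (tmono [])) ` {e. set e \<subseteq> letters (Suc r)}"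
  let ?Z = "tens.span (?U \<union> Kw r m)"
  have x: "x \<in> gt r" and u: "u \<in> lists (gt r)" using Cons.prems by auto
  obtain N where N: "\<forall>k\<ge>N. \<forall>a b. x k a b = 0" using gtD(1) [OF x] by blast
  let ?J = "{..<N} \<times> {1..r+1} \<times> {1..r+1}"
  let ?c = "\<lambda>(k, a, b). x k a b" and ?e = "\<lambda>(k, a, b). eps r a b k"
  have x_eq: "x = (\<lambda>k a b. \<Sum>j\<in>?J. ?c j * ?e j k a b)"
    by (rule trans [OF cur_expand [OF x N]]) (simp only: case_prod_unfold)
  have e: "?e j \<in> gt r" if "j \<in> ?J" for j
    using that by (auto intro!: eps_gt)
  have fin: "finite ?J" by simp
  have step: "lm (?e j) v \<in> ?Z" if j: "j \<in> ?J" and v: "v \<in> ?Z" for j v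
  proof (rule tens.endo_span [OF endo_lm _ tens.subspace_span v])
    obtain k a b where jj: "j = (k, a, b)" by (cases j)
    fix w assume "w \<in> ?U \<union> Kw r m"
    then show "lm (?e j) w \<in> ?Z"
    proof
      assume "w \<in> ?U"
      then obtain e where e: "w = act (ET r) e (tmono [])" "set e \<subseteq> letters (Suc r)" by blast
      have "lm (?e j) w = act (ET r) ((a, b, k) # e) (tmono [])"
        by (simp add: e jj ET_def)
      moreover have "set ((a, b, k) # e) \<subseteq> letters (Suc r)"
        using e j jj by (auto simp: letters_def)
      ultimately show ?thesis by (intro tens.span_base) blast
    next
      assume "w \<in> Kw r m"
      then show ?thesis using lm_Kw [OF e [OF j]] by (intro tens.span_base) blast
    qed
  qed
  have "lm x (tmono u) - (\<Sum>j\<in>?J. smul (?c j) (lm (?e j) (tmono u))) \<in> Kw r m"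
    using lm_sum_mod [where I = ?J and c = ?c and x = ?e, OF fin e tmono_words [OF u]] unfolding x_eq [symmetric] by blast
  moreover have "(\<Sum>j\<in>?J. smul (?c j) (lm (?e j) (tmono u))) \<in> ?Z"
    by (intro tens.span_sum tens.span_scale step Cons.IH u)
  ultimately have "(lm x (tmono u) - (\<Sum>j\<in>?J. smul (?c j) (lm (?e j) (tmono u)))) + (\<Sum>j\<in>?J. smul (?c j) (lm (?e j) (tmono u))) \<in> ?Z"
    by (intro tens.span_add [OF tens.span_base]) blast+
  then show ?case by (simp add: lm_tmono)
qed

lemma ET_tmono_Nil: "ET r a b k (tmono []) = tmono [eps r a b k]"
  by (simp add: ET_def lm_tmono)

lemma weyl_rel_Kw: "R \<in> weyl_rel r m \<Longrightarrow> R \<in> Kw r m"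
  using Kw.weyl [of R r m "[]"] by (simp add: tmul_Nil)

lemma lam_eps:
  assumes "1 \<le> a"
  shows "lam r m (eps r a a 0) = (\<Sum>i\<in>{1..r}. of_nat (m i) * ((if a \<le> i then 1 else 0) - of_nat i / of_nat (r + 1)))"
  unfolding lam_def
proof (intro sum.cong refl arg_cong2 [where f = "(*)"])
  fix i assume i: "i \<in> {1..r}"
  have "(\<Sum>j\<in>{1..i}. eps r a a 0 0 j j) = (\<Sum>j\<in>{1..i}. (if j = a then 1 else 0) - 1 / of_nat (r + 1))"
    using i by (intro sum.cong) (auto simp: eps_def)
  also have "\<dots> = (if a \<le> i then 1 else 0) - of_nat i / of_nat (r + 1)"
    unfolding sum_subtractf sum.delta [OF finite_atLeastAtMost] using assms by simp
  finally show "(\<Sum>j\<in>{1..i}. eps r a a 0 0 j j) = (if a \<le> i then 1 else 0) - of_nat i / of_nat (r + 1)" .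
qed

text \<open>The corrections i / (r + 1) from the projection to trace zero do not depend on a and
  cancel.\<close>

lemma lam_eps_diff:
  assumes "1 \<le> a" "a \<le> r"
  shows "lam r m (eps r a a 0) - lam r m (eps r (Suc a) (Suc a) 0) = of_nat (m a)"
proof -
  have "lam r m (eps r a a 0) - lam r m (eps r (Suc a) (Suc a) 0) = (\<Sum>i\<in>{1..r}. if i = a then of_nat (m i) else 0)"
    unfolding lam_eps [OF assms(1)] lam_eps [OF le_SucI [OF assms(1)]] sum_subtractf [symmetric]
    by (intro sum.cong) (auto simp: algebra_simps)
  also have "\<dots> = of_nat (m a)"
    unfolding sum.delta [OF finite_atLeastAtMost] using assms by simp
  finally show ?thesis .
qed

lemma weyl_vector_ET: "tens.weyl_vector (Suc r) m (ET r) (Kw r m) (tmono [])"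
  unfolding tens.weyl_vector_def
proof (intro conjI allI impI exI [of _ "\<lambda>a. lam r m (eps r a a 0)"])
  fix a b k assume *: "1 \<le> a \<and> a < b \<and> b \<le> Suc r"
  have gt: "eps r a b k \<in> gt r" by (rule eps_gt) (use * in auto)
  then have "eps r a b k \<in> nplus_t r"
    using * unfolding nplus_t_def by (auto simp: eps_def split: if_splits)
  then show "ET r a b k (tmono []) \<in> Kw r m"
    unfolding ET_tmono_Nil by (intro weyl_rel_Kw) (auto simp: weyl_rel_def)
next
  fix a k assume *: "1 \<le> a \<and> a \<le> Suc r \<and> 0 < (k::nat)"
  have gt: "eps r a a k \<in> gt r" by (rule eps_gt) (use * in auto)
  have "eps r a a k \<in> h_t_pos r"
    unfolding h_t_pos_def mem_Collect_eq
  proof (intro conjI gt allI impI)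
    show "x = y" if "eps r a a k k' x y \<noteq> 0" for k' x y
      using that by (auto simp: eps_def split: if_splits)
    show "eps r a a k 0 x y = 0" for x y
      using * by (auto simp: eps_def)
  qed
  then show "ET r a a k (tmono []) \<in> Kw r m"
    unfolding ET_tmono_Nil by (intro weyl_rel_Kw) (auto simp: weyl_rel_def)
next
  fix a assume *: "1 \<le> a \<and> a \<le> Suc r"
  have gt: "eps r a a 0 \<in> gt r" by (rule eps_gt) (use * in auto)
  have "eps r a a 0 \<in> h0 r"
    unfolding h0_def mem_Collect_eq
  proof (intro conjI gt allI impI)
    show "x = y" "k' = 0" if "eps r a a 0 k' x y \<noteq> 0" for k' x y
      using that by (auto simp: eps_def split: if_splits)
  qed
  then show "ET r a a 0 (tmono []) - smul (lam r m (eps r a a 0)) (tmono []) \<in> Kw r m"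
    unfolding ET_tmono_Nil by (intro weyl_rel_Kw) (auto simp: weyl_rel_def)
next
  fix i assume "1 \<le> i \<and> i < Suc r"
  then show "lam r m (eps r i i 0) - lam r m (eps r (Suc i) (Suc i) 0) = of_nat (m i)"
    by (intro lam_eps_diff) auto
next
  fix i assume *: "1 \<le> i \<and> i < Suc r"
  have "(ET r (Suc i) i 0 ^^ n) (tmono []) = tmono (replicate n (eps r (Suc i) i 0))" for n
    by (induction n) (simp_all add: ET_def lm_tmono)
  moreover have "eps r (Suc i) i 0 = xminus i i 0"
    using xminus_eps [of i i 0 r] by simp
  ultimately have "(ET r (Suc i) i 0 ^^ Suc (m i)) (tmono []) = tmono (replicate (m i + 1) (xminus i i 0))"
    by (simp only: Suc_eq_plus1)
  moreover have "tmono (replicate (m i + 1) (xminus i i 0)) \<in> weyl_rel r m"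
    using * unfolding weyl_rel_def by (intro UnI2 CollectI exI [of _ i]) simp
  ultimately show "(ET r (Suc i) i 0 ^^ Suc (m i)) (tmono []) \<in> Kw r m"
    using weyl_rel_Kw by simp
qed

definition cur_word :: "(nat \<times> nat \<times> nat) list \<Rightarrow> cur list" where
  "cur_word = map (\<lambda>(a, b, k). xminus b (a - 1) k)"

lemma bword_conv: "bword r S = cur_word (lower_word r S)"
  unfolding bword_def lower_word_def cur_word_def by (simp add: map_concat o_def)

lemma Bset_conv: "Bset r m = cur_word ` {lower_word r S |S. admissible r m S}"
  unfolding Bset_def admissible_def bword_conv by blast

lemma act_ET_lower_word: "act (ET r) (lower_word r S) (tmono []) = tmono (bword r S)"
proof -
  have "(\<And>a b k. (a, b, k) \<in> set e \<Longrightarrow> 1 \<le> b \<and> b < a) \<Longrightarrow> act (ET r) e (tmono []) = tmono (cur_word e)" for e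
  proof (induction e)
    case (Cons x e)
    obtain a b k where x: "x = (a, b, k)" by (cases x)
    have ab: "1 \<le> b" "b < a" using Cons.prems [of a b k] x by auto
    have "xminus b (a - 1) k = eps r a b k"
      using xminus_eps [of b "a - 1" k r] ab by simp
    moreover have IH: "act (ET r) e (tmono []) = tmono (cur_word e)"
      by (rule Cons.IH) (metis Cons.prems list.set_intros(2))
    ultimately show ?case
      unfolding x act_Cons IH unfolding ET_def lm_tmono by (simp add: cur_word_def)
  qed (simp add: cur_word_def)
  moreover have "1 \<le> b \<and> b < a" if "(a, b, k) \<in> set (lower_word r S)" for a b k
    using that by (auto simp: lower_word_def)
  ultimately show ?thesis by (simp add: bword_conv)
qed

text \<open>The free algebra is a current module only on \<open>words\<close> and modulo
  \<open>Kw\<close>, so \<open>weyl_module_spanning\<close> is applied to the projected operators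
  with zero subspace and the result is pulled back.\<close>

theorem tmono_spanned_by_Bset:
  assumes u: "u \<in> lists (gt r)"
  shows "tmono u \<in> tens.span (tmono ` Bset r m \<union> Kw r m)"
proof -
  have subC: "tens.subspace (words r m)" by (simp add: words_def)
  obtain \<pi> where \<pi>: "tens.endo \<pi>" "\<And>v. v \<in> Kw r m \<Longrightarrow> \<pi> v = 0" "\<And>v. \<pi> v \<in> words r m"
      "\<And>v. v \<in> words r m \<Longrightarrow> v - \<pi> v \<in> Kw r m"
    using tens.quotient_projection [OF subspace_Kw subC Kw_words] by blast
  have endo_ET: "tens.endo (ET r a b k)" for a b k
    unfolding ET_def by (rule endo_lm)
  note quot = endo_ET stable_ET ET_comm_mod \<pi>
  have one: "tmono [] \<in> words r m" by (rule tmono_words) simp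
  let ?E = "\<lambda>a b k v. \<pi> (ET r a b k (\<pi> v))"
  let ?U = "{lower_word r S |S. admissible r m S}"
  have "act (ET r) e (tmono []) \<in> tens.span ((\<lambda>u'. act (ET r) u' (tmono [])) ` ?U \<union> Kw r m)" if e: "set e \<subseteq> letters (Suc r)" for e
  proof (rule tens.span_quot [OF quot one subC subspace_Kw e])
    show "set u' \<subseteq> letters (Suc r)" if "u' \<in> ?U" for u'
      using that lower_word_letters by blast
    have "act ?E e (\<pi> (tmono [])) \<in> tens.span ({act ?E (lower_word r S) (\<pi> (tmono [])) |S. admissible r m S} \<union> {0})"
    proof (rule tens.weyl_module_spanning [OF tens.quotient_module [OF quot] tens.subspace_single_0 _ tens.weyl_vector_quot [OF quot one weyl_vector_ET] e])
      show "tens.stable (Suc r) ?E {0}"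
        by (simp add: tens.stable_def tens.endo_0 [OF \<pi>(1)] tens.endo_0 [OF endo_ET])
    qed
    also have "{act ?E (lower_word r S) (\<pi> (tmono [])) |S. admissible r m S} \<union> {0}
        = insert 0 ((\<lambda>u'. act ?E u' (\<pi> (tmono []))) ` ?U)"
      by auto
    finally show "act ?E e (\<pi> (tmono [])) \<in> tens.span ((\<lambda>u'. act ?E u' (\<pi> (tmono []))) ` ?U)"
      by simp
  qed
  moreover have "(\<lambda>u'. act (ET r) u' (tmono [])) ` ?U = tmono ` Bset r m"
    unfolding Bset_conv image_image by (rule image_cong [OF refl]) (auto simp: act_ET_lower_word bword_conv)
  ultimately have "(\<lambda>e. act (ET r) e (tmono [])) ` {e. set e \<subseteq> letters (Suc r)} \<union> Kw r m
      \<subseteq> tens.span (tmono ` Bset r m \<union> Kw r m)"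
    by (auto intro: tens.span_base)
  then show ?thesis
    using tmono_spanned_by_letters [OF u, of m] tens.span_minimal [OF _ tens.subspace_span] by blast
qed

section \<open>The graded Fock module\<close>

type_synonym graded = "nat \<Rightarrow> fock"

definition gscale :: "complex \<Rightarrow> graded \<Rightarrow> graded" where
  "gscale c f = (\<lambda>d. fscale c (f d))"

interpretation graded: vector_space_char_0 gscale
  by unfold_locales (simp_all add: gscale_def fun_eq_iff fscale_def algebra_simps)

text \<open>The degree \<open>k\<close> part of a current raises the degree by \<open>k\<close>.\<close>
definition cact :: "nat \<Rightarrow> nat \<Rightarrow> cur \<Rightarrow> graded \<Rightarrow> graded" where
  "cact N r x f = (\<lambda>d. \<Sum>k\<le>d. \<Sum>a\<in>{1..r+1}. \<Sum>b\<in>{1..r+1}. fscale (x k a b) (EF N a b k (f (d - k))))"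

lemma endo_cact: "graded.endo (cact N r x)"
  by (rule graded.endoI)
    (simp_all add: cact_def gscale_def fock.endo_add [OF endo_EF] fock.endo_scale [OF endo_EF] fock.scale_right_distrib
      sum.distrib fock.scale_sum_right fock.scale_left_commute mult.commute fun_eq_iff del: sum.cl_ivl_Suc)

lemma cact_add: "cact N r (x + y) f = cact N r x f + cact N r y f"
  by (rule ext) (simp add: cact_def fock.scale_left_distrib sum.distrib del: sum.cl_ivl_Suc)

lemma cact_scale: "cact N r (cscale c x) f = gscale c (cact N r x f)"
  by (rule ext) (simp add: cact_def gscale_def fock.scale_sum_right del: sum.cl_ivl_Suc)

lemma sum_swap_3:
  "(\<Sum>a\<in>A. \<Sum>b\<in>A. \<Sum>c\<in>A. g a b c) = (\<Sum>c\<in>A. \<Sum>a\<in>A. \<Sum>b\<in>A. g a b c)"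
proof -
  have "(\<Sum>a\<in>A. \<Sum>b\<in>A. \<Sum>c\<in>A. g a b c) = (\<Sum>a\<in>A. \<Sum>c\<in>A. \<Sum>b\<in>A. g a b c)"
    by (intro sum.cong refl sum.swap)
  also have "\<dots> = (\<Sum>c\<in>A. \<Sum>a\<in>A. \<Sum>b\<in>A. g a b c)"
    by (rule sum.swap)
  finally show ?thesis .
qed

context
  fixes N r :: nat
begin

abbreviation idx :: "nat set" where
  "idx \<equiv> {1..r+1}"

text \<open>The contraction terms E_{a,b} E_{b,e} = E_{a,e} of the product of x and y; the
  commutator is the difference of two such sums.\<close>

definition half :: "cur \<Rightarrow> cur \<Rightarrow> graded \<Rightarrow> nat \<Rightarrow> fock" where
  "half x y f d = (\<Sum>i\<le>d. \<Sum>j\<le>d - i. \<Sum>a\<in>idx. \<Sum>b\<in>idx. \<Sum>e\<in>idx. fscale (x i a b * y j b e) (EF N a e (i + j) (f (d - i - j))))"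

lemma cact_cact:
  "cact N r x (cact N r y f) d = (\<Sum>i\<le>d. \<Sum>j\<le>d - i. \<Sum>a\<in>idx. \<Sum>b\<in>idx. \<Sum>c\<in>idx. \<Sum>e\<in>idx.
     fscale (x i a b * y j c e) (EF N a b i (EF N c e j (f (d - i - j)))))"
proof -
  have "cact N r x (cact N r y f) d = (\<Sum>i\<le>d. \<Sum>a\<in>idx. \<Sum>b\<in>idx. \<Sum>j\<le>d - i. \<Sum>c\<in>idx. \<Sum>e\<in>idx.
     fscale (x i a b * y j c e) (EF N a b i (EF N c e j (f (d - i - j)))))"
    by (simp only: cact_def fock.endo_sum [OF endo_EF] fock.endo_scale [OF endo_EF] fock.scale_sum_right fock.scale_scale)
  also have "\<dots> = (\<Sum>i\<le>d. \<Sum>a\<in>idx. \<Sum>j\<le>d - i. \<Sum>b\<in>idx. \<Sum>c\<in>idx. \<Sum>e\<in>idx.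
     fscale (x i a b * y j c e) (EF N a b i (EF N c e j (f (d - i - j)))))"
    by (intro sum.cong refl sum.swap)
  also have "\<dots> = (\<Sum>i\<le>d. \<Sum>j\<le>d - i. \<Sum>a\<in>idx. \<Sum>b\<in>idx. \<Sum>c\<in>idx. \<Sum>e\<in>idx.
     fscale (x i a b * y j c e) (EF N a b i (EF N c e j (f (d - i - j)))))"
    by (intro sum.cong refl sum.swap)
  finally show ?thesis .
qed

lemma cact_commutator: "cact N r x (cact N r y f) d - cact N r y (cact N r x f) d = half x y f d - half y x f d"
proof -
  let ?S = "\<lambda>F. \<Sum>i\<le>d. \<Sum>j\<le>d - i. \<Sum>a\<in>idx. \<Sum>b\<in>idx. \<Sum>c\<in>idx. \<Sum>e\<in>idx. F i j a b c e"
  let ?g = "\<lambda>i j. f (d - i - j)"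
  have "cact N r x (cact N r y f) d
      = ?S (\<lambda>i j a b c e. fscale (x i a b * y j c e) (EF N c e j (EF N a b i (?g i j)))
          + (if c = b then fscale (x i a b * y j b e) (EF N a e (i + j) (?g i j)) else 0)
          - (if e = a then fscale (y j c a * x i a b) (EF N c b (j + i) (?g i j)) else 0))"
    unfolding cact_cact
  proof (intro sum.cong refl)
    fix i j a b c e
    show "fscale (x i a b * y j c e) (EF N a b i (EF N c e j (?g i j)))
        = fscale (x i a b * y j c e) (EF N c e j (EF N a b i (?g i j)))
          + (if c = b then fscale (x i a b * y j b e) (EF N a e (i + j) (?g i j)) else 0)
          - (if e = a then fscale (y j c a * x i a b) (EF N c b (j + i) (?g i j)) else 0)"
      unfolding EF_comm [of N a b i c e j]
      by (auto simp: fock.scale_right_distrib fock.scale_right_diff_distrib mult.commute add.commute)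
  qed
  also have "\<dots> = ?S (\<lambda>i j a b c e. fscale (x i a b * y j c e) (EF N c e j (EF N a b i (?g i j))))
      + ?S (\<lambda>i j a b c e. if c = b then fscale (x i a b * y j b e) (EF N a e (i + j) (?g i j)) else 0)
      - ?S (\<lambda>i j a b c e. if e = a then fscale (y j c a * x i a b) (EF N c b (j + i) (?g i j)) else 0)"
    by (simp only: sum.distrib sum_subtractf)
  also have "?S (\<lambda>i j a b c e. if c = b then fscale (x i a b * y j b e) (EF N a e (i + j) (?g i j)) else 0) = half x y f d"
  proof -
    have *: "(\<Sum>c\<in>idx. \<Sum>e\<in>idx. if c = b then F e else 0) = (\<Sum>e\<in>idx. F e)" if "b \<in> idx" for b and F :: "nat \<Rightarrow> fock"
      using that by (subst sum.swap) (simp only: sum.delta finite_atLeastAtMost if_True)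
    show ?thesis
      unfolding half_def
      by (rule sum.cong [OF refl], rule sum.cong [OF refl], rule sum.cong [OF refl], rule sum.cong [OF refl], rule *)
  qed
  also have "?S (\<lambda>i j a b c e. if e = a then fscale (y j c a * x i a b) (EF N c b (j + i) (?g i j)) else 0) = half y x f d"
  proof -
    have "?S (\<lambda>i j a b c e. if e = a then fscale (y j c a * x i a b) (EF N c b (j + i) (?g i j)) else 0)
        = (\<Sum>i\<le>d. \<Sum>j\<le>d - i. \<Sum>a\<in>idx. \<Sum>b\<in>idx. \<Sum>c\<in>idx. fscale (y j c a * x i a b) (EF N c b (j + i) (?g i j)))"
      by (intro sum.cong refl) (simp only: sum.delta finite_atLeastAtMost if_True)
    also have "\<dots> = (\<Sum>i\<le>d. \<Sum>j\<le>d - i. \<Sum>c\<in>idx. \<Sum>a\<in>idx. \<Sum>b\<in>idx. fscale (y j c a * x i a b) (EF N c b (j + i) (?g i j)))"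
      by (intro sum.cong refl sum_swap_3)
    also have "\<dots> = (\<Sum>j\<le>d. \<Sum>i\<le>d - j. \<Sum>c\<in>idx. \<Sum>a\<in>idx. \<Sum>b\<in>idx. fscale (y j c a * x i a b) (EF N c b (j + i) (?g i j)))"
      by (rule sum_triangle_swap)
    also have "\<dots> = half y x f d"
      unfolding half_def by (intro sum.cong refl) (simp add: add.commute)
    finally show ?thesis .
  qed
  also have "?S (\<lambda>i j a b c e. fscale (x i a b * y j c e) (EF N c e j (EF N a b i (?g i j)))) = cact N r y (cact N r x f) d"
  proof -
    have "?S (\<lambda>i j a b c e. fscale (x i a b * y j c e) (EF N c e j (EF N a b i (?g i j))))
        = (\<Sum>j\<le>d. \<Sum>i\<le>d - j. \<Sum>a\<in>idx. \<Sum>b\<in>idx. \<Sum>c\<in>idx. \<Sum>e\<in>idx. fscale (x i a b * y j c e) (EF N c e j (EF N a b i (?g i j))))"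
      by (rule sum_triangle_swap)
    also have "\<dots> = (\<Sum>j\<le>d. \<Sum>i\<le>d - j. \<Sum>c\<in>idx. \<Sum>e\<in>idx. \<Sum>a\<in>idx. \<Sum>b\<in>idx. fscale (x i a b * y j c e) (EF N c e j (EF N a b i (?g i j))))"
    proof (rule sum.cong [OF refl], rule sum.cong [OF refl])
      fix i j
      let ?F = "\<lambda>a b c e. fscale (x i a b * y j c e) (EF N c e j (EF N a b i (?g i j)))"
      have "(\<Sum>a\<in>idx. \<Sum>b\<in>idx. \<Sum>c\<in>idx. \<Sum>e\<in>idx. ?F a b c e) = (\<Sum>c\<in>idx. \<Sum>a\<in>idx. \<Sum>b\<in>idx. \<Sum>e\<in>idx. ?F a b c e)"
        by (rule sum_swap_3)
      also have "\<dots> = (\<Sum>c\<in>idx. \<Sum>e\<in>idx. \<Sum>a\<in>idx. \<Sum>b\<in>idx. ?F a b c e)"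
        by (rule sum.cong [OF refl], rule sum_swap_3)
      finally show "(\<Sum>a\<in>idx. \<Sum>b\<in>idx. \<Sum>c\<in>idx. \<Sum>e\<in>idx. ?F a b c e) = (\<Sum>c\<in>idx. \<Sum>e\<in>idx. \<Sum>a\<in>idx. \<Sum>b\<in>idx. ?F a b c e)" .
    qed
    also have "\<dots> = cact N r y (cact N r x f) d"
      unfolding cact_cact by (intro sum.cong refl) (simp add: mult.commute add.commute)
    finally show ?thesis .
  qed
  finally show ?thesis by (simp add: fun_eq_iff)
qed

lemma cact_br: "cact N r (br r x y) f = cact N r x (cact N r y f) - cact N r y (cact N r x f)"
proof (rule ext)
  fix d
  have half: "half x y f d = (\<Sum>k\<le>d. \<Sum>i\<le>k. \<Sum>a\<in>idx. \<Sum>e\<in>idx. \<Sum>b\<in>idx. fscale (x i a b * y (k - i) b e) (EF N a e k (f (d - k))))" for x y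
  proof -
    have "half x y f d = (\<Sum>(i, j)\<in>{(i, j). i + j \<le> d}. \<Sum>a\<in>idx. \<Sum>b\<in>idx. \<Sum>e\<in>idx. fscale (x i a b * y j b e) (EF N a e (i + j) (f (d - i - j))))"
      unfolding half_def by (subst sum.Sigma) (auto intro!: sum.cong simp: Sigma_def)
    also have "\<dots> = (\<Sum>k\<le>d. \<Sum>i\<le>k. \<Sum>a\<in>idx. \<Sum>b\<in>idx. \<Sum>e\<in>idx. fscale (x i a b * y (k - i) b e) (EF N a e (i + (k - i)) (f (d - i - (k - i)))))"
      by (rule sum.triangle_reindex_eq)
    also have "\<dots> = (\<Sum>k\<le>d. \<Sum>i\<le>k. \<Sum>a\<in>idx. \<Sum>b\<in>idx. \<Sum>e\<in>idx. fscale (x i a b * y (k - i) b e) (EF N a e k (f (d - k))))"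
      by (intro sum.cong refl) simp
    also have "\<dots> = (\<Sum>k\<le>d. \<Sum>i\<le>k. \<Sum>a\<in>idx. \<Sum>e\<in>idx. \<Sum>b\<in>idx. fscale (x i a b * y (k - i) b e) (EF N a e k (f (d - k))))"
      by (intro sum.cong refl sum.swap)
    finally show ?thesis .
  qed
  have "cact N r (br r x y) f d
      = (\<Sum>k\<le>d. \<Sum>a\<in>idx. \<Sum>e\<in>idx. \<Sum>i\<le>k. \<Sum>b\<in>idx. fscale (x i a b * y (k - i) b e - y i a b * x (k - i) b e) (EF N a e k (f (d - k))))"
    unfolding cact_def br_def atLeast0AtMost fock.scale_sum_left ..
  also have "\<dots> = (\<Sum>k\<le>d. \<Sum>i\<le>k. \<Sum>a\<in>idx. \<Sum>e\<in>idx. \<Sum>b\<in>idx. fscale (x i a b * y (k - i) b e - y i a b * x (k - i) b e) (EF N a e k (f (d - k))))"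
  proof (rule sum.cong [OF refl])
    fix k
    let ?F = "\<lambda>a e i. \<Sum>b\<in>idx. fscale (x i a b * y (k - i) b e - y i a b * x (k - i) b e) (EF N a e k (f (d - k)))"
    have "(\<Sum>a\<in>idx. \<Sum>e\<in>idx. \<Sum>i\<le>k. ?F a e i) = (\<Sum>a\<in>idx. \<Sum>i\<le>k. \<Sum>e\<in>idx. ?F a e i)"
      by (intro sum.cong refl sum.swap)
    also have "\<dots> = (\<Sum>i\<le>k. \<Sum>a\<in>idx. \<Sum>e\<in>idx. ?F a e i)"
      by (rule sum.swap)
    finally show "(\<Sum>a\<in>idx. \<Sum>e\<in>idx. \<Sum>i\<le>k. ?F a e i) = (\<Sum>i\<le>k. \<Sum>a\<in>idx. \<Sum>e\<in>idx. ?F a e i)" .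
  qed
  also have "\<dots> = half x y f d - half y x f d"
    unfolding half by (simp only: fock.scale_left_diff_distrib sum_subtractf)
  also have "\<dots> = cact N r x (cact N r y f) d - cact N r y (cact N r x f) d"
    by (rule cact_commutator [symmetric])
  finally show "cact N r (br r x y) f d = (cact N r x (cact N r y f) - cact N r y (cact N r x f)) d"
    by simp
qed

end

interpretation tens_graded: vector_space_pair smul gscale ..

lemma inj_tmono: "inj tmono"
  by (rule injI) (metis tmono_def zero_neq_one)

lemma independent_tmono: "tens.independent (range tmono)"
  unfolding tens.independent_explicit_module
proof (intro allI impI)
  fix t c v assume t: "finite t" "t \<subseteq> range tmono" "(\<Sum>v\<in>t. smul (c v) v) = 0" "v \<in> t"
  then obtain w where w: "v = tmono w" by blast
  have "smul (c u) u w = (if u = v then c v else 0)" if u: "u \<in> t" for u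
  proof -
    obtain w' where w': "u = tmono w'" using u t(2) by blast
    show ?thesis
      unfolding w w' using injD [OF inj_tmono, of w' w] by (auto simp: smul_def tmono_def)
  qed
  then have "(\<Sum>u\<in>t. smul (c u) u w) = c v"
    using t by simp
  moreover have "(\<Sum>u\<in>t. smul (c u) u w) = (\<Sum>v\<in>t. smul (c v) v) w"
    by (induction t rule: infinite_finite_induct) simp_all
  ultimately show "c v = 0" using t(3) by simp
qed

lemma cact_xminus:
  assumes "1 \<le> b" "b < a" "a \<le> r + 1"
  shows "cact N r (xminus b (a - 1) k) f d = (if k \<le> d then EF N a b k (f (d - k)) else 0)"
proof -
  have "cact N r (xminus b (a - 1) k) f d = (\<Sum>k'\<le>d. if k' = k then \<Sum>a'\<in>{1..r+1}. if a' = a then \<Sum>b'\<in>{1..r+1}. if b' = b then EF N a b k (f (d - k)) else 0 else 0 else 0)"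
    unfolding cact_def
  proof (rule sum.cong [OF refl])
    fix k'
    show "(\<Sum>a'\<in>{1..r+1}. \<Sum>b'\<in>{1..r+1}. fscale (xminus b (a - 1) k k' a' b') (EF N a' b' k' (f (d - k'))))
      = (if k' = k then \<Sum>a'\<in>{1..r+1}. if a' = a then \<Sum>b'\<in>{1..r+1}. if b' = b then EF N a b k (f (d - k)) else 0 else 0 else 0)"
    proof (cases "k' = k")
      case True
      show ?thesis
        unfolding True if_P [OF refl]
      proof (rule sum.cong [OF refl])
        fix a'
        show "(\<Sum>b'\<in>{1..r+1}. fscale (xminus b (a - 1) k k a' b') (EF N a' b' k (f (d - k))))
          = (if a' = a then \<Sum>b'\<in>{1..r+1}. if b' = b then EF N a b k (f (d - k)) else 0 else 0)"
        proof (cases "a' = a")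
          case True
          show ?thesis
            unfolding True if_P [OF refl] by (rule sum.cong [OF refl]) (use assms in \<open>simp add: xminus_def\<close>)
        qed (use assms in \<open>simp add: xminus_def del: sum.cl_ivl_Suc\<close>)
      qed
    qed (simp add: xminus_def del: sum.cl_ivl_Suc)
  qed
  then show ?thesis
    using assms by (simp only: sum.delta finite_atLeastAtMost finite_atMost) simp
qed

section \<open>The Fock model with m_i points of type i\<close>

locale graded_model =
  fixes N r :: nat and m \<tau> :: "nat \<Rightarrow> nat"
  assumes \<tau>: "p < N \<Longrightarrow> 1 \<le> \<tau> p \<and> \<tau> p \<le> r"
    and m: "1 \<le> i \<Longrightarrow> i \<le> r \<Longrightarrow> m i = card {p. p < N \<and> \<tau> p = i}"
begin

definition S0 :: "nat set" where
  "S0 = {mode p a |p a. p < N \<and> 1 \<le> a \<and> a \<le> \<tau> p}"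

lemma mode_S0: "mode p a \<in> S0 \<longleftrightarrow> p < N \<and> 1 \<le> a \<and> a \<le> \<tau> p"
  by (auto simp: S0_def)

lemma highest: "fock_highest N r \<tau> S0"
  by unfold_locales (use \<tau> in \<open>force simp: mode_S0\<close>)+

lemma EF_upper: "1 \<le> a \<Longrightarrow> a < b \<Longrightarrow> EF N a b k (ev S0) = 0"
proof -
  assume "1 \<le> a" "a < b"
  then have "hop (mode p a) (mode p b) (ev S0) = 0" for p
    by (auto simp: hop_ev mode_S0)
  then show ?thesis by (simp add: EF_def)
qed

text \<open>For k > 0 the eigenvalue is a power sum of points and in general not 0. This is the Weyl
  relation that fails without the degree filtration.\<close>

lemma EF_diag: "1 \<le> a \<Longrightarrow> EF N a a k (ev S0) = fscale (\<Sum>p | p < N \<and> a \<le> \<tau> p. of_nat p ^ k) (ev S0)"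
proof -
  assume a: "1 \<le> a"
  have sg: "sg x S * sg x S = 1" for x S
    using sg_square [of x S 1] by simp
  have "fscale (of_nat p ^ k) (hop (mode p a) (mode p a) (ev S0)) = (if a \<le> \<tau> p then fscale (of_nat p ^ k) (ev S0) else 0)"
    if "p \<in> {..<N}" for p
    using that a by (auto simp: hop_ev mode_S0 insert_absorb sg_remove insert_Diff sg)
  then have "EF N a a k (ev S0) = (\<Sum>p<N. if a \<le> \<tau> p then fscale (of_nat p ^ k) (ev S0) else 0)"
    unfolding EF_def by (rule sum.cong [OF refl])
  also have "\<dots> = (\<Sum>p | p < N \<and> a \<le> \<tau> p. fscale (of_nat p ^ k) (ev S0))"
    by (rule sum.inter_filter [symmetric, of "{..<N}", simplified])
  finally show ?thesis by (simp add: fock.scale_sum_left)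
qed

text \<open>Each application of \<open>E\<^bsub>i+1,i\<^esub>\<close> uses up a block in which the mode \<open>i\<close> can still be raised.\<close>
lemma EF_power:
  assumes i: "1 \<le> i" "i \<le> r"
  shows "(EF N (Suc i) i 0 ^^ Suc (m i)) (ev S0) = 0"
proof -
  define c where "c U = card {p. p < N \<and> mode p i \<in> U \<and> mode p (Suc i) \<notin> U}" for U
  have "(EF N (Suc i) i 0 ^^ n) (ev S0) U \<noteq> 0 \<Longrightarrow> c U + n \<le> m i" for n U
  proof (induction n arbitrary: U)
    case 0
    then have "U = S0" by (simp add: ev_def split: if_splits)
    then have "{p. p < N \<and> mode p i \<in> U \<and> mode p (Suc i) \<notin> U} = {p. p < N \<and> \<tau> p = i}"
      using i by (auto simp: mode_S0)
    then show ?case using m [OF i] by (simp add: c_def)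
  next
    case (Suc n)
    let ?f = "(EF N (Suc i) i 0 ^^ n) (ev S0)"
    from Suc.prems have "\<exists>p. p < N \<and> hop (mode p (Suc i)) (mode p i) ?f U \<noteq> 0"
      unfolding funpow.simps o_apply EF_apply by (rule contrapos_np) (auto intro: sum.neutral)
    then obtain p where p: "p < N" "hop (mode p (Suc i)) (mode p i) ?f U \<noteq> 0" by blast
    let ?U = "insert (mode p i) (U - {mode p (Suc i)})"
    from p(2) have U: "mode p (Suc i) \<in> U" "mode p i \<notin> U" "?f ?U \<noteq> 0"
      by (auto simp: hop_apply split: if_splits)
    have "{q. q < N \<and> mode q i \<in> ?U \<and> mode q (Suc i) \<notin> ?U} = insert p {q. q < N \<and> mode q i \<in> U \<and> mode q (Suc i) \<notin> U}"
      using p U by auto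
    then have "c ?U = Suc (c U)"
      using U by (simp add: c_def)
    then show ?case using Suc.IH [OF U(3)] by simp
  qed
  from this [of "Suc (m i)"] show ?thesis by (force simp: fun_eq_iff)
qed

definition v0 :: graded where
  "v0 d = (if d = 0 then ev S0 else 0)"

abbreviation actw :: "cur list \<Rightarrow> graded \<Rightarrow> graded" where
  "actw \<equiv> foldr (cact N r)"

lemma endo_actw: "graded.endo (actw u)"
  by (rule graded.endo_foldr) (rule endo_cact)

text \<open>What can be reached from \<open>v0\<close> in degree below d, with the degree forgotten.
  Working modulo \<open>L\<close> amounts to passing to the associated graded module.\<close>

definition lower :: "nat \<Rightarrow> fock set" where
  "lower d = fock.span {actw u v0 d' |u d'. u \<in> lists (gt r) \<and> d' < d}"

definition L :: "graded set" where
  "L = {f. \<forall>d. f d \<in> lower d}"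

lemma subspace_lower: "fock.subspace (lower d)"
  by (simp add: lower_def)

lemma subspace_L: "graded.subspace L"
  by (rule graded.subspaceI)
    (auto simp: L_def gscale_def intro: fock.subspace_0 fock.subspace_add fock.subspace_scale subspace_lower)

lemma gt_component: "x \<in> gt r \<Longrightarrow> (\<lambda>k'. if k' = k then x k else 0) \<in> gt r"
  by (rule gtI [of "Suc k"]) (use gtD [of x r] in \<open>auto split: if_splits\<close>)

text \<open>The degree k component of \<open>x\<close> is itself a current in \<open>gt r\<close>.
  It takes a vector reached in degree d' < d - k to one reached in degree d' + k < d.\<close>

lemma cact_L:
  assumes x: "x \<in> gt r" and f: "f \<in> L"
  shows "cact N r x f \<in> L"
  unfolding L_def
proof (intro CollectI allI)
  fix d
  let ?\<Theta> = "\<lambda>k v. \<Sum>a\<in>{1..r+1}. \<Sum>b\<in>{1..r+1}. fscale (x k a b) (EF N a b k v)"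
  have "?\<Theta> k (f (d - k)) \<in> lower d" if k: "k \<le> d" for k
  proof (rule fock.endo_span [of "?\<Theta> k"])
    show "fock.endo (?\<Theta> k)"
      by (rule fock.endoI) (simp_all add: fock.endo_add [OF endo_EF] fock.endo_scale [OF endo_EF] fock.scale_right_distrib
        sum.distrib fock.scale_sum_right fock.scale_left_commute mult.commute del: sum.cl_ivl_Suc)
    show "f (d - k) \<in> fock.span {actw u v0 d' |u d'. u \<in> lists (gt r) \<and> d' < d - k}"
      using f by (simp add: L_def lower_def)
    fix v assume "v \<in> {actw u v0 d' |u d'. u \<in> lists (gt r) \<and> d' < d - k}"
    then obtain u d' where v: "v = actw u v0 d'" "u \<in> lists (gt r)" "d' < d - k" by blast
    let ?x = "\<lambda>k'. if k' = k then x k else 0"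
    have "actw (?x # u) v0 (d' + k) = cact N r ?x (actw u v0) (d' + k)" by simp
    also have "\<dots> = (\<Sum>k'\<le>d' + k. if k' = k then ?\<Theta> k v else 0)"
      unfolding cact_def [of N r ?x "actw u v0"] by (rule sum.cong [OF refl]) (auto simp: v(1) simp del: sum.cl_ivl_Suc)
    also have "\<dots> = ?\<Theta> k v"
      unfolding sum.delta [OF finite_atMost] by simp
    finally have "?\<Theta> k v = actw (?x # u) v0 (d' + k)" ..
    then show "?\<Theta> k v \<in> lower d"
      unfolding lower_def using v gt_component [OF x, of k]
      by (intro fock.span_base CollectI exI [of _ "?x # u"] exI [of _ "d' + k"]) auto
  qed (rule subspace_lower)
  then show "cact N r x f d \<in> lower d"
    unfolding cact_def [of N r x f] by (intro fock.subspace_sum [OF subspace_lower, of "{..d}"]) (simp only: atMost_iff)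
qed

lemma actw_L: "u \<in> lists (gt r) \<Longrightarrow> f \<in> L \<Longrightarrow> actw u f \<in> L"
  by (induction u rule: list.induct) (auto intro: cact_L)

text \<open>Evaluation of words at \<open>v0\<close>. As \<open>tens\<close> contains functions of
  infinite support, it is defined by linear extension from the independent set of monomials.\<close>

definition Ev :: "tens \<Rightarrow> graded" where
  "Ev = tens_graded.construct (range tmono) (\<lambda>t. actw (inv tmono t) v0)"

lemma Ev_linear: "module_hom smul gscale Ev"
  unfolding Ev_def module_hom_iff_linear by (rule tens_graded.linear_construct [OF independent_tmono])

lemma Ev_tmono: "Ev (tmono u) = actw u v0"
  unfolding Ev_def by (subst tens_graded.construct_basis [OF independent_tmono]) (simp_all add: inj_tmono)

lemmas Ev_simps = module_hom.add [OF Ev_linear] module_hom.diff [OF Ev_linear] module_hom.scale [OF Ev_linear] Ev_tmono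

lemma cact_v0: "cact N r x v0 d = (\<Sum>a\<in>{1..r+1}. \<Sum>b\<in>{1..r+1}. fscale (x d a b) (EF N a b d (ev S0)))"
proof -
  have "cact N r x v0 d = (\<Sum>k\<le>d. if k = d then \<Sum>a\<in>{1..r+1}. \<Sum>b\<in>{1..r+1}. fscale (x d a b) (EF N a b d (ev S0)) else 0)"
    unfolding cact_def
    by (intro sum.cong refl) (auto simp: v0_def fock.endo_0 [OF endo_EF])
  then show ?thesis by simp
qed

lemma lam_conv:
  "lam r m H = (\<Sum>p<N. \<Sum>a\<in>{1..\<tau> p}. H 0 a a)"
proof -
  have "(\<Sum>p<N. \<Sum>a\<in>{1..\<tau> p}. H 0 a a) = (\<Sum>i\<in>{1..r}. \<Sum>p | p \<in> {..<N} \<and> \<tau> p = i. \<Sum>a\<in>{1..\<tau> p}. H 0 a a)"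
    by (rule sum.group [symmetric]) (use \<tau> in auto)
  also have "\<dots> = (\<Sum>i\<in>{1..r}. of_nat (m i) * (\<Sum>a\<in>{1..i}. H 0 a a))"
  proof (rule sum.cong [OF refl])
    fix i assume i: "i \<in> {1..r}"
    have "(\<Sum>p | p \<in> {..<N} \<and> \<tau> p = i. \<Sum>a\<in>{1..\<tau> p}. H 0 a a) = (\<Sum>p | p \<in> {..<N} \<and> \<tau> p = i. \<Sum>a\<in>{1..i}. H 0 a a)"
      by (intro sum.cong) auto
    then show "(\<Sum>p | p \<in> {..<N} \<and> \<tau> p = i. \<Sum>a\<in>{1..\<tau> p}. H 0 a a) = of_nat (m i) * (\<Sum>a\<in>{1..i}. H 0 a a)"
      using m [of i] i by simp
  qed
  finally show ?thesis by (simp add: lam_def)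
qed

lemma cact_diag_v0:
  assumes x: "\<And>k a b. x k a b \<noteq> 0 \<Longrightarrow> a = b"
  shows "cact N r x v0 d = fscale (\<Sum>a\<in>{1..r+1}. x d a a * (\<Sum>p | p < N \<and> a \<le> \<tau> p. of_nat p ^ d)) (ev S0)"
proof -
  have "(\<Sum>b\<in>{1..r+1}. fscale (x d a b) (EF N a b d (ev S0))) = fscale (x d a a * (\<Sum>p | p < N \<and> a \<le> \<tau> p. of_nat p ^ d)) (ev S0)"
    if a: "a \<in> {1..r+1}" for a
  proof -
    have "(\<Sum>b\<in>{1..r+1}. fscale (x d a b) (EF N a b d (ev S0))) = (\<Sum>b\<in>{1..r+1}. if b = a then fscale (x d a a) (EF N a a d (ev S0)) else 0)"
      using x [of d a] by (intro sum.cong) auto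
    then show ?thesis
      using a EF_diag [of a d] by (simp only: sum.delta finite_atLeastAtMost) simp
  qed
  then have "cact N r x v0 d = (\<Sum>a\<in>{1..r+1}. fscale (x d a a * (\<Sum>p | p < N \<and> a \<le> \<tau> p. of_nat p ^ d)) (ev S0))"
    unfolding cact_v0 by (rule sum.cong [OF refl])
  then show ?thesis by (simp only: fock.scale_sum_left)
qed

lemma ev_lower: "0 < d \<Longrightarrow> ev S0 \<in> lower d"
  unfolding lower_def by (intro fock.span_base CollectI exI [of _ "[]"] exI [of _ 0]) (simp add: v0_def)

text \<open>\<open>Kw\<close> contains all left multiples of a relator, hence one \<open>G\<close>
  has to serve for every word u in front. It is 0 except for the positive diagonal currents, where
  its components are multiples of \<open>ev S0\<close> that vanish in degree 0.\<close>

lemma weyl_rel_L: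
  assumes "R \<in> weyl_rel r m"
  shows "\<exists>G\<in>L. \<forall>u. Ev (foldr lm u R) = actw u G"
  using assms unfolding weyl_rel_def Un_iff
proof (elim disjE)
  assume "R \<in> {tmono [x] |x. x \<in> nplus_t r}"
  then obtain x where R: "R = tmono [x]" and x: "x \<in> nplus_t r" by blast
  have "cact N r x v0 d = 0" for d
    unfolding cact_v0
  proof (intro sum.neutral ballI)
    fix a b assume "a \<in> {1..r+1}" "b \<in> {1..r+1}"
    then show "fscale (x d a b) (EF N a b d (ev S0)) = 0"
      using x EF_upper [of a b d] by (cases "x d a b = 0") (auto simp: nplus_t_def)
  qed
  then have "cact N r x v0 = 0" by (simp add: fun_eq_iff)
  then have "Ev (foldr lm u R) = actw u 0" for u
    unfolding R foldr_lm_tmono Ev_tmono by simp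
  then show ?thesis using graded.subspace_0 [OF subspace_L] by blast
next
  assume "R \<in> {tmono [h] |h. h \<in> h_t_pos r}"
  then obtain h where R: "R = tmono [h]" and h: "h \<in> h_t_pos r" by blast
  have diag: "h k a b \<noteq> 0 \<Longrightarrow> a = b" and h0: "h 0 a b = 0" for k a b
    using h by (auto simp: h_t_pos_def)
  have "cact N r h v0 d \<in> lower d" for d
  proof -
    have "cact N r h v0 d = fscale (\<Sum>a\<in>{1..r+1}. h d a a * (\<Sum>p | p < N \<and> a \<le> \<tau> p. of_nat p ^ d)) (ev S0)"
      by (rule cact_diag_v0) (rule diag)
    then show ?thesis
      using ev_lower [of d] fock.subspace_scale [OF subspace_lower] fock.subspace_0 [OF subspace_lower]
      by (cases "d = 0") (simp_all add: h0 del: sum.cl_ivl_Suc)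
  qed
  then have "cact N r h v0 \<in> L" by (simp add: L_def)
  moreover have "Ev (foldr lm u R) = actw u (cact N r h v0)" for u
    unfolding R foldr_lm_tmono Ev_tmono by simp
  ultimately show ?thesis by blast
next
  assume "R \<in> {tmono [h] - smul (lam r m h) (tmono []) |h. h \<in> h0 r}"
  then obtain h where R: "R = tmono [h] - smul (lam r m h) (tmono [])" and h: "h \<in> h0 r" by blast
  have diag: "h k a b \<noteq> 0 \<Longrightarrow> a = b" and h0: "k \<noteq> 0 \<Longrightarrow> h k a b = 0" for k a b
    using h by (auto simp: h0_def)
  have v0: "cact N r h v0 d = fscale (\<Sum>a\<in>{1..r+1}. h d a a * (\<Sum>p | p < N \<and> a \<le> \<tau> p. of_nat p ^ d)) (ev S0)" for d
    by (rule cact_diag_v0) (rule diag)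
  have "cact N r h v0 d = gscale (lam r m h) v0 d" for d
  proof (cases "d = 0")
    case True
    have "(\<Sum>a\<in>{1..r+1}. h 0 a a * (\<Sum>p | p < N \<and> a \<le> \<tau> p. of_nat p ^ 0)) = (\<Sum>a\<in>{1..r+1}. \<Sum>p<N. if a \<le> \<tau> p then h 0 a a else 0)"
    proof (rule sum.cong [OF refl])
      fix a
      have "(\<Sum>p<N. if a \<le> \<tau> p then h 0 a a else 0) = (\<Sum>p | p < N \<and> a \<le> \<tau> p. h 0 a a)"
        by (rule sum.inter_filter [symmetric, of "{..<N}", simplified])
      then show "h 0 a a * (\<Sum>p | p < N \<and> a \<le> \<tau> p. of_nat p ^ 0) = (\<Sum>p<N. if a \<le> \<tau> p then h 0 a a else 0)"
        by simp
    qed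
    also have "\<dots> = (\<Sum>p<N. \<Sum>a\<in>{1..r+1}. if a \<le> \<tau> p then h 0 a a else 0)"
      by (rule sum.swap)
    also have "\<dots> = (\<Sum>p<N. \<Sum>a\<in>{1..\<tau> p}. h 0 a a)"
    proof (rule sum.cong [OF refl])
      fix p assume "p \<in> {..<N}"
      then have "\<tau> p \<le> r" using \<tau> by simp
      then have "{a \<in> {1..r+1}. a \<le> \<tau> p} = {1..\<tau> p}" by auto
      then show "(\<Sum>a\<in>{1..r+1}. if a \<le> \<tau> p then h 0 a a else 0) = (\<Sum>a\<in>{1..\<tau> p}. h 0 a a)"
        by (simp only: sum.inter_filter [symmetric, OF finite_atLeastAtMost])
    qed
    finally show ?thesis
      unfolding v0 True gscale_def v0_def lam_conv by simp
  next
    case False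
    then show ?thesis
      unfolding v0 gscale_def v0_def by (simp add: h0 del: sum.cl_ivl_Suc)
  qed
  then have "cact N r h v0 = gscale (lam r m h) v0" by (rule ext)
  then have "Ev (foldr lm u R) = actw u 0" for u
    by (simp add: R tens.endo_diff [OF endo_foldr_lm] tens.endo_scale [OF endo_foldr_lm] foldr_lm_tmono Ev_simps
      graded.endo_scale [OF endo_actw] graded.endo_0 [OF endo_actw])
  then show ?thesis using graded.subspace_0 [OF subspace_L] by blast
next
  assume "R \<in> {tmono (replicate (m i + 1) (xminus i i 0)) |i. i \<in> {1..r}}"
  then obtain i where i: "i \<in> {1..r}" and R: "R = tmono (replicate (m i + 1) (xminus i i 0))" by blast
  have step: "cact N r (xminus i i 0) f d = EF N (Suc i) i 0 (f d)" for f d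
    using cact_xminus [of i "Suc i" r N 0] i by simp
  have "actw (replicate n (xminus i i 0)) v0 d = (EF N (Suc i) i 0 ^^ n) (v0 d)" for n d
    by (induction n) (simp_all add: step)
  from this [of "Suc (m i)"] have "actw (replicate (m i + 1) (xminus i i 0)) v0 d = 0" for d
    using EF_power [of i] i fock.endo_0 [OF endo_EF] fock.endo_0 [OF fock.endo_funpow [OF endo_EF]]
    unfolding Suc_eq_plus1 [symmetric] v0_def by (cases "d = 0") auto
  then have "actw (replicate (m i + 1) (xminus i i 0)) v0 = 0"
    by (simp add: fun_eq_iff)
  then have "Ev (foldr lm u R) = actw u 0" for u
    unfolding R foldr_lm_tmono Ev_tmono foldr_append by simp
  then show ?thesis using graded.subspace_0 [OF subspace_L] by blast
qed

lemma Ev_Kw: "F \<in> Kw r m \<Longrightarrow> Ev F \<in> L"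
proof (induction rule: Kw.induct)
  case zero
  have "Ev (\<lambda>_. 0) = 0"
    using module_hom.zero [OF Ev_linear] by (simp add: zero_fun_def)
  then show ?case by (rule ssubst) (rule graded.subspace_0 [OF subspace_L])
next
  case (add F G)
  show ?case unfolding Ev_simps by (rule graded.subspace_add [OF subspace_L add.IH])
next
  case (smult F c)
  show ?case unfolding Ev_simps by (rule graded.subspace_scale [OF subspace_L smult.IH])
next
  case (lin_add x y u v)
  have "Ev (tmul (tmul (tmono u) (tmono [x + y] - tmono [x] - tmono [y])) (tmono v))
      = actw u (cact N r (x + y) (actw v v0) - cact N r x (actw v v0) - cact N r y (actw v v0))"
    unfolding relator_expand tens.endo_diff [OF endo_foldr_lm] foldr_lm_tmono Ev_simps graded.endo_diff [OF endo_actw]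
    by simp
  also have "\<dots> = 0"
    by (simp add: cact_add graded.endo_0 [OF endo_actw])
  finally show ?case by (rule ssubst) (rule graded.subspace_0 [OF subspace_L])
next
  case (lin_smult x u v c)
  have "Ev (tmul (tmul (tmono u) (tmono [cscale c x] - smul c (tmono [x]))) (tmono v))
      = actw u (cact N r (cscale c x) (actw v v0) - gscale c (cact N r x (actw v v0)))"
    unfolding relator_expand tens.endo_diff [OF endo_foldr_lm] tens.endo_scale [OF endo_foldr_lm] foldr_lm_tmono
      Ev_simps graded.endo_diff [OF endo_actw] graded.endo_scale [OF endo_actw]
    by simp
  also have "\<dots> = 0"
    by (simp add: cact_scale graded.endo_0 [OF endo_actw])
  finally show ?case by (rule ssubst) (rule graded.subspace_0 [OF subspace_L])
next
  case (lie x y u v)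
  have "Ev (tmul (tmul (tmono u) (tmono [x, y] - tmono [y, x] - tmono [br r x y])) (tmono v))
      = actw u (cact N r x (cact N r y (actw v v0)) - cact N r y (cact N r x (actw v v0)) - cact N r (br r x y) (actw v v0))"
    unfolding relator_expand tens.endo_diff [OF endo_foldr_lm] foldr_lm_tmono Ev_simps graded.endo_diff [OF endo_actw]
    by simp
  also have "\<dots> = 0"
    by (simp add: cact_br graded.endo_0 [OF endo_actw])
  finally show ?case by (rule ssubst) (rule graded.subspace_0 [OF subspace_L])
next
  case (weyl R u)
  obtain G where "G \<in> L" "Ev (foldr lm u R) = actw u G"
    using weyl_rel_L [OF weyl(1)] by blast
  then show ?case
    using actw_L [OF weyl(2)] by (simp add: tmul_tmono)
qed

end

section \<open>Combining spanning with independence in the Fock space\<close>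

lemma Bset_expansion:
  assumes "u \<in> lists (gt r)"
  shows "\<exists>A c. finite A \<and> A \<subseteq> Bset r m \<and> tmono u - (\<Sum>w\<in>A. smul (c w) (tmono w)) \<in> Kw r m"
proof -
  have "tmono u \<in> {x + y |x y. x \<in> tens.span (tmono ` Bset r m) \<and> y \<in> tens.span (Kw r m)}"
    using tmono_spanned_by_Bset [OF assms] unfolding tens.span_Un by blast
  then obtain x y where xy: "tmono u = x + y" "x \<in> tens.span (tmono ` Bset r m)" "y \<in> Kw r m"
    unfolding tens.span_eq_iff [THEN iffD2, OF subspace_Kw] by blast
  from xy(2) obtain t q where t: "finite t" "t \<subseteq> tmono ` Bset r m" "x = (\<Sum>a\<in>t. smul (q a) a)"
    unfolding tens.span_explicit by blast
  from finite_subset_image [OF t(1,2)] obtain A where A: "A \<subseteq> Bset r m" "finite A" "t = tmono ` A"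
    by blast
  have "x = (\<Sum>w\<in>A. smul (q (tmono w)) (tmono w))"
    unfolding t(3) A(3) by (simp add: sum.reindex [OF inj_on_subset [OF inj_tmono subset_UNIV]])
  then have "tmono u - (\<Sum>w\<in>A. smul (q (tmono w)) (tmono w)) = y"
    using xy(1) by simp
  then show ?thesis using A xy(3) by (intro exI [of _ A] exI [of _ "\<lambda>w. q (tmono w)"]) simp
qed

definition wdeg :: "(nat \<times> nat \<times> nat) list \<Rightarrow> nat" where
  "wdeg e = sum_list (map (\<lambda>(a, b, k). k) e)"

lemma set_lower_word: "(a, b, k) \<in> set (lower_word r S) \<Longrightarrow> 1 \<le> b \<and> b < a \<and> a \<le> r + 1"
  by (auto simp: lower_word_def)

lemma inj_cur_word: "inj_on cur_word (range (lower_word r))"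
proof (rule inj_onI)
  fix e e' assume e: "e \<in> range (lower_word r)" "e' \<in> range (lower_word r)" "cur_word e = cur_word e'"
  have letter: "1 \<le> b \<and> b < a" if "(a, b, k) \<in> set e \<or> (a, b, k) \<in> set e'" for a b k
    using that e(1,2) set_lower_word by blast
  have "inj_on (\<lambda>(a, b, k). xminus b (a - 1) k) (set e \<union> set e')"
  proof (rule inj_onI, clarsimp)
    fix a b k a' b' k'
    assume *: "(a, b, k) \<in> set e \<or> (a, b, k) \<in> set e'" "(a', b', k') \<in> set e \<or> (a', b', k') \<in> set e'"
      and eq: "xminus b (a - Suc 0) k = xminus b' (a' - Suc 0) k'"
    have "1 \<le> a" "1 \<le> a'"
      using letter [OF *(1)] letter [OF *(2)] by simp_all
    moreover from eq have "xminus b (a - Suc 0) k k a b = xminus b' (a' - Suc 0) k' k a b"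
      by simp
    ultimately show "a = a' \<and> b = b' \<and> k = k'"
      by (auto simp: xminus_def split: if_splits)
  qed
  then show "e = e'"
    using e(3) unfolding cur_word_def by (rule map_inj_on [rotated])
qed

context graded_model
begin

definition BL :: "(nat \<times> nat \<times> nat) list set" where
  "BL = {lower_word r S |S. admissible r m S}"

abbreviation bv :: "(nat \<times> nat \<times> nat) list \<Rightarrow> fock" where
  "bv e \<equiv> act (EF N) e (ev S0)"

lemma actw_cur_word:
  assumes "\<And>a b k. (a, b, k) \<in> set e \<Longrightarrow> 1 \<le> b \<and> b < a \<and> a \<le> r + 1"
  shows "actw (cur_word e) v0 d = (if d = wdeg e then bv e else 0)"
  using assms
proof (induction e arbitrary: d)
  case Nil
  then show ?case by (simp add: cur_word_def wdeg_def v0_def)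
next
  case (Cons x e)
  obtain a b k where x: "x = (a, b, k)" by (cases x)
  have ab: "1 \<le> b" "b < a" "a \<le> r + 1" using Cons.prems [of a b k] x by auto
  have IH: "actw (cur_word e) v0 d = (if d = wdeg e then bv e else 0)" for d
    by (rule Cons.IH) (metis Cons.prems list.set_intros(2))
  have "actw (cur_word (x # e)) v0 d = cact N r (xminus b (a - 1) k) (actw (cur_word e) v0) d"
    by (simp add: x cur_word_def)
  also have "\<dots> = (if k \<le> d then EF N a b k (if d - k = wdeg e then bv e else 0) else 0)"
    unfolding cact_xminus [OF ab] IH ..
  also have "\<dots> = (if d = wdeg (x # e) then bv (x # e) else 0)"
    by (auto simp: x wdeg_def fock.endo_0 [OF endo_EF])
  finally show ?case .
qed

lemma Ev_sum_Bset:
  assumes A: "finite A" "A \<subseteq> Bset r m"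
  shows "finite {e \<in> BL. cur_word e \<in> A \<and> wdeg e = d}"
    and "Ev (\<Sum>w\<in>A. smul (c w) (tmono w)) d
      = (\<Sum>e | e \<in> BL \<and> cur_word e \<in> A \<and> wdeg e = d. fscale (c (cur_word e)) (bv e))"
proof -
  let ?A = "{e \<in> BL. cur_word e \<in> A}"
  have inj: "inj_on cur_word ?A"
    by (rule inj_on_subset [OF inj_cur_word [of r]]) (auto simp: BL_def)
  have im: "cur_word ` ?A = A"
    using A(2) unfolding Bset_conv BL_def by blast
  then have fin: "finite ?A"
    using A(1) finite_imageD [OF _ inj] by simp
  then show "finite {e \<in> BL. cur_word e \<in> A \<and> wdeg e = d}"
    by (rule rev_finite_subset) blast
  have "Ev (\<Sum>w\<in>A. smul (c w) (tmono w)) d = (\<Sum>w\<in>A. Ev (smul (c w) (tmono w))) d"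
    unfolding module_hom.sum [OF Ev_linear] ..
  also have "\<dots> = (\<Sum>w\<in>A. fscale (c w) (actw w v0 d))"
    using A(1) by induction (simp_all add: Ev_simps gscale_def)
  also have "\<dots> = (\<Sum>e\<in>?A. fscale (c (cur_word e)) (actw (cur_word e) v0 d))"
    by (subst im [symmetric]) (simp add: sum.reindex [OF inj] del: im)
  also have "\<dots> = (\<Sum>e\<in>?A. if wdeg e = d then fscale (c (cur_word e)) (bv e) else 0)"
  proof (rule sum.cong [OF refl])
    fix e assume "e \<in> ?A"
    then obtain S where "e = lower_word r S" by (auto simp: BL_def)
    then have "actw (cur_word e) v0 d = (if d = wdeg e then bv e else 0)"
      using set_lower_word by (intro actw_cur_word) blast
    then show "fscale (c (cur_word e)) (actw (cur_word e) v0 d) = (if wdeg e = d then fscale (c (cur_word e)) (bv e) else 0)"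
      by auto
  qed
  also have "\<dots> = (\<Sum>e | e \<in> ?A \<and> wdeg e = d. fscale (c (cur_word e)) (bv e))"
    by (rule sum.inter_filter [symmetric, OF fin])
  finally show "Ev (\<Sum>w\<in>A. smul (c w) (tmono w)) d
      = (\<Sum>e | e \<in> BL \<and> cur_word e \<in> A \<and> wdeg e = d. fscale (c (cur_word e)) (bv e))"
    by (simp add: conj_assoc)
qed

text \<open>Here independence uses spanning: modulo \<open>Kw\<close> every word is a combination of
  basis words, and in degree d' this reads as basis words of degree exactly d' up to an error in
  \<open>lower d'\<close>, which the induction covers.\<close>

lemma lower_span: "lower d \<subseteq> fock.span (bv ` {e \<in> BL. wdeg e < d})"
proof (induction d rule: less_induct)
  case (less d)
  show ?case
    unfolding lower_def
  proof (rule fock.span_minimal [OF subsetI fock.subspace_span])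
    fix v assume "v \<in> {actw u v0 d' |u d'. u \<in> lists (gt r) \<and> d' < d}"
    then obtain u d' where v: "v = actw u v0 d'" "u \<in> lists (gt r)" "d' < d" by blast
    let ?X = "fock.span (bv ` {e \<in> BL. wdeg e < d})"
    obtain A c where A: "finite A" "A \<subseteq> Bset r m" "tmono u - (\<Sum>w\<in>A. smul (c w) (tmono w)) \<in> Kw r m"
      using Bset_expansion [OF v(2)] by blast
    let ?s = "\<Sum>e | e \<in> BL \<and> cur_word e \<in> A \<and> wdeg e = d'. fscale (c (cur_word e)) (bv e)"
    have "Ev (tmono u - (\<Sum>w\<in>A. smul (c w) (tmono w))) d' = v - ?s"
      by (simp only: module_hom.diff [OF Ev_linear] Ev_tmono fun_diff_def [of "actw u v0"] Ev_sum_Bset(2) [OF A(1,2)] v(1))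
    moreover have "Ev (tmono u - (\<Sum>w\<in>A. smul (c w) (tmono w))) d' \<in> lower d'"
      using Ev_Kw [OF A(3)] by (simp add: L_def)
    moreover have "lower d' \<subseteq> ?X"
      using v(3) by (intro order_trans [OF less [OF v(3)] fock.span_mono]) auto
    ultimately have "v - ?s \<in> ?X" by auto
    moreover have "?s \<in> ?X"
      using v(3) by (intro fock.span_sum fock.span_scale fock.span_base) auto
    ultimately have "(v - ?s) + ?s \<in> ?X" by (rule fock.span_add)
    then show "v \<in> ?X" by simp
  qed
qed

text \<open>In the degree of a chosen word \<open>e0\<close>, the relation says that basis words of
  this degree combine to a vector in the span of basis words of smaller degree. The two families are
  disjoint, so this is a relation among distinct words in the Fock space.\<close>

lemma Bset_independent:
  assumes A: "finite A" "A \<subseteq> Bset r m" "(\<Sum>w\<in>A. smul (c w) (tmono w)) \<in> Kw r m" and w: "w \<in> A"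
  shows "c w = 0"
proof -
  obtain e0 where e0: "w = cur_word e0" "e0 \<in> BL"
    using w A(2) unfolding Bset_conv BL_def by blast
  let ?d = "wdeg e0"
  let ?D = "{e \<in> BL. cur_word e \<in> A \<and> wdeg e = ?d}"
  let ?s = "\<Sum>e\<in>?D. fscale (c (cur_word e)) (bv e)"
  have "?s \<in> lower ?d"
    using Ev_Kw [OF A(3)] unfolding L_def mem_Collect_eq Ev_sum_Bset(2) [OF A(1,2), symmetric] by blast
  then have "?s \<in> fock.span (bv ` {e \<in> BL. wdeg e < ?d})"
    using lower_span by blast
  then obtain t q where t: "finite t" "t \<subseteq> bv ` {e \<in> BL. wdeg e < ?d}" "?s = (\<Sum>a\<in>t. fscale (q a) a)"
    unfolding fock.span_explicit by blast
  from t(2) obtain C where C: "C \<subseteq> {e \<in> BL. wdeg e < ?d}" "inj_on bv C" "t = bv ` C"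
    unfolding subset_image_inj by blast
  have finC: "finite C"
    using finite_imageD [OF _ C(2)] t(1) C(3) by blast
  have finD: "finite ?D"
    by (rule Ev_sum_Bset(1) [OF A(1,2)])
  have e0': "e0 \<in> ?D \<union> C"
    using e0 w by blast
  have disj: "?D \<inter> C = {}"
    using C(1) by auto
  \<comment> \<open>\<open>C\<close> selects one word for each vector used from the span, so the
    coefficients \<open>q\<close> of vectors can be read as coefficients of words.\<close>
  let ?c = "\<lambda>e. if wdeg e = ?d then c (cur_word e) else - q (bv e)"
  have "(\<Sum>e\<in>?D \<union> C. fscale (?c e) (bv e)) = (\<Sum>e\<in>?D. fscale (?c e) (bv e)) + (\<Sum>e\<in>C. fscale (?c e) (bv e))"
    by (rule sum.union_disjoint [OF finD finC disj])
  also have "(\<Sum>e\<in>?D. fscale (?c e) (bv e)) = ?s"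
    by (rule sum.cong [OF refl]) simp
  also have "(\<Sum>e\<in>C. fscale (?c e) (bv e)) = (\<Sum>e\<in>C. - fscale (q (bv e)) (bv e))"
    by (rule sum.cong [OF refl]) (use C(1) in auto)
  also have "\<dots> = - ?s"
    unfolding t(3) C(3) sum_negf by (simp add: sum.reindex [OF C(2)])
  finally have "(\<Sum>e\<in>?D \<union> C. fscale (?c e) (bv e)) = 0"
    by (simp only: right_minus)
  moreover have "?D \<union> C \<subseteq> {lower_word r S' |S'. admissible r m S'}"
    using C(1) unfolding BL_def by blast
  ultimately have "?c e0 = 0"
    using lower_words_independent [OF highest, of m "?D \<union> C" ?c e0] m finite_UnI [OF finD finC] e0' by blast
  then show ?thesis using e0(1) by simp
qed

end

lemma graded_model_exists:
  obtains N \<tau> where "graded_model N r m \<tau>"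
proof
  define xs where "xs = concat (map (\<lambda>i. replicate (m i) i) [1..<r + 1])"
  have rep: "count_list (replicate n x) y = (if x = y then n else 0)" for n and x y :: nat
    by (induction n) auto
  have count: "count_list (concat (map (\<lambda>i. replicate (m i) i) [1..<r + 1])) i = (if i \<in> {1..r} then m i else 0)" for i
    by (induction r) (auto simp: rep)
  show "graded_model (length xs) r m ((!) xs)"
  proof
    show "1 \<le> xs ! p \<and> xs ! p \<le> r" if "p < length xs" for p
      using nth_mem [OF that] unfolding xs_def by auto
    show "m i = card {p. p < length xs \<and> xs ! p = i}" if "1 \<le> i" "i \<le> r" for i
    proof -
      have "card {p. p < length xs \<and> xs ! p = i} = count_list xs i"
        by (simp add: count_list_eq_length_filter length_filter_conv_card eq_commute)
      then show ?thesis
        using count [of i] that unfolding xs_def by simp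
    qed
  qed
qed

theorem theorem2p1:
  fixes r :: nat and m :: "nat \<Rightarrow> nat"
  assumes "r \<ge> 1"
  shows "(\<forall>A c. finite A \<and> A \<subseteq> Bset r m \<and> (\<Sum>w\<in>A. smul (c w) (tmono w)) \<in> Kw r m
              \<longrightarrow> (\<forall>w\<in>A. c w = 0))
       \<and> (\<forall>u \<in> lists (gt r). \<exists>A c. finite A \<and> A \<subseteq> Bset r m
              \<and> tmono u - (\<Sum>w\<in>A. smul (c w) (tmono w)) \<in> Kw r m)"
proof -
  \<comment> \<open>Coefficients are indexed by words and not by their classes. Two distinct words
    with the same class would give a relation with coefficients 1 and - 1, so independence includes
    that distinct words give distinct basis vectors.\<close>
  obtain N \<tau> where "graded_model N r m \<tau>" by (rule graded_model_exists)
  then show ?thesis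
    using graded_model.Bset_independent [of N r m \<tau>] Bset_expansion [of _ r m] by (intro conjI allI impI ballI) auto
qed

end
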